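(* Let $p\geq 5$ be a prime and let $k$ be a natural number with $p<k+1$. Suppose further that $k+1\equiv a \pmod p$ with $2\leq a\leq p-2$. Then the number of conjugacy classes of admissible subgroups of order $p$ in $\mathrm{PGL}_{k+1}(\mathbb{C})$ is the same as the number of conjugacy classes of admissible subgroups of order $p$ in $\mathrm{PGL}_{a}(\mathbb{C})$, and the same as the number of conjugacy classes of admissible subgroups of order $p$ in $\mathrm{PGL}_{p-a}(\mathbb{C})$ (conjugacy being taken in the respective projective linear group).
   Context: Let $m\ge 1$. A set of points in $\mathbb{P}^m(\mathbb{C})$ is in general position if any subset of $t\le m+1$ of its points spans a $(t-1)$-dimensional linear projective subspace. The group $\mathrm{PGL}_{m+1}(\mathbb{C})$ acts on $\mathbb{P}^m(\mathbb{C})$ and hence on finite sets of points; for a finite set $T$ of points, $\mathrm{Aut}(T)=\{f\in \mathrm{PGL}_{m+1}(\mathbb{C}) : T^f=T\}$ (setwise stabilizer). A finite subgroup $H$ of $\mathrm{PGL}_{m+1}(\mathbb{C})$ is called admissible if there exists a finite set $T$ of $n\ge m+3$ distinct points of $\mathbb{P}^m(\mathbb{C})$ in general position such that $H\subseteq \mathrm{Aut}(T)$. *)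

theory Defs
  imports
    "HOL-Algebra.Coset"
    "HOL-Library.Equipollence"
    "HOL-Number_Theory.Cong"
    "Jordan_Normal_Form.VS_Connect"
begin

text \<open>Everything is indexed by the number \<open>n = m + 1\<close> of homogeneous coordinates, so \<open>n\<close> stands for
  \<open>m\<close>-dimensional complex projective space and its group \<open>PGL n\<close>, which acts on column vectors
  from the left.\<close>

definition GL :: "nat \<Rightarrow> complex mat monoid" where
  "GL n = units_of (ring_mat TYPE(complex) n ())"

definition scalar_mats :: "nat \<Rightarrow> complex mat set" where
  "scalar_mats n = {c \<cdot>\<^sub>m 1\<^sub>m n | c. c \<noteq> 0}"

definition PGL :: "nat \<Rightarrow> complex mat set monoid" where
  "PGL n = GL n Mod scalar_mats n"

text \<open>A projective point is represented by the corresponding line through the origin, as a set of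
  vectors containing \<open>0\<close>.\<close>

definition proj_points :: "nat \<Rightarrow> complex vec set set" where
  "proj_points n = {{c \<cdot>\<^sub>v v | c. True} | v. v \<in> carrier_vec n \<and> v \<noteq> 0\<^sub>v n}"

text \<open>An element of \<open>PGL n\<close> is a coset of matrices differing by nonzero scalars. All of them map a
  line onto the same line, so the union over the coset below is the image under any representative.\<close>

definition proj_act :: "complex mat set \<Rightarrow> complex vec set \<Rightarrow> complex vec set" where
  "proj_act f P = {A *\<^sub>v v | A v. A \<in> f \<and> v \<in> P}"

definition span_dim :: "nat \<Rightarrow> complex vec set set \<Rightarrow> nat" where
  "span_dim n S =
     vectorspace.dim class_ring
       ((module_vec TYPE(complex) n)
          \<lparr>carrier := LinearCombinations.module.span class_ring (module_vec TYPE(complex) n) (\<Union>S)\<rparr>)"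

text \<open>A projective subspace of dimension \<open>t - 1\<close> is a linear subspace of dimension \<open>t\<close>; here
  \<open>t = card U\<close>.\<close>

definition general_position :: "nat \<Rightarrow> complex vec set set \<Rightarrow> bool" where
  "general_position n T \<longleftrightarrow>
     (\<forall>U \<subseteq> T. finite U \<longrightarrow> card U \<le> n \<longrightarrow> span_dim n U = card U)"

definition Aut :: "nat \<Rightarrow> complex vec set set \<Rightarrow> complex mat set set" where
  "Aut n T = {f \<in> carrier (PGL n). proj_act f ` T = T}"

text \<open>The bound \<open>n + 2\<close> is \<open>m + 3\<close>.\<close>

definition admissible :: "nat \<Rightarrow> complex mat set set \<Rightarrow> bool" where
  "admissible n H \<longleftrightarrow>
     subgroup H (PGL n) \<and> finite H \<and>
     (\<exists>T \<subseteq> proj_points n. finite T \<and> card T \<ge> n + 2 \<and> general_position n T \<and> H \<subseteq> Aut n T)"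

definition conjugacy_class :: "('a, 'b) monoid_scheme \<Rightarrow> 'a set \<Rightarrow> 'a set set" where
  "conjugacy_class G H = {g <#\<^bsub>G\<^esub> H #>\<^bsub>G\<^esub> inv\<^bsub>G\<^esub> g | g. g \<in> carrier G}"

definition admissible_classes :: "nat \<Rightarrow> nat \<Rightarrow> complex mat set set set set" where
  "admissible_classes n p = conjugacy_class (PGL n) ` {H. admissible n H \<and> card H = p}"

end

theory Submission
  imports
    Defs
    "HOL-Combinatorics.Permutations"
    "HOL-Algebra.Multiplicative_Group"
    "Jordan_Normal_Form.Char_Poly"
    "Jordan_Normal_Form.DL_Rank"
begin

text \<open>Write \<open>n = q * p + a\<close> with \<open>2 \<le> a \<le> p - 2\<close> for the number of homogeneous coordinates. The theorem holds
because the conjugacy classes of admissible subgroups of order \<open>p\<close> in \<open>PGL n\<close> correspond to the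
\<open>a\<close>-element subsets \<open>S\<close> of the integers modulo \<open>p\<close>, taken up to affine maps \<open>i \<mapsto> u * i + v\<close> with \<open>u\<close>
invertible. This description does not involve \<open>q\<close>, and complementation exchanges the orbits of
\<open>a\<close>-element subsets and of \<open>(p - a)\<close>-element subsets.

The set \<open>S\<close> is read off from a generator. Scaled to satisfy \<open>A ^ p = 1\<close>, it is diagonalizable with
\<open>p\<close>-th roots of unity as eigenvalues, and admissibility forces their multiplicities to be \<open>q\<close> and
\<open>q + 1\<close>, the larger one occurring exactly at the exponents in \<open>S\<close>
(\<open>admissible_imp_conjugate_to_model\<close>). Suppose the invariant set of points contains \<open>q + 1\<close> free
orbits. Then \<open>q\<close> of them together with \<open>a\<close> points of the last one form a basis, and the Fourier
transforms of the orbits are eigenvectors, each eigenvalue occurring once per orbit; the transforms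
of the first \<open>q\<close> orbits are independent, and \<open>a\<close> from the last complete them to a basis
(\<open>cyclic_orbits_imp_diag_model\<close>). With fewer free orbits there would be an invariant set of \<open>n + 2\<close>
points in general position with at least three fixed points, and linear relations between the
points show that such a projective map is the identity (\<open>three_fixed_points_imp_scalar\<close>).
Replacing the generator by another one multiplies \<open>S\<close> by a unit, and rescaling the matrix by a root
of unity translates \<open>S\<close>, which accounts for the affine maps (\<open>model_classes_eq_iff\<close>).

Conversely, every \<open>S\<close> occurs (\<open>model_group_admissible\<close>). Let the coordinates be indexed by the
exponents \<open>e < q * p\<close> and \<open>e = q * p + s\<close> with \<open>s \<in> S\<close>, and consider the points with coordinates
\<open>z ^ e\<close>, where \<open>z\<close> runs through the roots of unity of a large order \<open>p ^ N\<close>. The diagonal matrix with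
entries \<open>\<zeta> ^ e\<close>, for a primitive \<open>p\<close>-th root of unity \<open>\<zeta>\<close>, sends the point of \<open>z\<close> to that of \<open>\<zeta> * z\<close>. General
position is a generalization of Chebotarev's theorem on the minors of the Fourier matrix of prime
order (\<open>chebotarev_exponent_independence\<close>): a polynomial with these exponents that vanishes at \<open>n\<close>
different roots of unity of order \<open>p ^ N\<close> is zero. Its proof reduces a determinant modulo the prime
above \<open>p\<close>, where all these roots of unity become \<open>1\<close>.\<close>

section \<open>Integrality at roots of unity of prime power order\<close>

text \<open>The easy direction of the determinant criterion, with the matrix and the kernel vector given by
  functions, as they arise below from finite sums.\<close>
lemma kernel_imp_det_zero:
  fixes w :: "nat \<Rightarrow> nat \<Rightarrow> 'a :: idom"
  assumes "\<And>i. i < n \<Longrightarrow> (\<Sum>j<n. w i j * x j) = 0" and "j0 < n" and "x j0 \<noteq> 0"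
  shows "det (mat n n (\<lambda>(i, j). w i j)) = 0"
proof (subst det_0_iff_vec_prod_zero[where n = n])
  have "vec n x \<noteq> 0\<^sub>v n"
    using assms(2,3) by (metis index_vec index_zero_vec(1))
  moreover have "mat n n (\<lambda>(i, j). w i j) *\<^sub>v vec n x = 0\<^sub>v n"
    using assms(1) by (intro eq_vecI) (auto simp: scalar_prod_def lessThan_atLeast0)
  ultimately show "\<exists>v. v \<in> carrier_vec n \<and> v \<noteq> 0\<^sub>v n \<and> mat n n (\<lambda>(i, j). w i j) *\<^sub>v v = 0\<^sub>v n"
    by (intro exI[of _ "vec n x"]) auto
qed auto

lemma det_cong_mod:
  fixes A B :: "int mat"
  assumes "A \<in> carrier_mat n n" and "B \<in> carrier_mat n n"
    and "\<And>i j. i < n \<Longrightarrow> j < n \<Longrightarrow> [A $$ (i, j) = B $$ (i, j)] (mod m)"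
  shows "[det A = det B] (mod m)"
  unfolding det_def'[OF assms(1)] det_def'[OF assms(2)]
proof (intro cong_sum cong_mult cong_refl cong_prod)
  fix \<sigma> i assume "\<sigma> \<in> {\<sigma>. \<sigma> permutes {0..<n}}" "i \<in> {0..<n}"
  then show "[A $$ (i, \<sigma> i) = B $$ (i, \<sigma> i)] (mod m)"
    using permutes_in_image by (intro assms(3)) fastforce+
qed

text \<open>The ring generated by \<open>\<zeta>\<close> is handled as the set of values at \<open>\<zeta>\<close> of integer polynomials.\<close>
definition at_root :: "complex \<Rightarrow> int poly \<Rightarrow> complex" where
  "at_root \<zeta> f = poly (map_poly of_int f) \<zeta>"

interpretation at_root: comm_ring_hom "at_root \<zeta>" for \<zeta>
  by unfold_locales (simp_all add: at_root_def hom_distribs)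

lemma at_root_pCons [simp]: "at_root \<zeta> (pCons c f) = of_int c + \<zeta> * at_root \<zeta> f"
  by (simp add: at_root_def of_int_hom.map_poly_pCons_hom)

lemma at_root_monom [simp]: "at_root \<zeta> (Polynomial.monom c k) = of_int c * \<zeta> ^ k"
  by (simp add: at_root_def poly_monom)

lemma at_root_altdef: "at_root \<zeta> f = (\<Sum>k\<le>degree f. of_int (Polynomial.coeff f k) * \<zeta> ^ k)"
  by (simp add: at_root_def poly_altdef coeff_map_poly degree_map_poly)

lemma prime_dvd_frobenius_defect:
  fixes x y :: "'a :: comm_ring_1"
  assumes "prime p"
  shows "of_nat p dvd (x + y) ^ p - (x ^ p + y ^ p)"
proof -
  have p: "p > 0" using assms prime_gt_0_nat by blast
  have "(x + y) ^ p = (\<Sum>k\<le>p. of_nat (p choose k) * x ^ k * y ^ (p - k))"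
    by (rule binomial_ring)
  also have "{..p} = insert 0 (insert p {0<..<p})" using p by auto
  also have "(\<Sum>k\<in>\<dots>. of_nat (p choose k) * x ^ k * y ^ (p - k)) =
      y ^ p + x ^ p + (\<Sum>k\<in>{0<..<p}. of_nat (p choose k) * x ^ k * y ^ (p - k))"
    using p by (simp add: add.assoc)
  finally have "(x + y) ^ p - (x ^ p + y ^ p) =
      (\<Sum>k\<in>{0<..<p}. of_nat (p choose k) * x ^ k * y ^ (p - k))" by (simp add: algebra_simps)
  also have "of_nat p dvd \<dots>"
  proof (rule dvd_sum)
    fix k assume k: "k \<in> {0<..<p}"
    then have "p dvd (p choose k)" using assms dvd_choose_prime[of k p] by simp
    then have "(of_nat p :: 'a) dvd of_nat (p choose k)" by (metis dvd_def of_nat_mult)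
    then show "(of_nat p :: 'a) dvd of_nat (p choose k) * x ^ k * y ^ (p - k)"
      by (simp add: dvd_mult2)
  qed
  finally show ?thesis .
qed

lemma diff_dvd_power_diff: "(x - y :: 'a :: comm_ring_1) dvd x ^ k - y ^ k"
  unfolding power_diff_sumr2 by (rule dvd_triv_left)

text \<open>Stated with the explicit difference, so that it applies in rings of any characteristic, in
  particular to integer polynomials.\<close>
lemma prime_dvd_frobenius_power_defect:
  fixes x y :: "'a :: comm_ring_1"
  assumes "prime p"
  shows "of_nat p dvd (x + y) ^ (p ^ N) - (x ^ (p ^ N) + y ^ (p ^ N))"
proof (induction N)
  case (Suc N)
  let ?A = "(x + y) ^ (p ^ N)" and ?B = "x ^ (p ^ N) + y ^ (p ^ N)"
  have "of_nat p dvd ?A ^ p - ?B ^ p"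
    using Suc diff_dvd_power_diff by (rule dvd_trans)
  then have "of_nat p dvd (?A ^ p - ?B ^ p) + (?B ^ p - ((x ^ (p ^ N)) ^ p + (y ^ (p ^ N)) ^ p))"
    using prime_dvd_frobenius_defect[OF assms] by (rule dvd_add)
  then show ?case by (simp add: algebra_simps flip: power_mult)
qed simp

lemma int_fermat_power:
  assumes "prime p"
  shows "int p dvd a ^ (p ^ N) - a"
proof -
  have p0: "p ^ N > 0" using assms prime_gt_0_nat by simp
  have nat_case: "int p dvd int k ^ (p ^ N) - int k" for k
  proof (induction k)
    case (Suc k)
    have "int p dvd ((int k + 1) ^ (p ^ N) - (int k ^ (p ^ N) + 1 ^ (p ^ N))) + (int k ^ (p ^ N) - int k)"
      using prime_dvd_frobenius_power_defect[OF assms, of "int k" 1 N] Suc by (intro dvd_add) auto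
    then show ?case by (simp add: algebra_simps)
  qed (use p0 in \<open>simp add: power_0_left\<close>)
  have "[a ^ (p ^ N) = (a mod int p) ^ (p ^ N)] (mod int p)"
    by (intro cong_pow) (simp add: cong_def)
  moreover have "[(a mod int p) ^ (p ^ N) = a mod int p] (mod int p)"
    using nat_case[of "nat (a mod int p)"] assms prime_gt_0_nat
    by (simp add: cong_iff_dvd_diff)
  ultimately have "[a ^ (p ^ N) = a] (mod int p)"
    by (metis cong_def mod_mod_trivial)
  then show ?thesis by (simp add: cong_iff_dvd_diff)
qed

text \<open>The Frobenius map modulo \<open>p\<close>, iterated \<open>N\<close> times, sends every power of \<open>\<zeta>\<close> to \<open>1\<close> and fixes the
  integers modulo \<open>p\<close>, so it sends the value of \<open>f\<close> at \<open>\<zeta>\<close> to the sum of the coefficients of \<open>f\<close>.\<close>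
lemma at_root_power_cong:
  assumes "prime p" and "\<zeta> ^ (p ^ N) = 1"
  shows "\<exists>u. at_root \<zeta> f ^ (p ^ N) = of_int (poly f 1) + of_nat p * at_root \<zeta> u"
proof (induction f)
  case 0
  have "p ^ N > 0" using assms prime_gt_0_nat by simp
  then show ?case by (intro exI[of _ 0]) simp
next
  case (pCons a f)
  let ?P = "p ^ N"
  obtain u where u: "at_root \<zeta> f ^ ?P = of_int (poly f 1) + of_nat p * at_root \<zeta> u"
    using pCons by blast
  obtain w where w: "([:a:] + [:0, 1:] * f) ^ ?P - ([:a:] ^ ?P + ([:0, 1:] * f) ^ ?P) = of_nat p * w"
    using prime_dvd_frobenius_power_defect[OF assms(1), of "[:a:]" "[:0, 1:] * f" N] by (auto elim: dvdE)
  obtain b where b: "a ^ ?P - a = int p * b"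
    using int_fermat_power[OF assms(1), of a N] by (auto elim: dvdE)
  have b': "(of_int a :: complex) ^ ?P = of_int a + of_nat p * of_int b"
    using arg_cong[OF b, of "of_int :: int \<Rightarrow> complex"] by (simp add: algebra_simps)
  have "at_root \<zeta> (pCons a f) ^ ?P = of_int a ^ ?P + \<zeta> ^ ?P * at_root \<zeta> f ^ ?P + of_nat p * at_root \<zeta> w"
    using arg_cong[OF w, of "at_root \<zeta>"]
    by (simp add: hom_distribs power_mult_distrib algebra_simps del: mult_pCons_left)
  also have "\<dots> = of_int (poly (pCons a f) 1) + of_nat p * at_root \<zeta> ([:b:] + u + w)"
    unfolding b' u assms(2) by (simp add: hom_distribs algebra_simps)
  finally show ?case by blast
qed

text \<open>The number \<open>m / p\<close> is rational and integral over the integers, hence an integer. Integrality is used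
  in the form of a determinant: multiplication by the value of \<open>u\<close> at \<open>\<zeta>\<close> acts on the vector
  \<open>(1, \<zeta>, \<dots>, \<zeta> ^ (P - 1))\<close> as an integer matrix.\<close>
lemma prime_dvd_of_at_root_multiple:
  assumes "prime p" and "\<zeta> ^ P = 1" and "P > 0"
    and "of_int m + of_nat p * at_root \<zeta> u = 0"
  shows "int p dvd m"
proof -
  define M where "M i j = (\<Sum>k | k \<le> degree u \<and> (k + i) mod P = j. Polynomial.coeff u k)" for i j
  \<comment> \<open>The matrix of multiplication by \<open>m + p * u(\<zeta>) = 0\<close>; it is congruent to a scalar matrix modulo \<open>p\<close>.\<close>
  define W where "W i j = (if i = j then m else 0) + int p * M i j" for i j
  have zmod: "\<zeta> ^ (k mod P) = \<zeta> ^ k" for k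
  proof -
    have "\<zeta> ^ k = \<zeta> ^ (P * (k div P) + k mod P)" by simp
    also have "\<dots> = \<zeta> ^ (k mod P)" unfolding power_add power_mult using assms(2) by simp
    finally show ?thesis ..
  qed
  have M: "(\<Sum>j<P. of_int (M i j) * \<zeta> ^ j) = at_root \<zeta> u * \<zeta> ^ i" for i
  proof -
    have "(\<Sum>j<P. of_int (M i j) * \<zeta> ^ j) =
        (\<Sum>j<P. \<Sum>k\<in>{k\<in>{..degree u}. (k + i) mod P = j}. of_int (Polynomial.coeff u k) * \<zeta> ^ (k + i))"
      by (auto simp: M_def sum_distrib_right zmod intro!: sum.cong)
    also have "\<dots> = (\<Sum>k\<le>degree u. of_int (Polynomial.coeff u k) * \<zeta> ^ (k + i))"
      using assms(3) by (intro sum.group) auto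
    finally show ?thesis by (simp add: at_root_altdef power_add sum_distrib_right mult.assoc)
  qed
  have "det (mat P P (\<lambda>(i, j). of_int (W i j) :: complex)) = 0"
  proof (rule kernel_imp_det_zero[where x = "\<lambda>j. \<zeta> ^ j" and ?j0.0 = 0])
    fix i assume i: "i < P"
    have W: "of_int (W i j) * \<zeta> ^ j =
        (if j = i then of_int m * \<zeta> ^ j else 0) + of_nat p * (of_int (M i j) * \<zeta> ^ j)" for j
      by (simp add: W_def algebra_simps)
    have "(\<Sum>j<P. of_int (W i j) * \<zeta> ^ j) =
        (\<Sum>j<P. if j = i then of_int m * \<zeta> ^ j else 0) + of_nat p * (\<Sum>j<P. of_int (M i j) * \<zeta> ^ j)"
      unfolding W sum.distrib sum_distrib_left ..
    also have "\<dots> = (of_int m + of_nat p * at_root \<zeta> u) * \<zeta> ^ i"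
      using i by (simp only: M sum.delta finite_lessThan lessThan_iff if_True distrib_right mult.assoc)
    finally show "(\<Sum>j<P. of_int (W i j) * \<zeta> ^ j) = 0" using assms(4) by simp
  qed (use assms(3) in auto)
  also have "mat P P (\<lambda>(i, j). of_int (W i j) :: complex) = map_mat of_int (mat P P (\<lambda>(i, j). W i j))"
    by (intro eq_matI) auto
  finally have "det (mat P P (\<lambda>(i, j). W i j)) = 0" by (simp add: of_int_hom.hom_det)
  moreover have "[det (mat P P (\<lambda>(i, j). W i j)) = det (m \<cdot>\<^sub>m 1\<^sub>m P)] (mod int p)"
    by (rule det_cong_mod[where n = P]) (auto simp: W_def cong_iff_dvd_diff)
  ultimately have "int p dvd m ^ P" by (simp add: cong_iff_dvd_diff det_smult)
  then show ?thesis using assms(1) by (intro prime_dvd_power_int[of _ m P]) simp_all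
qed

text \<open>All that is needed about the prime above \<open>p\<close> in the cyclotomic ring: reduction modulo it sends \<open>\<zeta>\<close>
  to \<open>1\<close>, and it contains no integers other than multiples of \<open>p\<close>.\<close>
lemma prime_dvd_value_at_1:
  assumes "prime p" and "\<zeta> ^ (p ^ N) = 1" and "at_root \<zeta> f = 0"
  shows "int p dvd poly f 1"
proof -
  have P: "p ^ N > 0" using assms(1) prime_gt_0_nat by simp
  obtain u where "at_root \<zeta> f ^ (p ^ N) = of_int (poly f 1) + of_nat p * at_root \<zeta> u"
    using at_root_power_cong[OF assms(1,2)] by blast
  then show ?thesis
    using prime_dvd_of_at_root_multiple[OF assms(1,2) P] assms(3) zero_power[OF P, where 'a = complex]
    by simp
qed

section \<open>Independence of exponents on roots of unity\<close>

text \<open>\<open>hsym x l e\<close> is the complete homogeneous symmetric polynomial of degree \<open>e - l\<close> in \<open>x 0, \<dots>, x l\<close>,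
  in other words the divided difference of the function \<open>z ^ e\<close> at these \<open>l + 1\<close> points. The recursion is
  Pascal's rule with weights, and at \<open>x = 1\<close> it becomes Pascal's rule.\<close>
fun hsym :: "(nat \<Rightarrow> 'a :: comm_ring_1) \<Rightarrow> nat \<Rightarrow> nat \<Rightarrow> 'a" where
  "hsym x 0 0 = 1"
| "hsym x 0 (Suc e) = x 0 * hsym x 0 e"
| "hsym x (Suc l) 0 = 0"
| "hsym x (Suc l) (Suc e) = x (Suc l) * hsym x (Suc l) e + hsym x l e"

lemma hsym_eq_0: "e < l \<Longrightarrow> hsym x l e = 0"
  by (induction x l e rule: hsym.induct) auto

lemma hsym_ones: "hsym (\<lambda>_. 1) l e = of_nat (e choose l)"
  by (induction "\<lambda>_ :: nat. 1 :: 'a" l e rule: hsym.induct) auto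

lemma (in comm_ring_hom) hom_hsym: "hom (hsym x l e) = hsym (\<lambda>i. hom (x i)) l e"
  by (induction x l e rule: hsym.induct) (auto simp: hom_distribs)

lemma hsym_Suc_right: "hsym x l (Suc e) = x l * hsym x l e + (case l of 0 \<Rightarrow> 0 | Suc m \<Rightarrow> hsym x m e)"
  by (cases l) auto

lemma power_eq_newton:
  fixes z :: "'a :: comm_ring_1"
  shows "z ^ e = (\<Sum>l\<le>e. hsym x l e * (\<Prod>m<l. z - x m))"
proof (induction e)
  case (Suc e)
  let ?w = "\<lambda>l. \<Prod>m<l. z - x m"
  have step: "z * ?w l = ?w (Suc l) + x l * ?w l" for l by (simp add: algebra_simps)
  have "z ^ Suc e = (\<Sum>l\<le>e. hsym x l e * (z * ?w l))"
    unfolding power_Suc Suc by (simp add: sum_distrib_left mult_ac)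
  also have "\<dots> = (\<Sum>l\<le>e. hsym x l e * ?w (Suc l)) + (\<Sum>l\<le>e. x l * hsym x l e * ?w l)"
    unfolding step sum.distrib[symmetric] by (intro sum.cong refl) (simp only: distrib_left mult_ac)
  also have "(\<Sum>l\<le>e. x l * hsym x l e * ?w l) = (\<Sum>l\<le>Suc e. x l * hsym x l e * ?w l)"
    by (simp add: hsym_eq_0)
  also have "(\<Sum>l\<le>e. hsym x l e * ?w (Suc l)) =
      (\<Sum>l\<le>Suc e. (case l of 0 \<Rightarrow> 0 | Suc m \<Rightarrow> hsym x m e) * ?w l)"
    unfolding sum.atMost_Suc_shift[of _ e] by simp
  also have "\<dots> + (\<Sum>l\<le>Suc e. x l * hsym x l e * ?w l) = (\<Sum>l\<le>Suc e. hsym x l (Suc e) * ?w l)"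
    unfolding sum.distrib[symmetric] hsym_Suc_right by (intro sum.cong refl) (simp only: distrib_right add_ac)
  finally show ?case .
qed simp

text \<open>A polynomial that vanishes at the interpolation points has vanishing Newton coefficients: evaluation
  at \<open>x l\<close> kills all later Newton basis polynomials, and the earlier coefficients are zero by
  induction.\<close>
lemma newton_coefficients_vanish:
  fixes x :: "nat \<Rightarrow> 'a :: idom"
  assumes "finite E" and "inj_on x {..<n}"
    and "\<And>i. i < n \<Longrightarrow> (\<Sum>e\<in>E. c e * x i ^ e) = 0" and "l < n"
  shows "(\<Sum>e\<in>E. c e * hsym x l e) = 0"
  using assms(4)
proof (induction l rule: less_induct)
  case (less l)
  define M where "M = Suc (l + Max (insert 0 E))"
  let ?b = "\<lambda>k. \<Sum>e\<in>E. c e * hsym x k e" and ?w = "\<lambda>k. \<Prod>m<k. x l - x m"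
  have M: "e < M" if "e \<in> E" for e
    using that assms(1) unfolding M_def by (metis Max_ge finite_insert insertI2 le_add2 le_trans less_Suc_eq_le)
  have "0 = (\<Sum>e\<in>E. c e * (\<Sum>k<M. hsym x k e * ?w k))"
  proof -
    have "x l ^ e = (\<Sum>k<M. hsym x k e * ?w k)" if "e \<in> E" for e
      unfolding power_eq_newton[of "x l" e x] using M[OF that]
      by (intro sum.mono_neutral_left) (auto simp: hsym_eq_0)
    then show ?thesis using assms(3)[OF less.prems] by simp
  qed
  also have "\<dots> = (\<Sum>k<M. ?b k * ?w k)"
    unfolding sum_distrib_left sum_distrib_right by (subst sum.swap) (simp only: mult.assoc)
  also have "\<dots> = (\<Sum>k\<in>{l}. ?b k * ?w k)"
  proof (intro sum.mono_neutral_right ballI)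
    fix k assume "k \<in> {..<M} - {l}"
    then consider "k < l" | "l < k" by fastforce
    then show "?b k * ?w k = 0"
    proof cases
      case 1
      then show ?thesis using less by simp
    next
      case 2
      then have "?w k = 0" by (intro prod_zero) auto
      then show ?thesis by simp
    qed
  qed (auto simp: M_def)
  finally have "?b l * ?w l = 0" by simp
  moreover have "?w l \<noteq> 0"
    using less.prems by (auto dest: inj_onD[OF assms(2)])
  ultimately show ?case by simp
qed

lemma binomial_shift_mult:
  "(int t - int r) * int (N + t choose (N + r)) = int (N + Suc r) * int (N + t choose (N + Suc r))"
proof (cases "r \<le> t")
  case True
  have "(N + t - (N + r)) * (N + t choose (N + r)) = Suc (N + r) * (N + t choose Suc (N + r))"
    by (simp only: binomial_absorb_comp binomial_absorption)
  from arg_cong[OF this, of int] True show ?thesis by (simp add: of_nat_diff algebra_simps)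
qed (auto simp: binomial_eq_0)

text \<open>Multiplication by \<open>t - r\<close> turns the \<open>r\<close>-th of the functions \<open>t \<mapsto> (N + t) choose (N + r)\<close> into an
  integer multiple of the next one, so multiplication by linear factors stays within their integer
  combinations. Such combinations make a matrix of binomial coefficients triangular without any
  division.\<close>
lemma binomial_row_combination:
  fixes s :: "nat \<Rightarrow> nat"
  shows "\<exists>G. \<forall>t. (\<Sum>r\<le>i. G r * int (N + t choose (N + r))) =
      int (N + t choose N) * (\<Prod>m<i. int t - int (s m))"
proof (induction i)
  case 0
  show ?case by (intro exI[of _ "\<lambda>_. 1"]) auto
next
  case (Suc i)
  then obtain G where G: "\<And>t. (\<Sum>r\<le>i. G r * int (N + t choose (N + r))) =
      int (N + t choose N) * (\<Prod>m<i. int t - int (s m))" by blast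
  define G1 where "G1 r = (if r \<le> i then (int r - int (s i)) * G r else 0)" for r
  define G2 where "G2 r = (case r of 0 \<Rightarrow> 0 | Suc r' \<Rightarrow> int (N + r) * G r')" for r
  have "(\<Sum>r\<le>Suc i. (G1 r + G2 r) * int (N + t choose (N + r))) =
      int (N + t choose N) * (\<Prod>m<Suc i. int t - int (s m))" for t
  proof -
    let ?b = "\<lambda>r. int (N + t choose (N + r))"
    have "(\<Sum>r\<le>Suc i. (G1 r + G2 r) * ?b r) = (\<Sum>r\<le>Suc i. G1 r * ?b r) + (\<Sum>r\<le>Suc i. G2 r * ?b r)"
      by (simp only: distrib_right sum.distrib)
    also have "(\<Sum>r\<le>Suc i. G1 r * ?b r) = (\<Sum>r\<le>i. (int r - int (s i)) * G r * ?b r)"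
      by (simp add: G1_def)
    also have "(\<Sum>r\<le>Suc i. G2 r * ?b r) = (\<Sum>r\<le>i. G r * (int (N + Suc r) * ?b (Suc r)))"
      unfolding sum.atMost_Suc_shift[of _ i] by (simp add: G2_def mult_ac)
    also have "\<dots> = (\<Sum>r\<le>i. G r * ((int t - int r) * ?b r))"
      unfolding binomial_shift_mult ..
    also have "(\<Sum>r\<le>i. (int r - int (s i)) * G r * ?b r) + \<dots> =
        (int t - int (s i)) * (\<Sum>r\<le>i. G r * ?b r)"
      unfolding sum.distrib[symmetric] sum_distrib_left by (intro sum.cong refl) (simp add: algebra_simps)
    also have "\<dots> = int (N + t choose N) * (\<Prod>m<Suc i. int t - int (s m))"
      unfolding G by simp
    finally show ?thesis .
  qed
  then show ?case by (intro exI[of _ "\<lambda>r. G1 r + G2 r"]) blast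
qed

lemma prime_not_dvd_binomial_multiple_add:
  assumes "prime p" and "s < p"
  shows "\<not> p dvd (q * p + s choose (q * p))"
proof -
  have "\<not> p dvd (q * p + s choose s)"
    using assms(2)
  proof (induction s)
    case (Suc s)
    have "Suc s * (q * p + Suc s choose Suc s) = Suc (q * p + s) * (q * p + s choose s)"
      using Suc_times_binomial_eq[of "q * p + s" s] by (simp add: mult.commute)
    moreover have "\<not> p dvd Suc (q * p + s)"
    proof
      assume "p dvd Suc (q * p + s)"
      then have "p dvd q * p + Suc s" by simp
      then have "p dvd Suc s" by (simp add: dvd_add_right_iff del: add_Suc_right)
      with Suc.prems show False by (auto dest: dvd_imp_le)
    qed
    ultimately show ?case
      using Suc assms(1) by (metis Suc_lessD dvd_mult prime_dvd_mult_iff)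
  qed (use assms(1) in \<open>simp add: prime_nat_iff\<close>)
  then show ?thesis by (metis add_diff_cancel_left' binomial_symmetric le_add1)
qed


text \<open>For \<open>q = 0\<close> and \<open>N = 1\<close> this is Chebotarev's theorem on the minors of the Fourier matrix of order \<open>p\<close>.
  The Newton coefficients of index at least \<open>q * p\<close> depend only on the top exponents \<open>q * p + s\<close>. They
  give a square system whose matrix consists of divided differences; modulo the prime above \<open>p\<close> these are
  binomial coefficients, and the determinant becomes, up to a unit, a Vandermonde determinant of the
  elements of \<open>S\<close>, which are distinct modulo \<open>p\<close>. So the top coefficients are zero, and what remains is a
  polynomial of degree less than \<open>q * p\<close> with at least \<open>q * p\<close> roots.\<close>
theorem chebotarev_exponent_independence:
  fixes c :: "nat \<Rightarrow> complex"
  assumes p: "prime p" and S: "S \<subseteq> {..<p}"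
    and Z: "Z \<subseteq> {z. z ^ (p ^ N) = 1}" "card Z = q * p + card S"
    and vanish: "\<And>z. z \<in> Z \<Longrightarrow> (\<Sum>e\<in>{..<q * p} \<union> (\<lambda>s. q * p + s) ` S. c e * z ^ e) = 0"
    and e: "e \<in> {..<q * p} \<union> (\<lambda>s. q * p + s) ` S"
  shows "c e = 0"
proof -
  define a where "a = card S"
  let ?E = "{..<q * p} \<union> (\<lambda>s. q * p + s) ` S"
  let ?P = "p ^ N"
  have P: "?P > 0" using p prime_gt_0_nat by simp
  have finS: "finite S" using S finite_subset by blast
  have "finite {z :: complex. z ^ ?P = 1}" using P by (intro finite_roots_unity) linarith
  with Z(1) have finZ: "finite Z" by (rule finite_subset)
  obtain s where s: "bij_betw s {..<a} S"
    using ex_bij_betw_nat_finite[OF finS] unfolding a_def lessThan_atLeast0 by blast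
  have s_less: "s j < p" if "j < a" for j
    using bij_betwE[OF s] S that by blast
  obtain z where z: "bij_betw z {..<q * p + a} Z"
    using ex_bij_betw_nat_finite[OF finZ] unfolding Z(2) a_def lessThan_atLeast0 by blast
  define \<zeta> where "\<zeta> = cis (2 * pi / real ?P)"
  have \<zeta>: "\<zeta> ^ ?P = 1" using P by (simp add: \<zeta>_def DeMoivre)
  have "\<exists>k. z i = \<zeta> ^ k" if "i < q * p + a" for i
  proof -
    have "z i \<in> {z. z ^ ?P = 1}" using z Z(1) that by (auto simp: bij_betw_def)
    with bij_betw_roots_unity[OF P] obtain k where "z i = cis (2 * pi * real k / real ?P)"
      by (auto simp: bij_betw_def)
    then show ?thesis by (intro exI[of _ k]) (simp add: \<zeta>_def DeMoivre mult_ac)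
  qed
  then obtain k where k: "\<And>i. i < q * p + a \<Longrightarrow> z i = \<zeta> ^ k i" by metis
  define x where "x i = \<zeta> ^ k i" for i
  have inj_x: "inj_on x {..<q * p + a}"
  proof -
    have "inj_on x {..<q * p + a} \<longleftrightarrow> inj_on z {..<q * p + a}"
      by (rule inj_on_cong) (simp add: k x_def)
    then show ?thesis using z by (simp add: bij_betw_def)
  qed
  have vanish_x: "(\<Sum>e\<in>?E. c e * x i ^ e) = 0" if "i < q * p + a" for i
  proof (rule vanish)
    have "z i \<in> Z" using bij_betwE[OF z] that by blast
    then show "x i \<in> Z" by (simp add: x_def flip: k[OF that])
  qed
  \<comment> \<open>Exponents below \<open>q * p\<close> do not contribute to these Newton coefficients.\<close>
  have row: "(\<Sum>j<a. hsym x (q * p + r) (q * p + s j) * c (q * p + s j)) = 0" if "r < a" for r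
  proof -
    have "0 = (\<Sum>e\<in>?E. c e * hsym x (q * p + r) e)"
      using newton_coefficients_vanish[of ?E x "q * p + a" c, OF _ inj_x vanish_x, of "q * p + r"] finS that
      by simp
    also have "\<dots> = (\<Sum>e\<in>(\<lambda>s. q * p + s) ` S. c e * hsym x (q * p + r) e)"
      using finS by (intro sum.mono_neutral_right) (auto simp: hsym_eq_0)
    also have "\<dots> = (\<Sum>t\<in>S. c (q * p + t) * hsym x (q * p + r) (q * p + t))"
      by (subst sum.reindex) auto
    also have "\<dots> = (\<Sum>j<a. c (q * p + s j) * hsym x (q * p + r) (q * p + s j))"
      using sum.reindex_bij_betw[OF s, symmetric] .
    finally show ?thesis by (simp add: mult.commute)
  qed
  have "\<forall>i. \<exists>g. \<forall>t. (\<Sum>r\<le>i. g r * int (q * p + t choose (q * p + r))) =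
      int (q * p + t choose (q * p)) * (\<Prod>m<i. int t - int (s m))"
    by (intro allI binomial_row_combination)
  from choice[OF this] obtain G
    where G: "\<And>i t. (\<Sum>r\<le>i. G i r * int (q * p + t choose (q * p + r))) =
      int (q * p + t choose (q * p)) * (\<Prod>m<i. int t - int (s m))"
    by blast
  \<comment> \<open>The combined rows lifted to integer polynomials, with \<open>\<zeta>\<close> as variable: at \<open>\<zeta>\<close> they annihilate the
    top coefficients, and at \<open>1\<close> they form a triangular matrix.\<close>
  define F where "F i j = (\<Sum>r\<le>i. of_int (G i r) * hsym (\<lambda>i. Polynomial.monom (1 :: int) (k i)) (q * p + r) (q * p + s j))" for i j
  define f where "f = det (mat a a (\<lambda>(i, j). F i j))"
  have at_F: "at_root \<zeta> (F i j) = (\<Sum>r\<le>i. of_int (G i r) * hsym x (q * p + r) (q * p + s j))" for i j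
    unfolding F_def by (simp add: hom_distribs at_root.hom_hsym x_def[abs_def])
  have F_at_1: "poly (F i j) 1 = int (q * p + s j choose (q * p)) * (\<Prod>m<i. int (s j) - int (s m))" for i j
  proof -
    show ?thesis unfolding G[symmetric] F_def
      by (simp add: poly_sum poly_hom.hom_hsym poly_monom hsym_ones)
  qed
  have p_f: "\<not> int p dvd poly f 1"
  proof -
    let ?A = "map_mat (\<lambda>f. poly f 1) (mat a a (\<lambda>(i, j). F i j))"
    have "upper_triangular ?A"
      unfolding upper_triangular_def by (auto simp: F_at_1)
    then have "det ?A = prod_list (diag_mat ?A)"
      by (rule det_upper_triangular[where n = a]) simp
    also have "\<dots> = (\<Prod>i<a. int (q * p + s i choose (q * p)) * (\<Prod>m<i. int (s i) - int (s m)))"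
      by (simp add: diag_mat_def F_at_1 prod.distinct_set_conv_list[symmetric] lessThan_atLeast0)
    finally have f1: "poly f 1 = \<dots>" unfolding f_def
      by (simp add: comm_ring_hom.hom_det[OF poly_hom.comm_ring_hom_axioms])
    show ?thesis
    proof
      assume "int p dvd poly f 1"
      then obtain i where i: "i < a"
        and "int p dvd int (q * p + s i choose (q * p)) * (\<Prod>m<i. int (s i) - int (s m))"
        unfolding f1 using p by (subst (asm) prime_dvd_prod_iff) auto
      moreover have si: "s i < p" using i s_less by blast
      ultimately obtain m where m: "m < i" "int p dvd int (s i) - int (s m)"
        using p prime_not_dvd_binomial_multiple_add[OF p si, of q]
        by (auto simp: prime_dvd_mult_iff prime_dvd_prod_iff)
      have sm: "s m < p" using i m s_less by simp
      have "[int (s i) = int (s m)] (mod int p)" using m(2) by (simp add: cong_iff_dvd_diff)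
      then have "[s i = s m] (mod p)" by (simp only: cong_int_iff)
      then have "s i = s m" using si sm by (simp add: cong_def)
      then have "i = m" using m(1) i inj_onD[OF bij_betw_imp_inj_on[OF s]] by simp
      then show False using m(1) by simp
    qed
  qed
  have top: "c (q * p + s j) = 0" if "j < a" for j
  proof (rule ccontr)
    assume nz: "c (q * p + s j) \<noteq> 0"
    have "det (mat a a (\<lambda>(i, j). at_root \<zeta> (F i j))) = 0"
    proof (rule kernel_imp_det_zero[where x = "\<lambda>j. c (q * p + s j)" and ?j0.0 = j])
      fix i assume i: "i < a"
      have "(\<Sum>j<a. at_root \<zeta> (F i j) * c (q * p + s j)) =
          (\<Sum>r\<le>i. of_int (G i r) * (\<Sum>j<a. hsym x (q * p + r) (q * p + s j) * c (q * p + s j)))"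
        unfolding at_F sum_distrib_left sum_distrib_right by (subst sum.swap) (simp only: mult.assoc)
      also have "\<dots> = 0" using row i by (intro sum.neutral) auto
      finally show "(\<Sum>j<a. at_root \<zeta> (F i j) * c (q * p + s j)) = 0" .
    qed (use that nz in auto)
    also have "mat a a (\<lambda>(i, j). at_root \<zeta> (F i j)) = map_mat (at_root \<zeta>) (mat a a (\<lambda>(i, j). F i j))"
      by (intro eq_matI) auto
    finally have "at_root \<zeta> f = 0" by (simp add: f_def at_root.hom_det)
    then show False using prime_dvd_value_at_1[OF p \<zeta>] p_f by blast
  qed
  have top': "c (q * p + t) = 0" if t: "t \<in> S" for t
  proof -
    obtain j where "j < a" "t = s j"
      using t bij_betw_imp_surj_on[OF s] by blast
    then show ?thesis using top by simp
  qed
  show "c e = 0"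
  proof (cases "e < q * p")
    case True
    define g where "g = (\<Sum>e<q * p. Polynomial.monom (c e) e)"
    have "degree g < q * p"
      unfolding g_def
    proof (rule degree_sum_less)
      show "0 < q * p" using True by linarith
    qed (auto intro: le_less_trans[OF degree_monom_le])
    moreover have "Z \<subseteq> {z. poly g z = 0}"
    proof
      fix y assume "y \<in> Z"
      then have "0 = (\<Sum>e\<in>?E. c e * y ^ e)" using vanish by simp
      also have "\<dots> = (\<Sum>e<q * p. c e * y ^ e)"
        using finS top' by (intro sum.mono_neutral_right) auto
      finally show "y \<in> {z. poly g z = 0}" by (simp add: g_def poly_sum poly_monom)
    qed
    ultimately have "g = 0"
      using poly_roots_degree[of g] card_mono[of "{z. poly g z = 0}" Z] poly_roots_finite[of g] Z(2) by fastforce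
    moreover have "Polynomial.coeff g e = c e"
      using True by (simp add: g_def Polynomial.coeff_sum)
    ultimately show ?thesis by simp
  next
    case False
    then show ?thesis using e top' by auto
  qed
qed

section \<open>Linear independence and general position\<close>

text \<open>Linear independence of an indexed family in coordinates. Families rather than sets of vectors
  allow reindexing along orbits.\<close>
definition indep :: "nat \<Rightarrow> 'i set \<Rightarrow> ('i \<Rightarrow> complex vec) \<Rightarrow> bool" where
  "indep n I f \<longleftrightarrow> (\<forall>c. (\<forall>j<n. (\<Sum>i\<in>I. c i * f i $ j) = 0) \<longrightarrow> (\<forall>i\<in>I. c i = 0))"

lemma indepD:
  assumes "indep n I f" and "\<And>j. j < n \<Longrightarrow> (\<Sum>i\<in>I. c i * f i $ j) = 0" and "i \<in> I"
  shows "c i = 0"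
  using assms unfolding indep_def by blast

lemma indep_subset:
  assumes "indep n I f" and "J \<subseteq> I" and "finite I"
  shows "indep n J f"
  unfolding indep_def
proof (intro allI impI ballI)
  fix c i assume c: "\<forall>j<n. (\<Sum>i\<in>J. c i * f i $ j) = 0" and i: "i \<in> J"
  have "(\<Sum>i\<in>I. (if i \<in> J then c i else 0) * f i $ j) = (\<Sum>i\<in>J. c i * f i $ j)" for j
    using assms(2,3) by (intro sum.mono_neutral_cong_right) auto
  then have "(if i \<in> J then c i else 0) = 0"
    using c i assms(2) by (intro indepD[OF assms(1), of "\<lambda>i. if i \<in> J then c i else 0"]) auto
  then show "c i = 0" using i by simp
qed

lemma indep_reindex:
  assumes "inj_on h I"
  shows "indep n (h ` I) f \<longleftrightarrow> indep n I (\<lambda>i. f (h i))"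
proof
  assume A: "indep n (h ` I) f"
  show "indep n I (\<lambda>i. f (h i))"
    unfolding indep_def
  proof (intro allI impI ballI)
    fix c i assume c: "\<forall>j<n. (\<Sum>i\<in>I. c i * f (h i) $ j) = 0" and i: "i \<in> I"
    have "(\<Sum>k\<in>h ` I. c (the_inv_into I h k) * f k $ j) = (\<Sum>i\<in>I. c i * f (h i) $ j)" for j
      using assms by (subst sum.reindex) (auto simp: the_inv_into_f_f)
    then have "c (the_inv_into I h (h i)) = 0"
      using c i by (intro indepD[OF A, of "\<lambda>k. c (the_inv_into I h k)"]) auto
    then show "c i = 0" using assms i by (simp add: the_inv_into_f_f)
  qed
next
  assume A: "indep n I (\<lambda>i. f (h i))"
  show "indep n (h ` I) f"
    unfolding indep_def
  proof (intro allI impI ballI)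
    fix c k assume c: "\<forall>j<n. (\<Sum>k\<in>h ` I. c k * f k $ j) = 0" and k: "k \<in> h ` I"
    have "(\<Sum>i\<in>I. c (h i) * f (h i) $ j) = (\<Sum>k\<in>h ` I. c k * f k $ j)" for j
      using assms by (simp add: sum.reindex)
    then have "c (h i) = 0" if "i \<in> I" for i
      using c that by (intro indepD[OF A, of "\<lambda>i. c (h i)"]) auto
    then show "c k = 0" using k by auto
  qed
qed

lemma indep_card_le:
  assumes "finite I" and "indep n I f"
  shows "card I \<le> n"
proof (rule ccontr)
  assume "\<not> card I \<le> n"
  define N where "N = card I"
  have N: "n < N" using \<open>\<not> card I \<le> n\<close> by (simp add: N_def)
  obtain b where b: "bij_betw b {..<N} I"
    using ex_bij_betw_nat_finite[OF assms(1)] unfolding N_def lessThan_atLeast0 by blast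
  \<comment> \<open>The coordinates of the vectors as columns, padded with zero rows to a square matrix.\<close>
  let ?w = "\<lambda>i j. if i < n then f (b j) $ i else 0"
  let ?W = "mat N N (\<lambda>(i, j). ?w i j)"
  have "det (mat N N (\<lambda>(i, j). ?w j i)) = 0"
    using N by (intro kernel_imp_det_zero[where x = "\<lambda>j. if j = n then 1 else 0" and ?j0.0 = n]) auto
  also have "mat N N (\<lambda>(i, j). ?w j i) = transpose_mat ?W" by (intro eq_matI) auto
  also have "det \<dots> = det ?W" by (rule det_transpose[of _ N]) simp
  finally obtain v where v: "v \<in> carrier_vec N" "v \<noteq> 0\<^sub>v N" "?W *\<^sub>v v = 0\<^sub>v N"
    using det_0_iff_vec_prod_zero[of ?W N] by auto
  have "(\<Sum>j<N. v $ j * f (b j) $ i) = 0" if "i < n" for i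
  proof -
    have "(?W *\<^sub>v v) $ i = 0" using v(3) that N by simp
    also have "(?W *\<^sub>v v) $ i = (\<Sum>j<N. v $ j * f (b j) $ i)"
      using that N v(1) by (simp add: scalar_prod_def lessThan_atLeast0 mult.commute)
    finally show ?thesis .
  qed
  moreover have "indep n {..<N} (\<lambda>j. f (b j))"
    using b assms(2) by (subst indep_reindex[symmetric]) (auto simp: bij_betw_def)
  ultimately have "v $ j = 0" if "j < N" for j
    using that by (intro indepD[where c = "\<lambda>j. v $ j" and I = "{..<N}" and n = n]) auto
  then have "v = 0\<^sub>v N" using v(1) by (intro eq_vecI) auto
  then show False using v(2) by simp
qed

definition in_span :: "nat \<Rightarrow> 'i set \<Rightarrow> ('i \<Rightarrow> complex vec) \<Rightarrow> complex vec \<Rightarrow> bool" where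
  "in_span n I f v \<longleftrightarrow> (\<exists>c. \<forall>j<n. v $ j = (\<Sum>i\<in>I. c i * f i $ j))"

lemma in_span_trans:
  assumes "in_span n I f v" and "\<And>i. i \<in> I \<Longrightarrow> in_span n K g (f i)"
  shows "in_span n K g v"
proof -
  obtain c where c: "\<And>j. j < n \<Longrightarrow> v $ j = (\<Sum>i\<in>I. c i * f i $ j)"
    using assms(1) by (auto simp: in_span_def)
  obtain d where d: "\<And>i j. i \<in> I \<Longrightarrow> j < n \<Longrightarrow> f i $ j = (\<Sum>k\<in>K. d i k * g k $ j)"
    using assms(2) unfolding in_span_def by metis
  have "v $ j = (\<Sum>k\<in>K. (\<Sum>i\<in>I. c i * d i k) * g k $ j)" if "j < n" for j
  proof -
    have "v $ j = (\<Sum>i\<in>I. \<Sum>k\<in>K. c i * d i k * g k $ j)"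
      using that by (simp add: c d sum_distrib_left mult.assoc)
    also have "\<dots> = (\<Sum>k\<in>K. (\<Sum>i\<in>I. c i * d i k) * g k $ j)"
      unfolding sum_distrib_right by (rule sum.swap)
    finally show ?thesis .
  qed
  then show ?thesis unfolding in_span_def
    by (intro exI[of _ "\<lambda>k. \<Sum>i\<in>I. c i * d i k"]) blast
qed

lemma in_span_member:
  assumes "finite I" and "i \<in> I"
  shows "in_span n I f (f i)"
  unfolding in_span_def
proof (intro exI allI impI)
  fix j
  have "(\<Sum>k\<in>I. (if k = i then 1 else 0) * f k $ j) = (\<Sum>k\<in>I. if k = i then f k $ j else 0)"
    by (intro sum.cong) auto
  then show "f i $ j = (\<Sum>k\<in>I. (if k = i then 1 else 0) * f k $ j)"
    using assms by simp
qed

lemma dependent_imp_in_span: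
  assumes "finite I" and "x \<notin> I" and "indep n I f" and "\<not> indep n (insert x I) f"
  shows "in_span n I f (f x)"
proof -
  obtain c y where c: "\<And>j. j < n \<Longrightarrow> (\<Sum>i\<in>insert x I. c i * f i $ j) = 0"
    and y: "y \<in> insert x I" "c y \<noteq> 0"
    using assms(4) unfolding indep_def by blast
  have c': "c x * f x $ j + (\<Sum>i\<in>I. c i * f i $ j) = 0" if "j < n" for j
    using c[OF that] assms(1,2) by simp
  have "c x \<noteq> 0"
  proof
    assume "c x = 0"
    then have "\<And>j. j < n \<Longrightarrow> (\<Sum>i\<in>I. c i * f i $ j) = 0" using c' by simp
    then have "\<forall>i\<in>I. c i = 0" using indepD[OF assms(3)] by blast
    then show False using y \<open>c x = 0\<close> by auto
  qed
  have "f x $ j = (\<Sum>i\<in>I. (- c i / c x) * f i $ j)" if "j < n" for j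
  proof -
    have "c x * (\<Sum>i\<in>I. (- c i / c x) * f i $ j) = - (\<Sum>i\<in>I. c i * f i $ j)"
      using \<open>c x \<noteq> 0\<close> by (simp add: sum_distrib_left sum_negf)
    also have "\<dots> = c x * f x $ j" using c'[OF that] by (simp add: add_eq_0_iff)
    finally show ?thesis using \<open>c x \<noteq> 0\<close> by simp
  qed
  then show ?thesis unfolding in_span_def by (intro exI[of _ "\<lambda>i. - c i / c x"]) blast
qed

lemma indep_card_eq_imp_in_span:
  assumes "finite I" and "indep n I f" and "card I = n"
  shows "in_span n I f v"
proof -
  \<comment> \<open>The vector \<open>v\<close> is added to the family under the index \<open>None\<close>.\<close>
  let ?g = "case_option v f" and ?I = "Some ` I"
  have ind: "indep n ?I ?g" using assms(2) by (subst indep_reindex) auto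
  moreover have "\<not> indep n (insert None ?I) ?g"
  proof
    assume "indep n (insert None ?I) ?g"
    then have "card (insert None ?I) \<le> n" using assms(1) by (intro indep_card_le) auto
    then show False using assms(1,3) by (simp add: card_insert_disjoint card_image)
  qed
  ultimately have "in_span n ?I ?g (?g None)" using assms(1) by (intro dependent_imp_in_span) auto
  then obtain c where c: "\<And>j. j < n \<Longrightarrow> v $ j = (\<Sum>i\<in>?I. c i * ?g i $ j)"
    unfolding in_span_def by auto
  have "v $ j = (\<Sum>i\<in>I. c (Some i) * f i $ j)" if "j < n" for j
    using c[OF that] by (simp add: sum.reindex)
  then show ?thesis unfolding in_span_def by (intro exI[of _ "\<lambda>i. c (Some i)"]) blast
qed

lemma spanning_card_ge:
  assumes "finite K" and "\<And>v. in_span n K f v"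
  shows "n \<le> card K"
proof -
  have "\<forall>i. \<exists>c. \<forall>j<n. unit_vec n i $ j = (\<Sum>k\<in>K. c k * f k $ j)"
    using assms(2) unfolding in_span_def by (rule allI)
  from choice[OF this] obtain C
    where C: "\<And>i j. j < n \<Longrightarrow> unit_vec n i $ j = (\<Sum>k\<in>K. C i k * f k $ j)" by blast
  define N where "N = card K"
  obtain b where b: "bij_betw b {..<N} K"
    using ex_bij_betw_nat_finite[OF assms(1)] unfolding N_def lessThan_atLeast0 by blast
  \<comment> \<open>A dependence between the coefficient vectors of the unit vectors would be one between the unit
    vectors themselves.\<close>
  have "indep N {..<n} (\<lambda>i. vec N (\<lambda>k. C i (b k)))"
    unfolding indep_def
  proof (intro allI impI ballI)
    fix d i assume d: "\<forall>k<N. (\<Sum>i<n. d i * vec N (\<lambda>k. C i (b k)) $ k) = 0" and i: "i \<in> {..<n}"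
    have d': "(\<Sum>l<n. d l * C l k) = 0" if k: "k \<in> K" for k
    proof -
      obtain k' where "k' < N" "k = b k'" using k bij_betw_imp_surj_on[OF b] by blast
      then show ?thesis using d[rule_format, of k'] by simp
    qed
    have "(\<Sum>l<n. d l * unit_vec n l $ i) = (\<Sum>l<n. if l = i then d l else 0)"
      using i by (intro sum.cong) auto
    then have "d i = (\<Sum>l<n. d l * unit_vec n l $ i)" using i by simp
    also have "\<dots> = (\<Sum>l<n. \<Sum>k\<in>K. d l * C l k * f k $ i)"
      using i by (simp only: C lessThan_iff sum_distrib_left mult.assoc)
    also have "\<dots> = (\<Sum>k\<in>K. (\<Sum>l<n. d l * C l k) * f k $ i)"
      unfolding sum_distrib_right by (rule sum.swap)
    also have "\<dots> = 0" using d' by simp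
    finally show "d i = 0" .
  qed
  then have "card {..<n} \<le> N" by (intro indep_card_le) auto
  then show ?thesis by (simp add: N_def)
qed

text \<open>The exchange lemma. A maximal independent subfamily of \<open>J\<close> that contains \<open>I\<close> spans everything, and
  then it has exactly \<open>n\<close> members.\<close>
lemma basis_between:
  assumes "finite J" and "I \<subseteq> J" and "indep n I f" and span: "\<And>v. in_span n J f v"
  obtains K where "I \<subseteq> K" "K \<subseteq> J" "indep n K f" "card K = n"
proof -
  let ?P = "\<lambda>K. I \<subseteq> K \<and> K \<subseteq> J \<and> indep n K f"
  have "finite {K. ?P K}" using assms(1) by (auto intro: finite_subset[of _ "Pow J"])
  moreover have "I \<in> {K. ?P K}" using assms by auto
  ultimately obtain K where K: "?P K" and maxi: "\<And>L. ?P L \<Longrightarrow> K \<subseteq> L \<Longrightarrow> K = L"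
    using finite_has_maximal2[of "{K. ?P K}" I] by auto
  have finK: "finite K" using K assms(1) finite_subset by blast
  have "in_span n K f (f x)" if "x \<in> J" for x
  proof (cases "x \<in> K")
    case True
    then show ?thesis using finK by (rule in_span_member[rotated])
  next
    case False
    then have "\<not> indep n (insert x K) f" using K maxi[of "insert x K"] that by auto
    then show ?thesis using K False finK by (intro dependent_imp_in_span) auto
  qed
  then have "in_span n K f v" for v using in_span_trans[OF span] by blast
  then have "n \<le> card K" using finK by (rule spanning_card_ge[rotated])
  moreover have "card K \<le> n" using finK K by (intro indep_card_le) auto
  ultimately show thesis using K by (intro that) auto
qed

abbreviation line :: "complex vec \<Rightarrow> complex vec set" where
  "line v \<equiv> {c \<cdot>\<^sub>v v | c. True}"

lemma lin_indpt_iff_indep: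
  assumes "finite X" and "X \<subseteq> carrier_vec n"
  shows "module.lin_dep class_ring (module_vec TYPE(complex) n) X \<longleftrightarrow> \<not> indep n X (\<lambda>x. x)"
proof -
  interpret vec_space "TYPE(complex)" n .
  have idx: "lincomb c X $ j = (\<Sum>x\<in>X. c x * x $ j)" if "j < n" for c j
    using that assms by (simp add: lincomb_index)
  have zero: "lincomb c X = 0\<^sub>v n \<longleftrightarrow> (\<forall>j<n. (\<Sum>x\<in>X. c x * x $ j) = 0)" for c
  proof -
    have "lincomb c X \<in> carrier_vec n" using assms by (intro lincomb_closed) auto
    then show ?thesis using idx by (auto simp: vec_eq_iff carrier_vecD)
  qed
  show ?thesis
  proof
    assume "lin_dep X"
    then obtain c v where "lincomb c X = 0\<^sub>v n" "v \<in> X" "c v \<noteq> 0"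
      using finite_lin_dep[OF assms(1)] assms(2) by (auto simp: class_ring_simps)
    then show "\<not> indep n X (\<lambda>x. x)" unfolding zero indep_def by blast
  next
    assume "\<not> indep n X (\<lambda>x. x)"
    then obtain c v where "lincomb c X = 0\<^sub>v n" "v \<in> X" "c v \<noteq> 0"
      unfolding zero indep_def by blast
    then show "lin_dep X"
      using assms by (intro lin_dep_crit[where A = X and a = c and v = v]) (auto simp: class_ring_simps)
  qed
qed


text \<open>The bridge from \<^const>\<open>span_dim\<close> to coordinates: vectors generating their span are independent if
  and only if their number is its dimension.\<close>
lemma span_dim_lines_eq_card_iff:
  assumes "finite X" and X: "X \<subseteq> carrier_vec n"
  shows "span_dim n (line ` X) = card X \<longleftrightarrow> indep n X (\<lambda>x. x)"
proof -
  interpret vec_space "TYPE(complex)" n .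
  have "\<Union> (line ` X) \<subseteq> span X"
  proof
    fix y assume "y \<in> \<Union> (line ` X)"
    then obtain c x where "x \<in> X" "y = c \<cdot>\<^sub>v x" by auto
    then show "y \<in> span X" using smult_in_span[OF X] in_own_span X by auto
  qed
  moreover have "X \<subseteq> \<Union> (line ` X)"
  proof
    fix x assume "x \<in> X"
    moreover have "x \<in> line x" by (auto intro: exI[of _ 1])
    ultimately show "x \<in> \<Union> (line ` X)" by blast
  qed
  ultimately have "span (\<Union> (line ` X)) = span X"
    by (meson X equalityI span_is_monotone span_subsetI)
  then have dim: "span_dim n (line ` X) = vectorspace.dim class_ring (span_vs X)"
    unfolding span_dim_def by simp
  show ?thesis
  proof
    assume "span_dim n (line ` X) = card X"
    then have "lin_indpt X" using full_dim_span[of X] assms unfolding dim by auto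
    then show "indep n X (\<lambda>x. x)" using lin_indpt_iff_indep[OF assms] by blast
  next
    assume "indep n X (\<lambda>x. x)"
    then have "lin_indpt X" using lin_indpt_iff_indep[OF assms] by blast
    then have "maximal X (\<lambda>T. T \<subseteq> X \<and> lin_indpt T)" unfolding maximal_def by auto
    then show "span_dim n (line ` X) = card X"
      unfolding dim using assms by (intro dim_span) auto
  qed
qed

lemma line_eqD:
  assumes "line v = line w"
  shows "\<exists>c. v = c \<cdot>\<^sub>v w"
proof -
  have "v \<in> line v" by (auto intro: exI[of _ 1])
  then show ?thesis using assms by auto
qed

lemma general_position_imp_indep:
  assumes "general_position n T" and "finite I" and "card I \<le> n"
    and "\<And>i. i \<in> I \<Longrightarrow> f i \<in> carrier_vec n" and "\<And>i. i \<in> I \<Longrightarrow> line (f i) \<in> T"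
    and inj: "inj_on (\<lambda>i. line (f i)) I"
  shows "indep n I f"
proof -
  have inj_f: "inj_on f I" using inj by (auto simp: inj_on_def)
  let ?U = "line ` f ` I"
  have cardU: "card ?U = card I" using inj by (simp add: card_image image_image)
  have "?U \<subseteq> T" using assms(5) by auto
  then have "span_dim n ?U = card ?U"
    using assms(1-3) cardU unfolding general_position_def by auto
  then have "span_dim n ?U = card (f ` I)" using cardU inj_f by (simp add: card_image)
  then have "indep n (f ` I) (\<lambda>x. x)"
    using assms(2,4) by (subst (asm) span_dim_lines_eq_card_iff) auto
  then show ?thesis using inj_f by (simp add: indep_reindex)
qed

lemma general_positionI:
  assumes "finite I" and "\<And>i. i \<in> I \<Longrightarrow> f i \<in> carrier_vec n"
    and ind: "\<And>J. J \<subseteq> I \<Longrightarrow> card J \<le> n \<Longrightarrow> indep n J f"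
  shows "general_position n ((\<lambda>i. line (f i)) ` I)"
  unfolding general_position_def
proof (intro allI impI)
  fix U assume U: "U \<subseteq> (\<lambda>i. line (f i)) ` I" "card U \<le> n"
  then obtain J where J: "J \<subseteq> I" "inj_on (\<lambda>i. line (f i)) J" "U = (\<lambda>i. line (f i)) ` J"
    by (meson subset_image_inj)
  have inj_f: "inj_on f J" using J(2) by (auto simp: inj_on_def)
  have cardJ: "card U = card J" using J by (simp add: card_image)
  have "indep n (f ` J) (\<lambda>x. x)"
    using ind[OF J(1)] U(2) cardJ inj_f by (simp add: indep_reindex)
  moreover have "finite J" using J(1) assms(1) finite_subset by blast
  ultimately have "span_dim n (line ` f ` J) = card (f ` J)"
    using J(1) assms(2) by (subst span_dim_lines_eq_card_iff) auto
  then show "span_dim n U = card U"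
    using J(3) cardJ inj_f by (simp add: card_image image_image)
qed

section \<open>Conjugacy of cyclic subgroups of prime order\<close>

context group begin

text \<open>The group generated by an element of prime order as a set of powers with natural number exponents,
  the form in which its elements are matrices of powers.\<close>
lemma prime_order_elem_powers:
  fixes p :: nat
  assumes "prime p" and "g \<in> carrier G" and "g [^] p = \<one>" and "g \<noteq> \<one>"
  shows "ord g = p" and "generate G {g} = range (\<lambda>t :: nat. g [^] t)"
    and "card (generate G {g}) = p"
proof -
  have "ord g dvd p" using assms pow_eq_id by blast
  moreover have "ord g \<noteq> 1" using assms ord_eq_1 by blast
  ultimately show p: "ord g = p" using assms(1) by (metis prime_nat_iff)
  then have "ord g \<noteq> 0" using assms(1) by auto
  then show "generate G {g} = range (\<lambda>t :: nat. g [^] t)"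
    using generate_pow_nat[OF assms(2)] by auto
  show "card (generate G {g}) = p"
    using generate_pow_card[OF assms(2)] p by simp
qed

lemma prime_card_subgroup_eq_generate:
  fixes p :: nat
  assumes "prime p" and "subgroup H G" and "card H = p" and "g \<in> H" and "g \<noteq> \<one>"
  shows "g [^] p = \<one>" and "H = generate G {g}"
proof -
  have H: "group (G\<lparr>carrier := H\<rparr>)"
    by (rule subgroup.subgroup_is_group[OF assms(2) is_group])
  have g: "g \<in> carrier G" by (rule subgroup.mem_carrier[OF assms(2,4)])
  have "g [^]\<^bsub>G\<lparr>carrier := H\<rparr>\<^esub> Coset.order (G\<lparr>carrier := H\<rparr>) = \<one>\<^bsub>G\<lparr>carrier := H\<rparr>\<^esub>"
    using assms(4) by (intro group.pow_order_eq_1[OF H]) simp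
  then show gp: "g [^] p = \<one>"
    using assms(3) by (simp add: Coset.order_def flip: nat_pow_consistent)
  have "generate G {g} \<subseteq> H"
    using generate_subgroup_incl[of "{g}" H] assms(2,4) by simp
  moreover have "finite H" using assms(1,3) by (metis card.infinite not_prime_0)
  ultimately show "H = generate G {g}"
    using prime_order_elem_powers(3)[OF assms(1) g gp assms(5)] assms(3) card_subset_eq by metis
qed

lemma generate_eq_iff_power:
  fixes p :: nat
  assumes "prime p" and g: "g \<in> carrier G" "g [^] p = \<one>" "g \<noteq> \<one>" and h: "h \<in> carrier G" "h \<noteq> \<one>"
    and "h [^] p = \<one>"
  shows "generate G {g} = generate G {h} \<longleftrightarrow> (\<exists>u :: nat. g = h [^] u)"
proof
  assume "generate G {g} = generate G {h}"
  then have "g \<in> generate G {h}" by (metis generate.incl singletonI)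
  then show "\<exists>u :: nat. g = h [^] u"
    using prime_order_elem_powers(2)[OF assms(1) h(1) assms(7) h(2)] by auto
next
  assume "\<exists>u :: nat. g = h [^] u"
  then have "g \<in> generate G {h}"
    using prime_order_elem_powers(2)[OF assms(1) h(1) assms(7) h(2)] by auto
  then show "generate G {g} = generate G {h}"
    using prime_card_subgroup_eq_generate(2)[OF assms(1) generate_is_subgroup _ _ g(3), of "{h}"]
      prime_order_elem_powers(3)[OF assms(1) h(1) assms(7) h(2)] h(1) by simp
qed

lemma conjugate_set_eq:
  assumes "H \<subseteq> carrier G" and "x \<in> carrier G"
  shows "x <# H #> inv x = (\<lambda>h. x \<otimes> h \<otimes> inv x) ` H"
  unfolding l_coset_def r_coset_def by auto

lemma conjugate_power:
  assumes "x \<in> carrier G" and "g \<in> carrier G"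
  shows "(x \<otimes> g \<otimes> inv x) [^] (t :: nat) = x \<otimes> g [^] t \<otimes> inv x"
proof (induction t)
  case (Suc t)
  have "inv x \<otimes> (x \<otimes> (g \<otimes> inv x)) = (inv x \<otimes> x) \<otimes> (g \<otimes> inv x)"
    using assms by (simp only: m_assoc m_closed inv_closed)
  then have "inv x \<otimes> (x \<otimes> (g \<otimes> inv x)) = g \<otimes> inv x" using assms by simp
  then show ?case using Suc assms by (simp add: m_assoc)
qed (use assms in simp)

lemma conjugate_eq_one_iff:
  assumes "x \<in> carrier G" and "g \<in> carrier G"
  shows "x \<otimes> g \<otimes> inv x = \<one> \<longleftrightarrow> g = \<one>"
proof
  assume "x \<otimes> g \<otimes> inv x = \<one>"
  moreover have "x \<otimes> g = (x \<otimes> g \<otimes> inv x) \<otimes> x" using assms by (simp add: m_assoc)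
  ultimately have "x \<otimes> g = x" using assms by simp
  then show "g = \<one>" using assms by (simp add: r_cancel_one)
qed (use assms in simp)

lemma conjugate_generate:
  fixes p :: nat
  assumes "prime p" and "g \<in> carrier G" "g [^] p = \<one>" "g \<noteq> \<one>" and x: "x \<in> carrier G"
  shows "x <# generate G {g} #> inv x = generate G {x \<otimes> g \<otimes> inv x}"
proof -
  let ?h = "x \<otimes> g \<otimes> inv x"
  have h: "?h \<in> carrier G" using assms by simp
  have hp: "?h [^] p = \<one>" using assms by (simp add: conjugate_power)
  have h1: "?h \<noteq> \<one>" using assms by (simp add: conjugate_eq_one_iff)
  have "generate G {g} \<subseteq> carrier G" using assms(2) generate_incl by simp
  then have "x <# generate G {g} #> inv x = (\<lambda>h. x \<otimes> h \<otimes> inv x) ` generate G {g}"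
    using x by (rule conjugate_set_eq)
  also have "\<dots> = range (\<lambda>t :: nat. ?h [^] t)"
    unfolding prime_order_elem_powers(2)[OF assms(1-4)] conjugate_power[OF x assms(2)] by auto
  also have "\<dots> = generate G {?h}"
    using prime_order_elem_powers(2)[OF assms(1) h hp h1] by simp
  finally show ?thesis .
qed

lemma conjugate_conjugate:
  assumes "H \<subseteq> carrier G" and "x \<in> carrier G" and "y \<in> carrier G"
  shows "x <# (y <# H #> inv y) #> inv x = (x \<otimes> y) <# H #> inv (x \<otimes> y)"
proof -
  have y: "y <# H #> inv y = (\<lambda>h. y \<otimes> h \<otimes> inv y) ` H"
    using assms(1,3) by (rule conjugate_set_eq)
  then have "y <# H #> inv y \<subseteq> carrier G" using assms by auto
  then have "x <# (y <# H #> inv y) #> inv x = (\<lambda>h. x \<otimes> h \<otimes> inv x) ` (y <# H #> inv y)"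
    using assms(2) by (rule conjugate_set_eq)
  also have "\<dots> = (\<lambda>h. (x \<otimes> y) \<otimes> h \<otimes> inv (x \<otimes> y)) ` H"
    unfolding y image_image using assms by (intro image_cong) (auto simp: inv_mult_group m_assoc)
  also have "\<dots> = (x \<otimes> y) <# H #> inv (x \<otimes> y)"
    using assms by (intro conjugate_set_eq[symmetric]) auto
  finally show ?thesis .
qed

lemma mem_conjugacy_class_iff:
  "L \<in> conjugacy_class G H \<longleftrightarrow> (\<exists>x\<in>carrier G. L = x <# H #> inv x)"
  unfolding conjugacy_class_def by (simp add: Bex_def conj_commute)

lemma conjugacy_class_conjugate_subset:
  assumes "H \<subseteq> carrier G" and x: "x \<in> carrier G"
  shows "conjugacy_class G (x <# H #> inv x) \<subseteq> conjugacy_class G H"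
proof
  fix L assume "L \<in> conjugacy_class G (x <# H #> inv x)"
  then obtain y where y: "y \<in> carrier G" and L: "L = y <# (x <# H #> inv x) #> inv y"
    unfolding mem_conjugacy_class_iff by (elim bexE)
  have "L = (y \<otimes> x) <# H #> inv (y \<otimes> x)"
    unfolding L using assms(1) y x by (rule conjugate_conjugate)
  then show "L \<in> conjugacy_class G H"
    unfolding mem_conjugacy_class_iff using x y by (intro bexI[of _ "y \<otimes> x"]) simp_all
qed

lemma conjugate_one: "H \<subseteq> carrier G \<Longrightarrow> \<one> <# H #> inv \<one> = H"
proof -
  assume H: "H \<subseteq> carrier G"
  have "\<one> <# H #> inv \<one> = (\<lambda>h. \<one> \<otimes> h \<otimes> inv \<one>) ` H"
    using H one_closed by (rule conjugate_set_eq)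
  also have "\<dots> = (\<lambda>h. h) ` H" using H by (intro image_cong) auto
  finally show ?thesis by simp
qed

lemma conjugacy_class_eq_iff:
  assumes "H \<subseteq> carrier G" and "K \<subseteq> carrier G"
  shows "conjugacy_class G H = conjugacy_class G K \<longleftrightarrow> (\<exists>x\<in>carrier G. x <# H #> inv x = K)"
proof
  have "K \<in> conjugacy_class G K"
    unfolding mem_conjugacy_class_iff using conjugate_one[OF assms(2)]
    by (intro bexI[of _ \<one>]) simp_all
  moreover assume "conjugacy_class G H = conjugacy_class G K"
  ultimately have "K \<in> conjugacy_class G H" by (simp only:)
  then show "\<exists>x\<in>carrier G. x <# H #> inv x = K"
    unfolding mem_conjugacy_class_iff by (elim bexE) (rule bexI, rule sym)
next
  assume "\<exists>x\<in>carrier G. x <# H #> inv x = K"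
  then obtain x where x: "x \<in> carrier G" and K: "x <# H #> inv x = K" by (elim bexE)
  have "inv x <# (x <# H #> inv x) #> inv (inv x) = (inv x \<otimes> x) <# H #> inv (inv x \<otimes> x)"
    using assms(1) inv_closed[OF x] x by (rule conjugate_conjugate)
  also have "\<dots> = H" using x conjugate_one[OF assms(1)] by simp
  finally have "H = inv x <# K #> inv (inv x)" unfolding K by (rule sym)
  then show "conjugacy_class G H = conjugacy_class G K"
    using conjugacy_class_conjugate_subset[OF assms(1) x] K
      conjugacy_class_conjugate_subset[OF assms(2) inv_closed[OF x]] by simp
qed

text \<open>Conjugacy of groups of prime order can be tested on generators, because every nontrivial power of \<open>h\<close>
  generates the group of \<open>h\<close>.\<close>
lemma conjugacy_class_generate_eq_iff:
  fixes p :: nat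
  assumes "prime p" and g: "g \<in> carrier G" "g [^] p = \<one>" "g \<noteq> \<one>"
    and h: "h \<in> carrier G" "h [^] p = \<one>" "h \<noteq> \<one>"
  shows "conjugacy_class G (generate G {g}) = conjugacy_class G (generate G {h}) \<longleftrightarrow>
    (\<exists>x\<in>carrier G. \<exists>u :: nat. x \<otimes> g \<otimes> inv x = h [^] u)"
proof -
  have "generate G {g} \<subseteq> carrier G" "generate G {h} \<subseteq> carrier G"
    using g(1) h(1) generate_incl by simp_all
  then have "conjugacy_class G (generate G {g}) = conjugacy_class G (generate G {h}) \<longleftrightarrow>
      (\<exists>x\<in>carrier G. generate G {x \<otimes> g \<otimes> inv x} = generate G {h})"
    by (simp add: conjugacy_class_eq_iff conjugate_generate[OF assms(1) g])
  also have "\<dots> \<longleftrightarrow> (\<exists>x\<in>carrier G. \<exists>u :: nat. x \<otimes> g \<otimes> inv x = h [^] u)"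
  proof (rule bex_cong[OF refl])
    fix x assume x: "x \<in> carrier G"
    have "x \<otimes> g \<otimes> inv x \<noteq> \<one>" using x g by (simp add: conjugate_eq_one_iff)
    then show "generate G {x \<otimes> g \<otimes> inv x} = generate G {h} \<longleftrightarrow> (\<exists>u :: nat. x \<otimes> g \<otimes> inv x = h [^] u)"
      using x g h by (intro generate_eq_iff_power[OF assms(1)]) (auto simp: conjugate_power)
  qed
  finally show ?thesis .
qed

end

section \<open>The projective linear group in terms of matrices\<close>

lemma GL_simps [simp]:
  "mult (GL n) = (*)" "one (GL n) = 1\<^sub>m n"
  by (simp_all add: GL_def units_of_def ring_mat_def)

lemma carrier_GL: "carrier (GL n) = {A \<in> carrier_mat n n. det A \<noteq> 0}"
proof (intro equalityI subsetI)
  fix A assume "A \<in> carrier (GL n)"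
  then have A: "A \<in> Units (ring_mat TYPE(complex) n ())" by (simp add: GL_def units_of_def)
  then have "A \<in> carrier_mat n n" by (simp add: Units_def ring_mat_def)
  then show "A \<in> {A \<in> carrier_mat n n. det A \<noteq> 0}" using unit_imp_det_non_zero[OF A] by simp
next
  fix A :: "complex mat" assume "A \<in> {A \<in> carrier_mat n n. det A \<noteq> 0}"
  then have "A \<in> Units (ring_mat TYPE(complex) n ())" by (intro det_non_zero_imp_unit) auto
  then show "A \<in> carrier (GL n)" by (simp add: GL_def units_of_def)
qed

lemma group_GL: "group (GL n)"
  unfolding GL_def by (intro monoid.units_group ring.is_monoid ring_mat)

lemma smult_smult_mat [simp]: "c \<cdot>\<^sub>m (d \<cdot>\<^sub>m A) = (c * d) \<cdot>\<^sub>m (A :: complex mat)"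
  by (intro eq_matI) auto

lemma one_smult_mat [simp]: "1 \<cdot>\<^sub>m A = (A :: complex mat)"
  by (intro eq_matI) auto

lemma smult_mat_mult_vec:
  "A \<in> carrier_mat m n \<Longrightarrow> v \<in> carrier_vec n \<Longrightarrow> (c \<cdot>\<^sub>m A) *\<^sub>v v = c \<cdot>\<^sub>v (A *\<^sub>v (v :: complex vec))"
  by (intro eq_vecI) (auto simp: scalar_prod_def sum_distrib_left mult.assoc)

lemma scalar_mat_mult: "A \<in> carrier_mat n m \<Longrightarrow> (c \<cdot>\<^sub>m 1\<^sub>m n) * A = c \<cdot>\<^sub>m (A :: complex mat)"
  by (simp add: mult_smult_assoc_mat[of _ n n _ m])

lemma mat_mult_scalar: "A \<in> carrier_mat m n \<Longrightarrow> A * (c \<cdot>\<^sub>m 1\<^sub>m n) = c \<cdot>\<^sub>m (A :: complex mat)"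
  by (simp add: mult_smult_distrib[of A m n _ n])

lemma scalar_mats_normal: "scalar_mats n \<lhd> GL n"
proof -
  interpret group "GL n" by (rule group_GL)
  have sub: "scalar_mats n \<subseteq> carrier (GL n)"
    by (auto simp: scalar_mats_def carrier_GL det_smult)
  have "subgroup (scalar_mats n) (GL n)"
  proof (intro subgroup.intro)
    show "scalar_mats n \<subseteq> carrier (GL n)" by fact
  next
    fix x y assume "x \<in> scalar_mats n" "y \<in> scalar_mats n"
    then obtain c d where "x = c \<cdot>\<^sub>m 1\<^sub>m n" "y = d \<cdot>\<^sub>m 1\<^sub>m n" "c * d \<noteq> 0"
      by (auto simp: scalar_mats_def)
    then show "x \<otimes>\<^bsub>GL n\<^esub> y \<in> scalar_mats n"
      by (auto simp: scalar_mats_def scalar_mat_mult[of _ n n] intro!: exI[of _ "c * d"])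
  next
    show "\<one>\<^bsub>GL n\<^esub> \<in> scalar_mats n"
      by (auto simp: scalar_mats_def intro!: exI[of _ 1])
  next
    fix x assume x: "x \<in> scalar_mats n"
    then obtain c where c: "x = c \<cdot>\<^sub>m 1\<^sub>m n" "c \<noteq> 0" by (auto simp: scalar_mats_def)
    let ?y = "inverse c \<cdot>\<^sub>m 1\<^sub>m n"
    have y: "?y \<in> scalar_mats n" using c(2) by (auto simp: scalar_mats_def intro!: exI[of _ "inverse c"])
    have "?y \<otimes>\<^bsub>GL n\<^esub> x = \<one>\<^bsub>GL n\<^esub>"
      using c by (simp add: scalar_mat_mult[of _ n n])
    then have "inv\<^bsub>GL n\<^esub> x = ?y" using x y sub by (intro inv_equality) auto
    then show "inv\<^bsub>GL n\<^esub> x \<in> scalar_mats n" using y by simp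
  qed
  moreover have "scalar_mats n #>\<^bsub>GL n\<^esub> A = A <#\<^bsub>GL n\<^esub> scalar_mats n" if "A \<in> carrier (GL n)" for A
    using that unfolding r_coset_def l_coset_def scalar_mats_def carrier_GL
    by (auto simp: scalar_mat_mult[of _ n n] mat_mult_scalar[of _ n n])
  ultimately show ?thesis by (intro normalI) auto
qed

definition pgl :: "nat \<Rightarrow> complex mat \<Rightarrow> complex mat set" where
  "pgl n A = scalar_mats n #>\<^bsub>GL n\<^esub> A"

lemma pgl_altdef: "A \<in> carrier_mat n n \<Longrightarrow> pgl n A = {c \<cdot>\<^sub>m A | c. c \<noteq> 0}"
  unfolding pgl_def r_coset_def scalar_mats_def by (auto simp: scalar_mat_mult[of _ n n])

lemma group_PGL: "group (PGL n)"
  unfolding PGL_def by (rule normal.factorgroup_is_group[OF scalar_mats_normal])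

lemma carrier_PGL: "carrier (PGL n) = pgl n ` carrier (GL n)"
  unfolding PGL_def FactGroup_def RCOSETS_def pgl_def by auto

lemma pgl_in_carrier: "A \<in> carrier (GL n) \<Longrightarrow> pgl n A \<in> carrier (PGL n)"
  unfolding carrier_PGL by (rule imageI)

lemma mult_pgl:
  "A \<in> carrier (GL n) \<Longrightarrow> B \<in> carrier (GL n) \<Longrightarrow> pgl n A \<otimes>\<^bsub>PGL n\<^esub> pgl n B = pgl n (A * B)"
  using normal.rcos_sum[OF scalar_mats_normal, of A n B]
  unfolding PGL_def FactGroup_def pgl_def by simp

lemma one_PGL: "\<one>\<^bsub>PGL n\<^esub> = pgl n (1\<^sub>m n)"
  unfolding PGL_def FactGroup_def by (simp add: pgl_altdef scalar_mats_def)

lemma mult_in_GL: "A \<in> carrier (GL n) \<Longrightarrow> B \<in> carrier (GL n) \<Longrightarrow> A * B \<in> carrier (GL n)"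
  using monoid.m_closed[OF group.is_monoid[OF group_GL], of A n B] by simp

lemma one_in_GL: "1\<^sub>m n \<in> carrier (GL n)"
  by (simp add: carrier_GL)

lemma pgl_eq_iff:
  assumes "A \<in> carrier_mat n n" and "B \<in> carrier_mat n n"
  shows "pgl n A = pgl n B \<longleftrightarrow> (\<exists>c. c \<noteq> 0 \<and> A = c \<cdot>\<^sub>m B)"
proof
  assume "pgl n A = pgl n B"
  moreover have "A \<in> pgl n A" using assms(1) by (auto simp: pgl_altdef intro!: exI[of _ 1])
  ultimately show "\<exists>c. c \<noteq> 0 \<and> A = c \<cdot>\<^sub>m B" using assms(2) by (auto simp: pgl_altdef)
next
  assume "\<exists>c. c \<noteq> 0 \<and> A = c \<cdot>\<^sub>m B"
  then obtain c where c: "c \<noteq> 0" "A = c \<cdot>\<^sub>m B" by blast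
  have "\<exists>d. k \<cdot>\<^sub>m B = d \<cdot>\<^sub>m (c \<cdot>\<^sub>m B) \<and> d \<noteq> 0" if "k \<noteq> 0" for k
    using c(1) that by (intro exI[of _ "k / c"]) auto
  then show "pgl n A = pgl n B"
    using c assms by (auto simp: pgl_altdef)
qed

lemma pow_pgl:
  assumes "A \<in> carrier (GL n)"
  shows "pgl n A [^]\<^bsub>PGL n\<^esub> (t :: nat) = pgl n (A ^\<^sub>m t)" and "A ^\<^sub>m t \<in> carrier (GL n)"
proof -
  interpret PGL: group "PGL n" by (rule group_PGL)
  have "pgl n A [^]\<^bsub>PGL n\<^esub> (t :: nat) = pgl n (A ^\<^sub>m t) \<and> A ^\<^sub>m t \<in> carrier (GL n)"
  proof (induction t)
    case 0
    have "dim_row A = n" using assms by (auto simp: carrier_GL)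
    then show ?case using one_in_GL[of n] by (simp add: one_PGL)
  next
    case (Suc t)
    then show ?case using assms by (simp add: mult_pgl mult_in_GL)
  qed
  then show "pgl n A [^]\<^bsub>PGL n\<^esub> (t :: nat) = pgl n (A ^\<^sub>m t)" and "A ^\<^sub>m t \<in> carrier (GL n)" by auto
qed

lemma mat_diag_power: "mat_diag n d ^\<^sub>m t = mat_diag n (\<lambda>i. d i ^ t)"
  by (induction t) (simp_all add: power_commutes carrier_matD(1)[OF mat_diag_dim])

lemma mat_diag_in_GL: "(\<And>i. i < n \<Longrightarrow> d i \<noteq> 0) \<Longrightarrow> mat_diag n d \<in> carrier (GL n)"
proof -
  assume d: "\<And>i. i < n \<Longrightarrow> d i \<noteq> 0"
  have "det (mat_diag n d) = prod_list (diag_mat (mat_diag n d))"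
    by (rule det_upper_triangular[of _ n]) (auto simp: mat_diag_def)
  also have "\<dots> \<noteq> 0" using d by (auto simp: diag_mat_def mat_diag_def prod_list_zero_iff)
  finally show ?thesis by (simp add: carrier_GL)
qed

text \<open>Conjugacy in \<open>PGL n\<close> as an intertwining relation, which avoids inverse matrices.\<close>
lemma conjugate_pgl_eq_iff:
  assumes P: "P \<in> carrier (GL n)" and A: "A \<in> carrier (GL n)" and B: "B \<in> carrier (GL n)"
  shows "pgl n P \<otimes>\<^bsub>PGL n\<^esub> pgl n A \<otimes>\<^bsub>PGL n\<^esub> inv\<^bsub>PGL n\<^esub> pgl n P = pgl n B \<longleftrightarrow>
    (\<exists>c. c \<noteq> 0 \<and> P * A = c \<cdot>\<^sub>m (B * P))"
proof -
  interpret PGL: group "PGL n" by (rule group_PGL)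
  note cl = pgl_in_carrier[OF P] pgl_in_carrier[OF A] pgl_in_carrier[OF B]
  have "pgl n P \<otimes>\<^bsub>PGL n\<^esub> pgl n A \<otimes>\<^bsub>PGL n\<^esub> inv\<^bsub>PGL n\<^esub> pgl n P = pgl n B \<longleftrightarrow>
      pgl n P \<otimes>\<^bsub>PGL n\<^esub> pgl n A = pgl n B \<otimes>\<^bsub>PGL n\<^esub> pgl n P"
    using cl PGL.inv_solve_right'[of "pgl n B" "pgl n P \<otimes>\<^bsub>PGL n\<^esub> pgl n A" "pgl n P"] by auto
  also have "\<dots> \<longleftrightarrow> pgl n (P * A) = pgl n (B * P)"
    using P A B by (simp add: mult_pgl)
  also have "\<dots> \<longleftrightarrow> (\<exists>c. c \<noteq> 0 \<and> P * A = c \<cdot>\<^sub>m (B * P))"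
    using mult_in_GL[OF P A] mult_in_GL[OF B P] by (intro pgl_eq_iff) (auto simp: carrier_GL)
  finally show ?thesis .
qed

lemma proj_act_line:
  assumes "A \<in> carrier_mat n n" and "v \<in> carrier_vec n"
  shows "proj_act (pgl n A) (line v) = line (A *\<^sub>v v)"
proof
  show "proj_act (pgl n A) (line v) \<subseteq> line (A *\<^sub>v v)"
    using assms by (auto simp: proj_act_def pgl_altdef smult_mat_mult_vec[of _ n n] mult_mat_vec smult_smult_assoc)
  show "line (A *\<^sub>v v) \<subseteq> proj_act (pgl n A) (line v)"
  proof
    fix x assume "x \<in> line (A *\<^sub>v v)"
    then obtain c where "x = c \<cdot>\<^sub>v (A *\<^sub>v v)" by auto
    then have "x = A *\<^sub>v (c \<cdot>\<^sub>v v)" using assms by (simp add: mult_mat_vec)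
    moreover have "A \<in> pgl n A" using assms(1) by (auto simp: pgl_altdef intro!: exI[of _ 1])
    ultimately show "x \<in> proj_act (pgl n A) (line v)" unfolding proj_act_def by auto
  qed
qed

section \<open>Diagonal models and their point sets\<close>

definition prim_root :: "nat \<Rightarrow> complex" where
  "prim_root p = cis (2 * pi / real p)"

lemma prim_root_power: "prim_root p ^ k = cis (2 * pi * real k / real p)"
  by (simp add: prim_root_def DeMoivre mult_ac)

lemma prim_root_nonzero [simp]: "prim_root p \<noteq> 0"
  by (simp add: prim_root_def)

lemma prim_root_power_self: "p > 0 \<Longrightarrow> prim_root p ^ p = 1"
  by (simp add: prim_root_power)

lemma prim_root_power_mod: "p > 0 \<Longrightarrow> prim_root p ^ (k mod p) = prim_root p ^ k"
proof -
  assume p: "p > 0"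
  have "prim_root p ^ k = prim_root p ^ (p * (k div p) + k mod p)" by simp
  also have "\<dots> = prim_root p ^ (k mod p)"
    unfolding power_add power_mult using prim_root_power_self[OF p] by simp
  finally show ?thesis ..
qed

lemma prim_root_power_eq_iff:
  assumes "p > 0"
  shows "prim_root p ^ i = prim_root p ^ j \<longleftrightarrow> i mod p = j mod p"
proof
  assume "prim_root p ^ i = prim_root p ^ j"
  then have "prim_root p ^ (i mod p) = prim_root p ^ (j mod p)" using assms by (simp add: prim_root_power_mod)
  moreover have "i mod p \<in> {..<p}" "j mod p \<in> {..<p}" using assms by auto
  ultimately show "i mod p = j mod p"
    using bij_betw_imp_inj_on[OF bij_betw_roots_unity[OF assms]] unfolding prim_root_power inj_on_def by blast
qed (metis assms prim_root_power_mod)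

lemma root_of_unity_eq_prim_root_power:
  assumes "p > 0" and "z ^ p = 1"
  obtains k where "z = prim_root p ^ k"
proof -
  have "z \<in> {z. z ^ p = 1}" using assms(2) by simp
  then have "z \<in> (\<lambda>k. cis (2 * pi * real k / real p)) ` {..<p}"
    using bij_betw_imp_surj_on[OF bij_betw_roots_unity[OF assms(1)]] by simp
  then show thesis using that by (auto simp: prim_root_power)
qed

text \<open>The exponents of the monomials that serve as coordinates. Modulo \<open>p\<close> every residue occurs \<open>q\<close> times,
  and the residues in \<open>S\<close> occur once more.\<close>
definition exponents :: "nat \<Rightarrow> nat \<Rightarrow> nat set \<Rightarrow> nat set" where
  "exponents p q S = {..<q * p} \<union> (\<lambda>s. q * p + s) ` S"

lemma finite_exponents [simp]: "finite S \<Longrightarrow> finite (exponents p q S)"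
  by (simp add: exponents_def)

lemma card_exponents: "finite S \<Longrightarrow> card (exponents p q S) = q * p + card S"
  unfolding exponents_def by (subst card_Un_disjoint) (auto simp: card_image)

lemma card_exponents_residue:
  assumes "S \<subseteq> {..<p}" and "i < p"
  shows "card {e \<in> exponents p q S. e mod p = i} = q + (if i \<in> S then 1 else 0)"
proof -
  let ?M = "{..<q} \<union> (if i \<in> S then {q} else {})"
  have "{e \<in> exponents p q S. e mod p = i} = (\<lambda>m. m * p + i) ` ?M"
  proof (intro equalityI subsetI)
    fix e assume e: "e \<in> {e \<in> exponents p q S. e mod p = i}"
    then have eq: "e = (e div p) * p + i" by (auto simp: mult.commute)
    from e consider "e < q * p" | s where "s \<in> S" "e = q * p + s"
      by (auto simp: exponents_def)
    then have "e div p \<in> ?M"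
    proof cases
      case 1
      then show ?thesis using assms(2) by (simp add: less_mult_imp_div_less)
    next
      case (2 s)
      then have "s < p" using assms(1) by auto
      then have "e div p = q" "e mod p = s" using 2 by simp_all
      then show ?thesis using 2 e by auto
    qed
    then show "e \<in> (\<lambda>m. m * p + i) ` ?M" using eq by blast
  next
    fix e assume "e \<in> (\<lambda>m. m * p + i) ` ?M"
    then obtain m where m: "m \<in> ?M" "e = m * p + i" by blast
    have "m * p + i < q * p" if "m < q"
    proof -
      have "m * p + i < Suc m * p" using assms(2) by simp
      also have "\<dots> \<le> q * p" using that by (intro mult_le_mono1) simp
      finally show ?thesis .
    qed
    then show "e \<in> {e \<in> exponents p q S. e mod p = i}"
      using m assms(2) by (auto simp: exponents_def split: if_splits)
  qed
  moreover have "inj_on (\<lambda>m. m * p + i) ?M" using assms(2) by (auto simp: inj_on_def)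
  ultimately show ?thesis by (simp add: card_image)
qed

text \<open>A fixed enumeration of the exponents, needed because the rows of a matrix are numbered.\<close>
definition nth_elem :: "nat set \<Rightarrow> nat \<Rightarrow> nat" where
  "nth_elem E c = sorted_list_of_set E ! c"

lemma nth_elem_bij: "finite E \<Longrightarrow> bij_betw (nth_elem E) {..<card E} E"
  unfolding nth_elem_def using bij_betw_nth[of "sorted_list_of_set E" "{..<card E}" E] by simp

definition diag_model :: "nat \<Rightarrow> nat \<Rightarrow> nat set \<Rightarrow> complex mat" where
  "diag_model p q S =
     mat_diag (q * p + card S) (\<lambda>c. prim_root p ^ nth_elem (exponents p q S) c)"

lemma diag_model_in_GL: "diag_model p q S \<in> carrier (GL (q * p + card S))"
  unfolding diag_model_def by (rule mat_diag_in_GL) simp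

definition point_vec :: "nat set \<Rightarrow> complex \<Rightarrow> complex vec" where
  "point_vec E z = vec (card E) (\<lambda>c. z ^ nth_elem E c)"

lemma point_vec_carrier [simp]: "point_vec E z \<in> carrier_vec (card E)"
  by (simp add: point_vec_def)

lemma diag_mult_point_vec:
  "mat_diag (card E) (\<lambda>c. (w ^ nth_elem E c) ^ t) *\<^sub>v point_vec E z = point_vec E (w ^ t * z)"
proof (intro eq_vecI)
  fix i assume "i < dim_vec (point_vec E (w ^ t * z))"
  then have i: "i < card E" by (simp add: point_vec_def)
  have "(mat_diag (card E) (\<lambda>c. (w ^ nth_elem E c) ^ t) *\<^sub>v point_vec E z) $ i =
      (\<Sum>j<card E. (if i = j then (w ^ nth_elem E j) ^ t else 0) * z ^ nth_elem E j)"
    using i by (simp add: mat_diag_def point_vec_def scalar_prod_def lessThan_atLeast0)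
  also have "\<dots> = (\<Sum>j<card E. if j = i then (w ^ nth_elem E j) ^ t * z ^ nth_elem E j else 0)"
    by (intro sum.cong) auto
  also have "\<dots> = (w ^ nth_elem E i) ^ t * z ^ nth_elem E i" using i by simp
  finally show "(mat_diag (card E) (\<lambda>c. (w ^ nth_elem E c) ^ t) *\<^sub>v point_vec E z) $ i =
      point_vec E (w ^ t * z) $ i"
    using i by (simp add: point_vec_def power_mult_distrib flip: power_mult) (simp add: mult.commute)
qed (simp add: mat_diag_def point_vec_def)

text \<open>The square matrix of the powers \<open>z ^ e\<close> has independent columns by the generalized Chebotarev theorem,
  so its rows, which are the coordinate vectors of the points, are independent as well.\<close>
lemma roots_of_unity_point_vecs_indep:
  assumes p: "prime p" and S: "S \<subseteq> {..<p}" and E: "E = exponents p q S"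
    and J: "J \<subseteq> {z. z ^ (p ^ N) = 1}" "card J = card E"
  shows "indep (card E) J (point_vec E)"
  unfolding indep_def
proof (intro allI impI ballI)
  fix c y assume c: "\<forall>j<card E. (\<Sum>z\<in>J. c z * point_vec E z $ j) = 0" and y: "y \<in> J"
  define n where "n = card E"
  have finS: "finite S" using S finite_subset by blast
  then have finE: "finite E" by (simp add: E)
  have "p ^ N \<ge> 1" using p prime_gt_0_nat by (simp add: Suc_leI)
  then have finJ: "finite J" using J(1) finite_roots_unity[of "p ^ N"] finite_subset by blast
  obtain z where z: "bij_betw z {..<n} J"
    using ex_bij_betw_nat_finite[OF finJ] unfolding J(2) n_def lessThan_atLeast0 by blast
  let ?W = "mat n n (\<lambda>(i, j). z i ^ nth_elem E j)"
  show "c y = 0"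
  proof (rule ccontr)
    assume cy: "c y \<noteq> 0"
    obtain i0 where i0: "i0 < n" "y = z i0" using y bij_betw_imp_surj_on[OF z] by blast
    have "det (mat n n (\<lambda>(i, j). z j ^ nth_elem E i)) = 0"
    proof (rule kernel_imp_det_zero[where x = "\<lambda>j. c (z j)" and ?j0.0 = i0])
      fix i assume i: "i < n"
      have "(\<Sum>j<n. z j ^ nth_elem E i * c (z j)) = (\<Sum>x\<in>J. x ^ nth_elem E i * c x)"
        by (rule sum.reindex_bij_betw[OF z])
      also have "\<dots> = 0"
        using c i by (auto simp: point_vec_def n_def mult.commute)
      finally show "(\<Sum>j<n. z j ^ nth_elem E i * c (z j)) = 0" .
    qed (use i0 cy in auto)
    also have "mat n n (\<lambda>(i, j). z j ^ nth_elem E i) = transpose_mat ?W" by (intro eq_matI) auto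
    also have "det \<dots> = det ?W" by (rule det_transpose[of _ n]) simp
    finally obtain v where v: "v \<in> carrier_vec n" "v \<noteq> 0\<^sub>v n" "?W *\<^sub>v v = 0\<^sub>v n"
      using det_0_iff_vec_prod_zero[of ?W n] by auto
    define d where "d e = v $ (the_inv_into {..<n} (nth_elem E) e)" for e
    have bijE: "bij_betw (nth_elem E) {..<n} E" unfolding n_def by (rule nth_elem_bij[OF finE])
    have d: "d (nth_elem E i) = v $ i" if "i < n" for i
      unfolding d_def using that the_inv_into_f_f[OF bij_betw_imp_inj_on[OF bijE]] by simp
    have "(\<Sum>e\<in>E. d e * x ^ e) = 0" if x: "x \<in> J" for x
    proof -
      obtain i where i: "i < n" "x = z i" using x bij_betw_imp_surj_on[OF z] by blast
      have "(\<Sum>e\<in>E. d e * x ^ e) = (\<Sum>j<n. d (nth_elem E j) * x ^ nth_elem E j)"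
        by (rule sum.reindex_bij_betw[OF bijE, symmetric])
      also have "\<dots> = (?W *\<^sub>v v) $ i"
        using i v(1) by (simp add: d scalar_prod_def lessThan_atLeast0 mult.commute)
      also have "\<dots> = 0" using v(3) i by simp
      finally show ?thesis .
    qed
    then have "d e = 0" if "e \<in> E" for e
      using that J card_exponents[OF finS, of p q]
      by (intro chebotarev_exponent_independence[OF p S, of J N q d e])
         (auto simp: E exponents_def[of p q S])
    then have "v $ i = 0" if "i < n" for i
      using that d bij_betwE[OF bijE] by force
    then have "v = 0\<^sub>v n" using v(1) by (intro eq_vecI) auto
    then show False using v(2) by simp
  qed
qed

section \<open>The diagonal models are admissible\<close>

definition model_elem :: "nat \<Rightarrow> nat \<Rightarrow> nat set \<Rightarrow> complex mat set" where
  "model_elem p q S = pgl (q * p + card S) (diag_model p q S)"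

lemma model_elem_power:
  "model_elem p q S [^]\<^bsub>PGL (q * p + card S)\<^esub> (t :: nat) =
     pgl (q * p + card S) (mat_diag (q * p + card S) (\<lambda>c. (prim_root p ^ nth_elem (exponents p q S) c) ^ t))"
  unfolding model_elem_def pow_pgl(1)[OF diag_model_in_GL] unfolding diag_model_def mat_diag_power ..

lemma scalar_diag_cong:
  fixes d d' :: "nat \<Rightarrow> complex"
  assumes "mat_diag n d = c \<cdot>\<^sub>m mat_diag n d'" and "i < n"
  shows "d i = c * d' i"
proof -
  have "mat_diag n d $$ (i, i) = (c \<cdot>\<^sub>m mat_diag n d') $$ (i, i)" using assms(1) by simp
  then show ?thesis using assms(2) by (simp add: mat_diag_def)
qed

text \<open>The model element is not the identity because two different residues in \<open>S\<close> give two different diagonal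
  entries.\<close>
lemma model_elem_props:
  assumes p: "prime p" and S: "S \<subseteq> {..<p}" and two: "2 \<le> card S" and n: "n = q * p + card S"
  shows "model_elem p q S \<in> carrier (PGL n)"
    and "model_elem p q S [^]\<^bsub>PGL n\<^esub> p = \<one>\<^bsub>PGL n\<^esub>"
    and "model_elem p q S \<noteq> \<one>\<^bsub>PGL n\<^esub>"
proof -
  have p0: "p > 0" using p prime_gt_0_nat by blast
  have finS: "finite S" using S finite_subset by blast
  let ?e = "nth_elem (exponents p q S)"
  have bij: "bij_betw ?e {..<n} (exponents p q S)"
    using nth_elem_bij[of "exponents p q S"] card_exponents[OF finS] finS n by simp
  show "model_elem p q S \<in> carrier (PGL n)"
    unfolding model_elem_def n by (rule pgl_in_carrier[OF diag_model_in_GL])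
  have "(prim_root p ^ k) ^ p = 1" for k
    using prim_root_power_self[OF p0] by (simp add: power_mult flip: power_mult) (metis mult.commute power_mult power_one)
  then show "model_elem p q S [^]\<^bsub>PGL n\<^esub> p = \<one>\<^bsub>PGL n\<^esub>"
    unfolding n model_elem_power one_PGL by simp
  show "model_elem p q S \<noteq> \<one>\<^bsub>PGL n\<^esub>"
  proof
    assume "model_elem p q S = \<one>\<^bsub>PGL n\<^esub>"
    then obtain c where "diag_model p q S = c \<cdot>\<^sub>m 1\<^sub>m n"
      using diag_model_in_GL[of p q S] unfolding n one_PGL model_elem_def
      by (subst (asm) pgl_eq_iff) (auto simp: carrier_GL)
    then have "mat_diag n (\<lambda>c. prim_root p ^ ?e c) = c \<cdot>\<^sub>m mat_diag n (\<lambda>_. 1)"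
      unfolding diag_model_def n by simp
    then have c: "prim_root p ^ ?e i = c" if "i < n" for i
      using scalar_diag_cong[of n _ c "\<lambda>_. 1", OF _ that] by auto
    obtain s s' where s: "s \<in> S" "s' \<in> S" "s \<noteq> s'"
      using two by (metis card_le_Suc0_iff_eq finS not_less_eq_eq numeral_2_eq_2)
    have "prim_root p ^ (q * p + t) = c" if t: "t \<in> S" for t
    proof -
      have "q * p + t \<in> exponents p q S" using t by (simp add: exponents_def)
      then obtain i where "i < n" "?e i = q * p + t"
        using bij_betw_imp_surj_on[OF bij] by (metis imageE lessThan_iff)
      then show ?thesis using c by metis
    qed
    then have "prim_root p ^ (q * p + s) = prim_root p ^ (q * p + s')" using s by simp
    then have "s mod p = s' mod p" by (simp add: prim_root_power_eq_iff[OF p0])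
    moreover have "s < p" "s' < p" using s(1,2) S by blast+
    ultimately show False using s(3) by simp
  qed
qed

text \<open>The points of the roots of unity of order \<open>p ^ N\<close> form an invariant set, and they are in general
  position because any \<open>n\<close> of them are independent.\<close>
lemma model_group_admissible:
  assumes p: "prime p" and S: "S \<subseteq> {..<p}" and two: "2 \<le> card S" and n: "n = q * p + card S"
  shows "admissible n (generate (PGL n) {model_elem p q S})"
    and "card (generate (PGL n) {model_elem p q S}) = p"
proof -
  interpret PGL: group "PGL n" by (rule group_PGL)
  note g = model_elem_props[OF p S two n]
  have p0: "p > 0" and p2: "p \<ge> 2" using p prime_gt_0_nat prime_ge_2_nat by blast+
  have finS: "finite S" using S finite_subset by blast
  define E where "E = exponents p q S"
  have n_E: "n = card E" by (simp add: n E_def card_exponents[OF finS])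
  have n2: "n \<ge> 2" using two n by simp
  show card_p: "card (generate (PGL n) {model_elem p q S}) = p"
    by (rule PGL.prime_order_elem_powers(3)[OF p g])
  \<comment> \<open>Any exponent with \<open>p ^ N \<ge> n + 2\<close> gives enough points.\<close>
  define N where "N = n + 2"
  define Z where "Z = {z :: complex. z ^ (p ^ N) = 1}"
  have PN: "p ^ N \<ge> n + 2"
  proof -
    have "n + 2 < 2 ^ N" unfolding N_def by (rule power_gt_expt) simp
    also have "\<dots> \<le> p ^ N" using p2 by (intro power_mono) auto
    finally show ?thesis by simp
  qed
  have PN0: "p ^ N > 0" using p0 by simp
  have cardZ: "card Z = p ^ N" unfolding Z_def by (rule card_roots_unity_eq[OF PN0])
  have finZ: "finite Z" using cardZ PN0 by (metis card.infinite less_irrefl)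
  have ind: "indep n J (point_vec E)" if J: "J \<subseteq> Z" "card J \<le> n" for J
  proof -
    have "n \<le> card Z" using cardZ PN by simp
    from exists_subset_between[OF J(2) this J(1) finZ] obtain K
      where K: "J \<subseteq> K" "K \<subseteq> Z" "card K = n" by blast
    have finK: "finite K" using K(2) finZ by (rule finite_subset)
    have "indep (card E) K (point_vec E)"
      using K by (intro roots_of_unity_point_vecs_indep[OF p S E_def]) (auto simp: Z_def n_E)
    then show ?thesis using K(1) finK unfolding n_E by (rule indep_subset)
  qed
  define L where "L z = line (point_vec E z)" for z
  have "inj_on L Z"
  proof (rule inj_onI)
    fix x y assume xy: "x \<in> Z" "y \<in> Z" "L x = L y"
    show "x = y"
    proof (rule ccontr)
      assume neq: "x \<noteq> y"
      obtain c where c: "point_vec E x = c \<cdot>\<^sub>v point_vec E y"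
        using line_eqD xy(3) unfolding L_def by blast
      have "indep n {x, y} (point_vec E)" using xy neq n2 by (intro ind) auto
      then have "(if x = x then 1 else - c) = 0"
      proof (rule indepD[where c = "\<lambda>z. if z = x then 1 else - c"])
        fix j assume j: "j < n"
        have "point_vec E x $ j = (c \<cdot>\<^sub>v point_vec E y) $ j" by (simp only: c)
        also have "\<dots> = c * point_vec E y $ j"
          using j by (intro index_smult_vec(1)) (simp add: n_E point_vec_def)
        finally show "(\<Sum>z\<in>{x, y}. (if z = x then 1 else - c) * point_vec E z $ j) = 0"
          using neq by simp
      qed simp
      then show False by simp
    qed
  qed
  then have card_T: "card (L ` Z) = p ^ N" using cardZ by (simp add: card_image)
  have "L ` Z \<subseteq> proj_points n"
  proof
    fix P assume "P \<in> L ` Z"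
    then obtain z where z: "z \<in> Z" "P = line (point_vec E z)" unfolding L_def by blast
    have "z \<noteq> 0"
    proof
      assume "z = 0"
      then show False using z(1) zero_power[OF PN0, where 'a = complex] by (simp add: Z_def)
    qed
    then have "point_vec E z $ 0 \<noteq> 0\<^sub>v n $ 0" using n2 n_E by (simp add: point_vec_def)
    then have "point_vec E z \<noteq> 0\<^sub>v n" by metis
    then show "P \<in> proj_points n" unfolding proj_points_def z(2) n_E by auto
  qed
  moreover have "general_position n (L ` Z)"
    unfolding L_def using ind by (intro general_positionI[OF finZ]) (auto simp: n_E)
  moreover have "generate (PGL n) {model_elem p q S} \<subseteq> Aut n (L ` Z)"
  proof
    fix f assume f: "f \<in> generate (PGL n) {model_elem p q S}"
    then obtain t :: nat where "f = model_elem p q S [^]\<^bsub>PGL n\<^esub> t"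
      unfolding PGL.prime_order_elem_powers(2)[OF p g] by blast
    then have f_eq: "f = pgl n (mat_diag n (\<lambda>c. (prim_root p ^ nth_elem E c) ^ t))"
      unfolding n model_elem_power E_def .
    have act: "proj_act f (L z) = L (prim_root p ^ t * z)" for z
      unfolding f_eq L_def using point_vec_carrier[of E z] diag_mult_point_vec[of E "prim_root p" t z]
      by (subst proj_act_line) (simp_all add: n_E)
    have N0: "N = Suc (n + 1)" by (simp add: N_def)
    have "prim_root p ^ (p ^ N) = 1" unfolding N0 power_Suc power_mult prim_root_power_self[OF p0] by simp
    then have root1: "(prim_root p ^ t) ^ (p ^ N) = 1" by (metis mult.commute power_mult power_one)
    have "(\<lambda>z. prim_root p ^ t * z) ` Z = Z"
    proof (intro equalityI subsetI)
      fix z assume "z \<in> (\<lambda>z. prim_root p ^ t * z) ` Z"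
      then show "z \<in> Z" using root1 by (auto simp: Z_def power_mult_distrib)
    next
      fix z assume "z \<in> Z"
      then have "z / prim_root p ^ t \<in> Z" using root1 by (simp add: Z_def power_divide)
      then show "z \<in> (\<lambda>z. prim_root p ^ t * z) ` Z" by (intro image_eqI[of _ _ "z / prim_root p ^ t"]) simp_all
    qed
    moreover have "proj_act f ` L ` Z = L ` (\<lambda>z. prim_root p ^ t * z) ` Z"
      by (simp only: image_image act)
    ultimately have "proj_act f ` L ` Z = L ` Z" by simp
    moreover have "f \<in> carrier (PGL n)" using f g(1) PGL.generate_incl[of "{model_elem p q S}"] by blast
    ultimately show "f \<in> Aut n (L ` Z)" unfolding Aut_def by blast
  qed
  moreover have "subgroup (generate (PGL n) {model_elem p q S}) (PGL n)"
    using g(1) by (intro PGL.generate_is_subgroup) simp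
  moreover have "finite (generate (PGL n) {model_elem p q S})"
    using card_p p0 by (metis card.infinite less_irrefl)
  moreover have "finite (L ` Z)" using finZ by simp
  ultimately show "admissible n (generate (PGL n) {model_elem p q S})"
    unfolding admissible_def using card_T PN by auto
qed

definition affine :: "nat \<Rightarrow> nat \<Rightarrow> nat \<Rightarrow> nat \<Rightarrow> nat" where
  "affine p u v i = (u * i + v) mod p"

text \<open>The equivalence of subsets of the integers modulo \<open>p\<close> under the one-dimensional affine group.\<close>
definition affine_related :: "nat \<Rightarrow> nat set \<Rightarrow> nat set \<Rightarrow> bool" where
  "affine_related p S S' \<longleftrightarrow> (\<exists>u v. \<not> p dvd u \<and> S = affine p u v ` S')"

lemma affine_bij:
  assumes "prime p" and "\<not> p dvd u"
  shows "bij_betw (affine p u v) {..<p} {..<p}"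
proof -
  have p0: "p > 0" using assms(1) prime_gt_0_nat by blast
  have "inj_on (affine p u v) {..<p}"
  proof (rule inj_onI)
    fix i j assume ij: "i \<in> {..<p}" "j \<in> {..<p}" "affine p u v i = affine p u v j"
    then have "[u * i = u * j] (mod p)"
      by (simp add: affine_def cong_add_rcancel_nat flip: cong_def)
    moreover have "coprime u p" using assms by (metis coprime_commute prime_imp_coprime)
    ultimately have "[i = j] (mod p)" by (simp add: cong_mult_lcancel_nat)
    then show "i = j" using ij by (simp add: cong_def)
  qed
  moreover have "affine p u v ` {..<p} \<subseteq> {..<p}" using p0 by (auto simp: affine_def)
  ultimately show ?thesis
    using endo_inj_surj[of "{..<p}"] by (auto simp: bij_betw_def)
qed

lemma affine_related_complement:
  assumes "prime p" and "S \<subseteq> {..<p}" and "S' \<subseteq> {..<p}"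
  shows "affine_related p ({..<p} - S) ({..<p} - S') \<longleftrightarrow> affine_related p S S'"
proof -
  have "{..<p} - S = affine p u v ` ({..<p} - S') \<longleftrightarrow> S = affine p u v ` S'" if "\<not> p dvd u" for u v
  proof -
    have bij: "bij_betw (affine p u v) {..<p} {..<p}" by (rule affine_bij[OF assms(1) that])
    have "affine p u v ` ({..<p} - S') = {..<p} - affine p u v ` S'"
      using inj_on_image_set_diff[OF bij_betw_imp_inj_on[OF bij], of "{..<p}" S']
        bij_betw_imp_surj_on[OF bij] assms(3) by auto
    moreover have "affine p u v ` S' \<subseteq> {..<p}"
      using bij_betw_imp_surj_on[OF bij] assms(3) by blast
    ultimately show ?thesis using assms(2) double_diff[OF _ subset_refl] by metis
  qed
  then show ?thesis unfolding affine_related_def by metis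
qed

section \<open>Conjugacy of diagonal models\<close>

lemma card_vimage_permutes:
  assumes "\<sigma> permutes {..<n}" and "\<And>i. i < n \<Longrightarrow> f (\<sigma> i) = g i"
  shows "card {i. i < n \<and> f i = y} = card {i. i < n \<and> g i = y}"
proof -
  have "\<sigma> ` {i. i < n \<and> g i = y} = {i. i < n \<and> f i = y}"
  proof (intro equalityI subsetI)
    fix i assume "i \<in> \<sigma> ` {i. i < n \<and> g i = y}"
    then show "i \<in> {i. i < n \<and> f i = y}"
      using assms permutes_in_image[OF assms(1)] by auto
  next
    fix i assume i: "i \<in> {i. i < n \<and> f i = y}"
    then obtain j where "j < n" "i = \<sigma> j"
      using permutes_image[OF assms(1)] by (metis (mono_tags, lifting) imageE lessThan_iff mem_Collect_eq)
    then show "i \<in> \<sigma> ` {i. i < n \<and> g i = y}" using i assms(2) by auto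
  qed
  then show ?thesis
    using card_image[of \<sigma> "{i. i < n \<and> g i = y}"] permutes_inj_on[OF assms(1)] by metis
qed

lemma permutation_of_equal_fibres:
  fixes f g :: "nat \<Rightarrow> 'b"
  assumes "\<And>y. card {i. i < n \<and> f i = y} = card {i. i < n \<and> g i = y}"
  obtains \<sigma> where "\<sigma> permutes {..<n :: nat}" "\<And>i. i < n \<Longrightarrow> f (\<sigma> i) = g i"
proof -
  have "count (image_mset h (mset_set {..<n})) y = card {i. i < n \<and> h i = y}" for h :: "nat \<Rightarrow> 'b" and y
  proof -
    have "{x \<in> {..<n}. y = h x} = {i. i < n \<and> h i = y}" by auto
    then show ?thesis by (simp add: count_image_mset' filter_mset_mset_set)
  qed
  then have "image_mset g (mset_set {..<n}) = image_mset f (mset_set {..<n})"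
    using assms by (intro multiset_eqI) simp
  then obtain \<sigma> where "\<sigma> permutes {..<n}" "\<forall>x\<in>{..<n}. g x = f (\<sigma> x)"
    using image_mset_eq_implies_permutes[of "{..<n}" g f] by auto
  then show thesis using that by auto
qed

text \<open>Some term in the Leibniz formula is nonzero. Applied to an intertwining matrix, this matches the
  eigenvalues of two diagonal matrices without characteristic polynomials.\<close>
lemma det_nonzero_imp_permutation:
  assumes "A \<in> carrier_mat n n" and "det A \<noteq> (0 :: complex)"
  obtains \<sigma> where "\<sigma> permutes {..<n}" "\<And>i. i < n \<Longrightarrow> A $$ (i, \<sigma> i) \<noteq> 0"
proof -
  obtain \<sigma> where \<sigma>: "\<sigma> permutes {0..<n}" "signof \<sigma> * (\<Prod>i = 0..<n. A $$ (i, \<sigma> i)) \<noteq> 0"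
    using assms(2) unfolding det_def'[OF assms(1)] by (metis (mono_tags, lifting) mem_Collect_eq sum.neutral)
  then show thesis using that[of \<sigma>] by (auto simp: lessThan_atLeast0)
qed

lemma card_nth_elem_residue:
  assumes "S \<subseteq> {..<p}" and "i < p" and "n = q * p + card S"
  shows "card {c. c < n \<and> nth_elem (exponents p q S) c mod p = i} = q + (if i \<in> S then 1 else 0)"
proof -
  have finS: "finite S" using assms(1) finite_subset by blast
  let ?e = "nth_elem (exponents p q S)"
  have bij: "bij_betw ?e {..<n} (exponents p q S)"
    using nth_elem_bij[of "exponents p q S"] card_exponents[OF finS] finS assms(3) by simp
  have img: "?e ` {c. c < n \<and> ?e c mod p = i} = {e \<in> exponents p q S. e mod p = i}"
  proof (intro equalityI subsetI)
    fix e assume e: "e \<in> {e \<in> exponents p q S. e mod p = i}"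
    then obtain c where "c < n" "e = ?e c" using bij_betw_imp_surj_on[OF bij] by blast
    then show "e \<in> ?e ` {c. c < n \<and> ?e c mod p = i}" using e by blast
  qed (use bij_betwE[OF bij] in auto)
  have "inj_on ?e {c. c < n \<and> ?e c mod p = i}"
    by (rule inj_on_subset[OF bij_betw_imp_inj_on[OF bij]]) auto
  from card_image[OF this] have "card {c. c < n \<and> ?e c mod p = i} = card {e \<in> exponents p q S. e mod p = i}"
    unfolding img by (rule sym)
  then show ?thesis using card_exponents_residue[OF assms(1,2)] by simp
qed

text \<open>The residues that occur \<open>q + 1\<close> times rather than \<open>q\<close> times are the elements of \<open>S\<close> on one side and
  the affine images of the elements of \<open>S'\<close> on the other.\<close>
lemma equal_fibres_iff_affine_image:
  fixes p q u v :: nat and S S' :: "nat set"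
  assumes p: "prime p" and S: "S \<subseteq> {..<p}" "S' \<subseteq> {..<p}" and u: "\<not> p dvd u"
    and n: "n = q * p + card S" "n = q * p + card S'"
  defines "f \<equiv> \<lambda>c. nth_elem (exponents p q S) c mod p"
    and "g \<equiv> \<lambda>c. (u * nth_elem (exponents p q S') c + v) mod p"
  shows "(\<forall>y. card {c. c < n \<and> f c = y} = card {c. c < n \<and> g c = y}) \<longleftrightarrow> S = affine p u v ` S'"
proof -
  have p0: "p > 0" using p prime_gt_0_nat by blast
  note bij = affine_bij[OF p u, of v]
  have g: "g c = affine p u v (nth_elem (exponents p q S') c mod p)" for c
    unfolding g_def affine_def by (metis mod_add_left_eq mod_mult_right_eq)
  have count_g: "card {c. c < n \<and> g c = affine p u v i} = q + (if i \<in> S' then 1 else 0)" if i: "i < p" for i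
  proof -
    have "g c = affine p u v i \<longleftrightarrow> nth_elem (exponents p q S') c mod p = i" for c
      unfolding g using inj_onD[OF bij_betw_imp_inj_on[OF bij], of "nth_elem (exponents p q S') c mod p" i]
        i p0 by auto
    then show ?thesis using card_nth_elem_residue[OF S(2) i n(2)] by simp
  qed
  have count_f: "card {c. c < n \<and> f c = y} = q + (if y \<in> S then 1 else 0)" if "y < p" for y
    unfolding f_def by (rule card_nth_elem_residue[OF S(1) that n(1)])
  have aff_lt: "affine p u v i < p" for i using p0 by (simp add: affine_def)
  have "(\<forall>y. card {c. c < n \<and> f c = y} = card {c. c < n \<and> g c = y}) \<longleftrightarrow>
      (\<forall>i<p. affine p u v i \<in> S \<longleftrightarrow> i \<in> S')"
  proof
    assume A: "\<forall>y. card {c. c < n \<and> f c = y} = card {c. c < n \<and> g c = y}"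
    show "\<forall>i<p. affine p u v i \<in> S \<longleftrightarrow> i \<in> S'"
    proof (intro allI impI)
      fix i assume i: "i < p"
      show "affine p u v i \<in> S \<longleftrightarrow> i \<in> S'"
        using A[rule_format, of "affine p u v i"] count_g[OF i] count_f[OF aff_lt[of i]]
        by (simp split: if_splits)
    qed
  next
    assume A: "\<forall>i<p. affine p u v i \<in> S \<longleftrightarrow> i \<in> S'"
    show "\<forall>y. card {c. c < n \<and> f c = y} = card {c. c < n \<and> g c = y}"
    proof
      fix y
      show "card {c. c < n \<and> f c = y} = card {c. c < n \<and> g c = y}"
      proof (cases "y < p")
        case True
        then have "y \<in> affine p u v ` {..<p}" using bij_betw_imp_surj_on[OF bij] by simp
        then obtain i where "i < p" "y = affine p u v i" by blast
        then show ?thesis using A count_g count_f aff_lt by simp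
      next
        case False
        have "f c < p" "g c < p" for c using p0 by (simp_all add: f_def g_def)
        then have "{c. c < n \<and> f c = y} = {}" "{c. c < n \<and> g c = y} = {}" using False by auto
        then show ?thesis by (simp only:)
      qed
    qed
  qed
  also have "\<dots> \<longleftrightarrow> S = affine p u v ` S'"
  proof
    assume A: "\<forall>i<p. affine p u v i \<in> S \<longleftrightarrow> i \<in> S'"
    show "S = affine p u v ` S'"
    proof (intro equalityI subsetI)
      fix s assume s: "s \<in> S"
      then have "s \<in> affine p u v ` {..<p}" using S(1) bij_betw_imp_surj_on[OF bij] by auto
      then show "s \<in> affine p u v ` S'" using A s by auto
    qed (use A S(2) in auto)
  next
    assume A: "S = affine p u v ` S'"
    show "\<forall>i<p. affine p u v i \<in> S \<longleftrightarrow> i \<in> S'"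
    proof (intro allI impI)
      fix i assume "i < p"
      then show "affine p u v i \<in> S \<longleftrightarrow> i \<in> S'"
        unfolding A using S(2) inj_on_image_mem_iff[OF bij_betw_imp_inj_on[OF bij], of i S'] by simp
    qed
  qed
  finally show ?thesis .
qed

lemma diag_intertwining_entry:
  fixes P :: "complex mat"
  assumes "P \<in> carrier_mat n n" and "P * mat_diag n d = c \<cdot>\<^sub>m (mat_diag n d' * P)" and "i < n" "j < n"
  shows "P $$ (i, j) * d j = c * (d' i * P $$ (i, j))"
proof -
  have "(P * mat_diag n d) $$ (i, j) = (c \<cdot>\<^sub>m (mat_diag n d' * P)) $$ (i, j)" using assms(2) by simp
  then show ?thesis using assms by (simp add: mat_diag_mult_left[OF assms(1)] mat_diag_mult_right[OF assms(1)])
qed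

text \<open>If \<open>P\<close> intertwines the two models up to a scalar \<open>c\<close> and a power \<open>u\<close>, then \<open>c\<close> is a \<open>p\<close>-th root of
  unity, say with exponent \<open>v\<close>, and comparing eigenvalues shows that \<open>i \<mapsto> u * i + v\<close> maps \<open>S'\<close> onto \<open>S\<close>.
  Conversely such a map gives equal eigenvalues, and a permutation matrix intertwines.\<close>
lemma model_classes_eq_iff:
  assumes p: "prime p" and S: "S \<subseteq> {..<p}" "S' \<subseteq> {..<p}" and two: "2 \<le> card S" "card S' = card S"
    and n: "n = q * p + card S"
  shows "conjugacy_class (PGL n) (generate (PGL n) {model_elem p q S}) =
      conjugacy_class (PGL n) (generate (PGL n) {model_elem p q S'}) \<longleftrightarrow> affine_related p S S'"
proof -
  interpret PGL: group "PGL n" by (rule group_PGL)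
  have p0: "p > 0" using p prime_gt_0_nat by blast
  have n': "n = q * p + card S'" using n two by simp
  have two': "2 \<le> card S'" using two by simp
  note g = model_elem_props[OF p S(1) two(1) n] and g' = model_elem_props[OF p S(2) two' n']
  let ?e = "nth_elem (exponents p q S)" and ?e' = "nth_elem (exponents p q S')"
  let ?D = "mat_diag n (\<lambda>c. prim_root p ^ ?e c)" and ?D' = "\<lambda>u. mat_diag n (\<lambda>c. (prim_root p ^ ?e' c) ^ u)"
  have D: "?D \<in> carrier (GL n)" "?D' u \<in> carrier (GL n)" for u by (rule mat_diag_in_GL, simp)+
  have "conjugacy_class (PGL n) (generate (PGL n) {model_elem p q S}) =
      conjugacy_class (PGL n) (generate (PGL n) {model_elem p q S'}) \<longleftrightarrow>
      (\<exists>x\<in>carrier (PGL n). \<exists>u :: nat. x \<otimes>\<^bsub>PGL n\<^esub> model_elem p q S \<otimes>\<^bsub>PGL n\<^esub> inv\<^bsub>PGL n\<^esub> x =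
        model_elem p q S' [^]\<^bsub>PGL n\<^esub> u)"
    by (rule PGL.conjugacy_class_generate_eq_iff[OF p g g'])
  also have "\<dots> \<longleftrightarrow> (\<exists>P\<in>carrier (GL n). \<exists>u c. c \<noteq> 0 \<and> P * ?D = c \<cdot>\<^sub>m (?D' u * P))"
  proof -
    have "model_elem p q S' [^]\<^bsub>PGL n\<^esub> u = pgl n (?D' u)" for u :: nat
      unfolding n' by (rule model_elem_power)
    moreover have "model_elem p q S = pgl n ?D"
      by (simp add: model_elem_def diag_model_def n)
    ultimately show ?thesis
      unfolding carrier_PGL using D by (simp add: conjugate_pgl_eq_iff)
  qed
  also have "\<dots> \<longleftrightarrow> affine_related p S S'"
  proof
    assume "\<exists>P\<in>carrier (GL n). \<exists>u c. c \<noteq> 0 \<and> P * ?D = c \<cdot>\<^sub>m (?D' u * P)"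
    then obtain P u c where P: "P \<in> carrier_mat n n" "det P \<noteq> 0" and c: "c \<noteq> 0"
      and eq: "P * ?D = c \<cdot>\<^sub>m (?D' u * P)" by (auto simp: carrier_GL)
    obtain \<sigma> where \<sigma>: "\<sigma> permutes {..<n}" "\<And>i. i < n \<Longrightarrow> P $$ (i, \<sigma> i) \<noteq> 0"
      using det_nonzero_imp_permutation[OF P] by blast
    have rel: "prim_root p ^ ?e (\<sigma> i) = c * prim_root p ^ (u * ?e' i)" if i: "i < n" for i
    proof -
      have "\<sigma> i < n" using permutes_in_image[OF \<sigma>(1), of i] i by simp
      then show ?thesis
        using diag_intertwining_entry[OF P(1) eq i, of "\<sigma> i"] \<sigma>(2)[OF i]
        by (simp add: mult.commute flip: power_mult)
    qed
    have n0: "0 < n" using two(1) n by simp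
    have "c ^ p = 1"
    proof -
      have root: "(prim_root p ^ k) ^ p = 1" for k
        using prim_root_power_self[OF p0] by (metis mult.commute power_mult power_one)
      have "(prim_root p ^ ?e (\<sigma> 0)) ^ p = (c * prim_root p ^ (u * ?e' 0)) ^ p" using rel[OF n0] by simp
      then show ?thesis unfolding power_mult_distrib root by simp
    qed
    then obtain v where v: "c = prim_root p ^ v" using root_of_unity_eq_prim_root_power[OF p0] by blast
    have res: "?e (\<sigma> i) mod p = (u * ?e' i + v) mod p" if "i < n" for i
      using rel[OF that] by (simp add: v prim_root_power_eq_iff[OF p0] add.commute flip: power_add)
    have counts: "card {i. i < n \<and> ?e i mod p = y} = card {i. i < n \<and> (u * ?e' i + v) mod p = y}" for y
      using res by (intro card_vimage_permutes[OF \<sigma>(1)]) auto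
    \<comment> \<open>Otherwise all eigenvalues would coincide, although \<open>S\<close> has two elements.\<close>
    have u: "\<not> p dvd u"
    proof
      assume "p dvd u"
      then have const: "(u * ?e' i + v) mod p = v mod p" for i by (auto elim: dvdE simp: mult.assoc)
      obtain s where s: "s \<in> S" "s \<noteq> v mod p"
      proof -
        have "\<not> S \<subseteq> {v mod p}"
        proof
          assume "S \<subseteq> {v mod p}"
          then have "card S \<le> card {v mod p}" by (intro card_mono) auto
          then show False using two(1) by simp
        qed
        then show thesis using that by blast
      qed
      have "s < p" using s(1) S(1) by blast
      have "card {i. i < n \<and> ?e i mod p = s} = q + 1"
        using card_nth_elem_residue[OF S(1) \<open>s < p\<close> n] s(1) by simp
      moreover have "card {i. i < n \<and> (u * ?e' i + v) mod p = s} = 0" using s(2) by (simp add: const)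
      ultimately show False using counts[of s] by simp
    qed
    then have "S = affine p u v ` S'"
      using equal_fibres_iff_affine_image[OF p S u n n', of v] counts by simp
    then show "affine_related p S S'" unfolding affine_related_def using u by blast
  next
    assume "affine_related p S S'"
    then obtain u v where u: "\<not> p dvd u" and "S = affine p u v ` S'"
      unfolding affine_related_def by blast
    then have "\<forall>y. card {c. c < n \<and> ?e c mod p = y} = card {c. c < n \<and> (u * ?e' c + v) mod p = y}"
      using equal_fibres_iff_affine_image[OF p S u n n', of v] by simp
    then obtain \<sigma> where \<sigma>: "\<sigma> permutes {..<n}" "\<And>i. i < n \<Longrightarrow> ?e (\<sigma> i) mod p = (u * ?e' i + v) mod p"
      using permutation_of_equal_fibres[of n "\<lambda>c. ?e c mod p" "\<lambda>c. (u * ?e' c + v) mod p"] by blast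
    define P where "P = mat n n (\<lambda>(i, j). 1\<^sub>m n $$ (\<sigma> i, j) :: complex)"
    have P: "P \<in> carrier_mat n n" by (simp add: P_def)
    have \<sigma>n: "\<sigma> i < n" if "i < n" for i using permutes_in_image[OF \<sigma>(1), of i] that by simp
    have "det P = signof \<sigma> * det (1\<^sub>m n :: complex mat)"
      unfolding P_def using \<sigma>(1) by (intro det_permute_rows) (auto simp: lessThan_atLeast0)
    then have "det P \<noteq> 0" by (simp add: sign_def)
    moreover have "P * ?D = prim_root p ^ v \<cdot>\<^sub>m (?D' u * P)"
    proof (rule eq_matI)
      fix i j assume "i < dim_row (prim_root p ^ v \<cdot>\<^sub>m (?D' u * P))" "j < dim_col (prim_root p ^ v \<cdot>\<^sub>m (?D' u * P))"
      then have ij: "i < n" "j < n" using P by (auto simp: mat_diag_def)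
      have "prim_root p ^ ?e (\<sigma> i) = prim_root p ^ v * (prim_root p ^ ?e' i) ^ u"
        using \<sigma>(2)[OF ij(1)]
        by (simp add: prim_root_power_eq_iff[OF p0] ac_simps flip: power_add power_mult)
      then show "(P * ?D) $$ (i, j) = (prim_root p ^ v \<cdot>\<^sub>m (?D' u * P)) $$ (i, j)"
        using ij P \<sigma>n by (simp add: mat_diag_mult_left[OF P] mat_diag_mult_right[OF P]) (auto simp: P_def)
    qed (use P in \<open>auto simp: mat_diag_def\<close>)
    ultimately show "\<exists>P\<in>carrier (GL n). \<exists>u c. c \<noteq> 0 \<and> P * ?D = c \<cdot>\<^sub>m (?D' u * P)"
      using P by (intro bexI[of _ P] exI[of _ u] exI[of _ "prim_root p ^ v"]) (auto simp: carrier_GL)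
  qed
  finally show ?thesis .
qed

section \<open>Fixed points and eigenvectors\<close>

lemma mult_mat_vec_index:
  assumes "A \<in> carrier_mat n n" and "v \<in> carrier_vec n" and "j < n"
  shows "(A *\<^sub>v v) $ j = (\<Sum>k<n. A $$ (j, k) * v $ k)"
  using assms by (simp add: scalar_prod_def lessThan_atLeast0)

lemma mat_eq_on_basis:
  assumes A: "A \<in> carrier_mat n n" and B: "B \<in> carrier_mat n n"
    and "finite Y" and "indep n Y v" and "card Y = n" and v: "\<And>y. y \<in> Y \<Longrightarrow> v y \<in> carrier_vec n"
    and eq: "\<And>y. y \<in> Y \<Longrightarrow> A *\<^sub>v v y = B *\<^sub>v v y"
  shows "A = B"
proof (rule eq_matI)
  fix j i assume ji: "j < dim_row B" "i < dim_col B"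
  then have j: "j < n" and i: "i < n" using B by auto
  obtain c where c: "\<And>k. k < n \<Longrightarrow> unit_vec n i $ k = (\<Sum>y\<in>Y. c y * v y $ k)"
    using indep_card_eq_imp_in_span[OF assms(3-5), of "unit_vec n i"] unfolding in_span_def by blast
  have entry: "M $$ (j, i) = (\<Sum>y\<in>Y. c y * (M *\<^sub>v v y) $ j)" if M: "M \<in> carrier_mat n n" for M
  proof -
    have "M $$ (j, i) = (\<Sum>k<n. if k = i then M $$ (j, k) else 0)" using i by simp
    also have "\<dots> = (\<Sum>k<n. M $$ (j, k) * unit_vec n i $ k)"
      using i by (intro sum.cong) auto
    also have "\<dots> = (\<Sum>k<n. \<Sum>y\<in>Y. c y * (M $$ (j, k) * v y $ k))"
      by (intro sum.cong refl) (simp add: c sum_distrib_left mult.left_commute del: index_unit_vec)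
    also have "\<dots> = (\<Sum>y\<in>Y. c y * (M *\<^sub>v v y) $ j)"
      by (subst sum.swap) (simp add: mult_mat_vec_index[OF M v j] sum_distrib_left)
    finally show ?thesis .
  qed
  show "A $$ (j, i) = B $$ (j, i)" using entry[OF A] entry[OF B] eq by simp
qed (use A B in auto)

text \<open>The linear relations between \<open>n + 2\<close> points in general position form a plane on which \<open>A\<close> acts, and a
  nonzero relation has at most one zero coefficient. For each fixed point \<open>y\<close> there is a relation vanishing
  only at \<open>y\<close>, and it is an eigenvector of the action. Three fixed points give three eigenlines in a plane,
  so \<open>A\<close> acts on all relations by a scalar. A relation that vanishes at \<open>z\<close> then also vanishes at the
  image of \<open>z\<close>, whence \<open>z\<close> is fixed.\<close>
lemma three_fixed_points_imp_scalar:
  assumes A: "A \<in> carrier_mat n n" and X: "finite X" "card X = n + 2"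
    and v: "\<And>x. x \<in> X \<Longrightarrow> v x \<in> carrier_vec n"
    and ind: "\<And>Y. Y \<subseteq> X \<Longrightarrow> card Y = n \<Longrightarrow> indep n Y v"
    and \<sigma>: "bij_betw \<sigma> X X" and \<alpha>: "\<And>x. x \<in> X \<Longrightarrow> \<alpha> x \<noteq> 0"
    and act: "\<And>x. x \<in> X \<Longrightarrow> A *\<^sub>v v x = \<alpha> x \<cdot>\<^sub>v v (\<sigma> x)"
    and y: "y1 \<in> X" "y2 \<in> X" "y3 \<in> X" "y1 \<noteq> y2" "y1 \<noteq> y3" "y2 \<noteq> y3"
    and fixed: "\<sigma> y1 = y1" "\<sigma> y2 = y2" "\<sigma> y3 = y3"
  shows "\<exists>\<mu>. \<forall>x\<in>X. \<sigma> x = x \<and> \<alpha> x = \<mu>"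
proof -
  define rel where "rel r \<longleftrightarrow> (\<forall>j<n. (\<Sum>x\<in>X. r x * v x $ j) = 0)" for r
  \<comment> \<open>The other \<open>n\<close> points are independent.\<close>
  have two_zeros: "r z = 0" if r: "rel r" "x \<in> X" "y \<in> X" "x \<noteq> y" "r x = 0" "r y = 0" "z \<in> X" for r x y z
  proof -
    have "card (X - {x, y}) = n" using X r by (simp add: card_Diff_subset)
    then have "indep n (X - {x, y}) v" by (intro ind) auto
    moreover have "(\<Sum>w\<in>X - {x, y}. r w * v w $ j) = 0" if "j < n" for j
    proof -
      have "(\<Sum>w\<in>X - {x, y}. r w * v w $ j) = (\<Sum>w\<in>X. r w * v w $ j)"
        using X(1) r by (intro sum.mono_neutral_left) auto
      then show ?thesis using r(1) that by (simp add: rel_def)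
    qed
    ultimately have "\<forall>w\<in>X - {x, y}. r w = 0" unfolding indep_def by blast
    then show ?thesis using r by blast
  qed
  have ex: "\<exists>r. rel r \<and> r y = 0 \<and> (\<forall>x\<in>X - {y}. r x \<noteq> 0)" if yX: "y \<in> X" for y
  proof -
    have "\<not> indep n (X - {y}) v"
    proof
      assume "indep n (X - {y}) v"
      then have "card (X - {y}) \<le> n" using X(1) by (intro indep_card_le) auto
      then show False using X yX by simp
    qed
    then obtain c z where c: "\<forall>j<n. (\<Sum>x\<in>X - {y}. c x * v x $ j) = 0" and z: "z \<in> X - {y}" "c z \<noteq> 0"
      unfolding indep_def by blast
    define r where "r x = (if x = y then 0 else c x)" for x
    have "(\<Sum>x\<in>X. r x * v x $ j) = (\<Sum>x\<in>X - {y}. c x * v x $ j)" for j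
      using X(1) by (intro sum.mono_neutral_cong_right) (auto simp: r_def)
    then have r: "rel r" using c by (simp add: rel_def)
    have ry: "r y = 0" by (simp add: r_def)
    have "r x \<noteq> 0" if x: "x \<in> X - {y}" for x
    proof
      assume "r x = 0"
      then have "r z = 0" using two_zeros[OF r, of x y z] x yX ry z by auto
      then show False using z by (simp add: r_def)
    qed
    then show ?thesis using r ry by blast
  qed
  have eigen: "\<alpha> x * r x = \<alpha> y * r (\<sigma> x)"
    if r: "rel r" "r y' = 0" and yy: "y \<in> X" "y' \<in> X" "y \<noteq> y'" "\<sigma> y = y" "\<sigma> y' = y'" and x: "x \<in> X" for r y y' x
  proof -
    define s where "s = the_inv_into X \<sigma>"
    \<comment> \<open>The image of the relation \<open>r\<close> under \<open>A\<close>, corrected so as to vanish at both fixed points.\<close>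
    define r' where "r' x = \<alpha> (s x) * r (s x) - \<alpha> y * r x" for x
    have s: "s (\<sigma> x) = x" if "x \<in> X" for x
      unfolding s_def using that by (intro the_inv_into_f_f bij_betw_imp_inj_on[OF \<sigma>])
    have "(\<Sum>x\<in>X. r' x * v x $ j) = 0" if j: "j < n" for j
    proof -
      have "(\<Sum>x\<in>X. \<alpha> (s x) * r (s x) * v x $ j) = (\<Sum>x\<in>X. \<alpha> (s (\<sigma> x)) * r (s (\<sigma> x)) * v (\<sigma> x) $ j)"
        by (rule sum.reindex_bij_betw[OF \<sigma>, symmetric])
      also have "\<dots> = (\<Sum>x\<in>X. r x * (A *\<^sub>v v x) $ j)"
      proof (intro sum.cong refl)
        fix x assume x: "x \<in> X"
        have "v (\<sigma> x) \<in> carrier_vec n" using bij_betwE[OF \<sigma>] x v by blast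
        then have "(\<alpha> x \<cdot>\<^sub>v v (\<sigma> x)) $ j = \<alpha> x * v (\<sigma> x) $ j"
          using j by (intro index_smult_vec(1)) auto
        then show "\<alpha> (s (\<sigma> x)) * r (s (\<sigma> x)) * v (\<sigma> x) $ j = r x * (A *\<^sub>v v x) $ j"
          by (simp only: act[OF x] s[OF x] mult_ac)
      qed
      also have "\<dots> = (\<Sum>x\<in>X. \<Sum>k<n. A $$ (j, k) * (r x * v x $ k))"
        by (intro sum.cong refl) (simp add: mult_mat_vec_index[OF A v j] sum_distrib_left mult.left_commute)
      also have "\<dots> = (\<Sum>k<n. A $$ (j, k) * (\<Sum>x\<in>X. r x * v x $ k))"
        unfolding sum_distrib_left by (rule sum.swap)
      also have "\<dots> = 0" using r(1) by (simp add: rel_def)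
      finally have "(\<Sum>x\<in>X. \<alpha> (s x) * r (s x) * v x $ j) = 0" .
      moreover have "(\<Sum>x\<in>X. \<alpha> y * r x * v x $ j) = 0"
        using r(1) j by (simp add: rel_def mult.assoc flip: sum_distrib_left)
      ultimately show ?thesis by (simp add: r'_def left_diff_distrib sum_subtractf)
    qed
    then have rel': "rel r'" by (simp add: rel_def)
    have "r' y = 0" using s[OF yy(1)] yy by (simp add: r'_def)
    moreover have "r' y' = 0" using s[OF yy(2)] yy r(2) by (simp add: r'_def)
    moreover have "\<sigma> x \<in> X" using bij_betwE[OF \<sigma>] x by blast
    ultimately have "r' (\<sigma> x) = 0" by (rule two_zeros[OF rel' yy(1-3)])
    then show ?thesis by (simp add: r'_def s[OF x])
  qed
  obtain r1 where r1: "rel r1" "r1 y1 = 0" "\<forall>x\<in>X - {y1}. r1 x \<noteq> 0" using ex[OF y(1)] by blast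
  obtain r2 where r2: "rel r2" "r2 y2 = 0" "\<forall>x\<in>X - {y2}. r2 x \<noteq> 0" using ex[OF y(2)] by blast
  define \<mu> where "\<mu> = \<alpha> y3"
  have "\<alpha> y3 * r2 y3 = \<alpha> y1 * r2 y3"
    using eigen[OF r2(1,2) y(1,2,4) fixed(1,2) y(3)] fixed by simp
  then have \<alpha>1: "\<alpha> y1 = \<mu>" using r2(3) y unfolding \<mu>_def by auto
  have "\<alpha> y3 * r1 y3 = \<alpha> y2 * r1 y3"
    using eigen[OF r1(1,2) y(2,1) y(4)[symmetric] fixed(2,1) y(3)] fixed by simp
  then have \<alpha>2: "\<alpha> y2 = \<mu>" using r1(3) y unfolding \<mu>_def by auto
  have e1: "\<alpha> x * r1 x = \<mu> * r1 (\<sigma> x)" if "x \<in> X" for x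
    using eigen[OF r1(1,2) y(2,1) y(4)[symmetric] fixed(2,1) that] \<alpha>2 by simp
  have e2: "\<alpha> x * r2 x = \<mu> * r2 (\<sigma> x)" if "x \<in> X" for x
    using eigen[OF r2(1,2) y(1,2,4) fixed(1,2) that] \<alpha>1 by simp
  have "\<sigma> z = z \<and> \<alpha> z = \<mu>" if z: "z \<in> X" for z
  proof (cases "z = y1 \<or> z = y2")
    case True
    then show ?thesis using fixed \<alpha>1 \<alpha>2 by auto
  next
    case False
    then have nz: "r1 z \<noteq> 0" "r2 z \<noteq> 0" using z r1(3) r2(3) by auto
    \<comment> \<open>The combination of the two eigenrelations that vanishes at \<open>z\<close>.\<close>
    define r where "r x = r1 z * r2 x - r2 z * r1 x" for x
    have "rel r"
      using r1(1) r2(1)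
      by (simp add: rel_def r_def left_diff_distrib sum_subtractf mult.assoc flip: sum_distrib_left)
    have rz: "r z = 0" by (simp add: r_def)
    have "\<mu> * r (\<sigma> z) = r1 z * (\<mu> * r2 (\<sigma> z)) - r2 z * (\<mu> * r1 (\<sigma> z))"
      by (simp add: r_def algebra_simps)
    also have "\<dots> = 0" unfolding e1[OF z, symmetric] e2[OF z, symmetric] by simp
    finally have "r (\<sigma> z) = 0" using \<alpha>[OF y(3)] by (simp add: \<mu>_def)
    moreover have "\<sigma> z \<in> X" using bij_betwE[OF \<sigma>] z by blast
    moreover have "r y1 \<noteq> 0" using nz r1(2) r2(3) y by (simp add: r_def)
    ultimately have "\<sigma> z = z" using two_zeros[OF \<open>rel r\<close> z, of "\<sigma> z" y1] rz y(1) by metis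
    then show ?thesis using e2[OF z] nz by simp
  qed
  then show ?thesis by blast
qed

text \<open>Orthogonality of characters, with \<open>p - 1\<close> in the role of \<open>-1\<close> to stay within natural number exponents.\<close>
lemma sum_root_powers:
  assumes "prime p" and "t < p" and "t' < p"
  shows "(\<Sum>i<p. prim_root p ^ (i * t) * prim_root p ^ ((p - 1) * i * t')) = (if t = t' then of_nat p else 0)"
proof -
  have p0: "p > 0" using assms(1) prime_gt_0_nat by blast
  define z where "z = prim_root p ^ (t + (p - 1) * t')"
  have term_eq: "prim_root p ^ (i * t) * prim_root p ^ ((p - 1) * i * t') = z ^ i" for i
    unfolding z_def by (simp add: algebra_simps flip: power_add power_mult)
  have "z = 1 \<longleftrightarrow> (t + (p - 1) * t') mod p = 0"
    unfolding z_def using prim_root_power_eq_iff[OF p0, of "t + (p - 1) * t'" 0] by simp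
  also have "\<dots> \<longleftrightarrow> t = t'"
  proof -
    obtain p' where p': "p = Suc p'" using p0 by (cases p) auto
    have eq: "int (t + (p - 1) * t') = int p * int t' + (int t - int t')"
      by (simp add: p' algebra_simps)
    have "(t + (p - 1) * t') mod p = 0 \<longleftrightarrow> int p dvd int (t + (p - 1) * t')"
      by (simp only: int_dvd_int_iff flip: dvd_eq_mod_eq_0)
    also have "\<dots> \<longleftrightarrow> int p dvd int t - int t'"
      unfolding eq by (simp add: dvd_add_right_iff)
    also have "\<dots> \<longleftrightarrow> [int t = int t'] (mod int p)" by (simp add: cong_iff_dvd_diff)
    also have "\<dots> \<longleftrightarrow> [t = t'] (mod p)" by (simp only: cong_int_iff)
    also have "\<dots> \<longleftrightarrow> t = t'" using assms by (simp add: cong_def)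
    finally show ?thesis .
  qed
  finally have z1: "z = 1 \<longleftrightarrow> t = t'" .
  have zp: "z ^ p = 1" unfolding z_def using prim_root_power_self[OF p0] by (metis mult.commute power_mult power_one)
  show ?thesis
  proof (cases "t = t'")
    case True
    then show ?thesis unfolding term_eq using z1 by simp
  next
    case False
    then show ?thesis unfolding term_eq using z1 zp geometric_sum[of z p] by simp
  qed
qed

text \<open>The Fourier transforms \<open>g (m, i)\<close> of the orbits \<open>w m\<close> are eigenvectors of \<open>A\<close>, and inversion recovers
  the orbits. Hence the transforms of the first \<open>q\<close> orbits are as independent as these orbits, and all
  transforms together span. A basis between the two families consists of the former and of the \<open>g (q, i)\<close>
  for \<open>i\<close> in a set \<open>S\<close> with \<open>a\<close> elements; in this basis \<open>A\<close> is the diagonal model.\<close>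
lemma cyclic_orbits_imp_diag_model:
  fixes A :: "complex mat" and w :: "nat \<Rightarrow> nat \<Rightarrow> complex vec"
  assumes p: "prime p" and a: "a < p" and n: "n = q * p + a"
    and A: "A \<in> carrier_mat n n"
    and w: "\<And>m t. w m t \<in> carrier_vec n" and step: "\<And>m t. A *\<^sub>v w m t = w m (Suc t)"
    and period: "\<And>m. w m p = w m 0"
    and ind: "\<And>Y. Y \<subseteq> {..q} \<times> {..<p} \<Longrightarrow> card Y \<le> n \<Longrightarrow> indep n Y (\<lambda>(m, t). w m t)"
  obtains S P where "S \<subseteq> {..<p}" "card S = a" "P \<in> carrier (GL n)" "P * diag_model p q S = A * P"
proof -
  have p0: "p > 0" using p prime_gt_0_nat by blast
  \<comment> \<open>The exponent \<open>(p - 1) * i * t\<close> stands for \<open>- i * t\<close>.\<close>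
  define g where "g = (\<lambda>(m, i). vec n (\<lambda>j. \<Sum>t<p. prim_root p ^ ((p - 1) * i * t) * w m t $ j))"
  have g_idx: "g (m, i) $ j = (\<Sum>t<p. prim_root p ^ ((p - 1) * i * t) * w m t $ j)" if "j < n" for m i j
    using that by (simp add: g_def)
  have g_carrier: "g x \<in> carrier_vec n" for x by (cases x) (simp add: g_def)
  have one: "prim_root p ^ (p * k) = 1" for k using prim_root_power_self[OF p0] by (simp add: power_mult)
  obtain p' where p': "p = Suc p'" using p0 by (cases p) auto
  have eigen: "(A *\<^sub>v g (m, i)) $ j = prim_root p ^ i * g (m, i) $ j" if j: "j < n" for m i j
  proof -
    let ?c = "\<lambda>t. prim_root p ^ ((p - 1) * i * t)"
    have c: "?c t = prim_root p ^ i * ?c (Suc t)" for t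
    proof -
      have "i + (p - 1) * i * Suc t = p * i + (p - 1) * i * t" by (simp add: p')
      then have "prim_root p ^ i * ?c (Suc t) = prim_root p ^ (p * i) * ?c t" by (metis power_add)
      then show ?thesis by (simp add: one)
    qed
    have "(A *\<^sub>v g (m, i)) $ j = (\<Sum>k<n. \<Sum>t<p. ?c t * (A $$ (j, k) * w m t $ k))"
      unfolding mult_mat_vec_index[OF A g_carrier j]
      by (intro sum.cong refl) (simp add: g_idx sum_distrib_left mult.left_commute)
    also have "\<dots> = (\<Sum>t<p. ?c t * (A *\<^sub>v w m t) $ j)"
      by (subst sum.swap) (simp only: mult_mat_vec_index[OF A w j] sum_distrib_left)
    also have "\<dots> = (\<Sum>t<p. prim_root p ^ i * (?c (Suc t) * w m (Suc t) $ j))"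
      unfolding step by (intro sum.cong refl) (metis c mult.assoc)
    also have "\<dots> = prim_root p ^ i * (\<Sum>t<p. ?c (Suc t) * w m (Suc t) $ j)"
      by (simp only: sum_distrib_left)
    also have "(\<Sum>t<p. ?c (Suc t) * w m (Suc t) $ j) = (\<Sum>t<p. ?c t * w m t $ j)"
    proof -
      have "(\<Sum>t<Suc p. ?c t * w m t $ j) = ?c 0 * w m 0 $ j + (\<Sum>t<p. ?c (Suc t) * w m (Suc t) $ j)"
        by (rule sum.lessThan_Suc_shift)
      moreover have "(\<Sum>t<Suc p. ?c t * w m t $ j) = (\<Sum>t<p. ?c t * w m t $ j) + ?c p * w m p $ j"
        by (rule sum.lessThan_Suc)
      moreover have "?c p = 1" using one[of "(p - 1) * i"] by (simp only: mult.commute)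
      ultimately show ?thesis by (simp add: period)
    qed
    finally show ?thesis using j by (simp only: g_idx)
  qed
  have w_in_span: "in_span n ({..q} \<times> {..<p}) g (w m t)" if m: "m \<le> q" and t: "t < p" for m t
  proof -
    have "w m t $ j = (\<Sum>x\<in>{..q} \<times> {..<p}. (case x of (m', i) \<Rightarrow> if m' = m then prim_root p ^ (i * t) / of_nat p else 0) * g x $ j)"
      if j: "j < n" for j
    proof -
      have "(\<Sum>x\<in>{..q} \<times> {..<p}. (case x of (m', i) \<Rightarrow> if m' = m then prim_root p ^ (i * t) / of_nat p else 0) * g x $ j) =
          (\<Sum>m'\<le>q. \<Sum>i<p. (if m' = m then prim_root p ^ (i * t) / of_nat p else 0) * g (m', i) $ j)"
        unfolding sum.cartesian_product by (intro sum.cong) auto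
      also have "\<dots> = (\<Sum>m'\<le>q. if m' = m then \<Sum>i<p. prim_root p ^ (i * t) / of_nat p * g (m', i) $ j else 0)"
        by (intro sum.cong refl) auto
      also have "\<dots> = (\<Sum>i<p. prim_root p ^ (i * t) / of_nat p * g (m, i) $ j)" using m by simp
      also have "\<dots> = (\<Sum>i<p. \<Sum>t'<p. (prim_root p ^ (i * t) * prim_root p ^ ((p - 1) * i * t')) * (w m t' $ j / of_nat p))"
        using j by (intro sum.cong refl) (simp add: g_idx sum_distrib_left field_simps)
      also have "\<dots> = (\<Sum>t'<p. (\<Sum>i<p. prim_root p ^ (i * t) * prim_root p ^ ((p - 1) * i * t')) * (w m t' $ j / of_nat p))"
        unfolding sum_distrib_right by (rule sum.swap)
      also have "\<dots> = (\<Sum>t'<p. if t' = t then w m t' $ j else 0)"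
      proof (intro sum.cong refl)
        fix t' assume "t' \<in> {..<p}"
        then show "(\<Sum>i<p. prim_root p ^ (i * t) * prim_root p ^ ((p - 1) * i * t')) * (w m t' $ j / of_nat p) =
            (if t' = t then w m t' $ j else 0)"
          using sum_root_powers[OF p t, of t'] p0 by auto
      qed
      also have "\<dots> = w m t $ j" using t by simp
      finally show ?thesis ..
    qed
    then show ?thesis unfolding in_span_def by (intro exI[of _ "\<lambda>(m', i). if m' = m then prim_root p ^ (i * t) / of_nat p else 0"]) blast
  qed
  have span: "in_span n ({..q} \<times> {..<p}) g v" for v
  proof -
    let ?Y = "{..<q} \<times> {..<p} \<union> {q} \<times> {..<a}"
    have "card ?Y = n" by (subst card_Un_disjoint) (auto simp: n card_cartesian_product)
    moreover have sub: "?Y \<subseteq> {..q} \<times> {..<p}" using a by auto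
    ultimately have "in_span n ?Y (\<lambda>(m, t). w m t) v"
      by (intro indep_card_eq_imp_in_span ind) auto
    then show ?thesis
    proof (rule in_span_trans)
      fix x assume "x \<in> ?Y"
      then obtain m t where "x = (m, t)" "m \<le> q" "t < p" using sub by blast
      then show "in_span n ({..q} \<times> {..<p}) g (case x of (m, t) \<Rightarrow> w m t)"
        using w_in_span by simp
    qed
  qed
  have indI: "indep n ({..<q} \<times> {..<p}) g"
    unfolding indep_def
  proof (intro allI impI ballI)
    fix b x assume b: "\<forall>j<n. (\<Sum>x\<in>{..<q} \<times> {..<p}. b x * g x $ j) = 0" and x: "x \<in> {..<q} \<times> {..<p}"
    define b' where "b' = (\<lambda>(m, t). \<Sum>i<p. b (m, i) * prim_root p ^ ((p - 1) * i * t))"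
    have "indep n ({..<q} \<times> {..<p}) (\<lambda>(m, t). w m t)"
      by (rule ind) (auto simp: n card_cartesian_product)
    moreover have "(\<Sum>x\<in>{..<q} \<times> {..<p}. b' x * (case x of (m, t) \<Rightarrow> w m t) $ j) = 0" if j: "j < n" for j
    proof -
      have "0 = (\<Sum>m<q. \<Sum>i<p. b (m, i) * g (m, i) $ j)"
        using b j unfolding sum.cartesian_product by (simp add: case_prod_unfold)
      also have "\<dots> = (\<Sum>m<q. \<Sum>i<p. \<Sum>t<p. b (m, i) * prim_root p ^ ((p - 1) * i * t) * w m t $ j)"
        using j by (simp add: g_idx sum_distrib_left mult.assoc)
      also have "\<dots> = (\<Sum>m<q. \<Sum>t<p. b' (m, t) * w m t $ j)"
      proof (rule sum.cong[OF refl])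
        fix m
        show "(\<Sum>i<p. \<Sum>t<p. b (m, i) * prim_root p ^ ((p - 1) * i * t) * w m t $ j) =
            (\<Sum>t<p. b' (m, t) * w m t $ j)"
          by (subst sum.swap) (simp add: b'_def sum_distrib_right)
      qed
      finally show ?thesis unfolding sum.cartesian_product by (simp add: case_prod_unfold)
    qed
    ultimately have b'0: "\<forall>x\<in>{..<q} \<times> {..<p}. b' x = 0" unfolding indep_def by blast
    obtain m i where mi: "x = (m, i)" "m < q" "i < p" using x by blast
    have "0 = (\<Sum>t<p. prim_root p ^ (t * i) * b' (m, t))" using b'0 mi by simp
    also have "\<dots> = (\<Sum>t<p. \<Sum>i'<p. b (m, i') * (prim_root p ^ (t * i) * prim_root p ^ ((p - 1) * t * i')))"
      by (intro sum.cong refl) (simp add: b'_def sum_distrib_left mult_ac)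
    also have "\<dots> = (\<Sum>i'<p. b (m, i') * (\<Sum>t<p. prim_root p ^ (t * i) * prim_root p ^ ((p - 1) * t * i')))"
      unfolding sum_distrib_left by (rule sum.swap)
    also have "\<dots> = (\<Sum>i'<p. if i' = i then b (m, i') * of_nat p else 0)"
    proof (intro sum.cong refl)
      fix i' assume "i' \<in> {..<p}"
      then show "b (m, i') * (\<Sum>t<p. prim_root p ^ (t * i) * prim_root p ^ ((p - 1) * t * i')) =
          (if i' = i then b (m, i') * of_nat p else 0)"
        using sum_root_powers[OF p mi(3), of i'] by auto
    qed
    also have "\<dots> = b (m, i) * of_nat p" using mi by simp
    finally show "b x = 0" using p0 mi by simp
  qed
  obtain K where K: "{..<q} \<times> {..<p} \<subseteq> K" "K \<subseteq> {..q} \<times> {..<p}" "indep n K g" "card K = n"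
    by (rule basis_between[OF _ _ indI span]) auto
  define S where "S = {i. (q, i) \<in> K}"
  have S: "S \<subseteq> {..<p}" using K(2) by (auto simp: S_def)
  have finS: "finite S" using S finite_subset by blast
  have K_eq: "K = {..<q} \<times> {..<p} \<union> {q} \<times> S"
  proof (intro equalityI subsetI)
    fix x assume x: "x \<in> K"
    then obtain m i where "x = (m, i)" "m \<le> q" "i < p" using K(2) by blast
    then show "x \<in> {..<q} \<times> {..<p} \<union> {q} \<times> S" using x by (cases "m = q") (auto simp: S_def)
  qed (use K(1) in \<open>auto simp: S_def\<close>)
  have "card K = q * p + card S"
    unfolding K_eq using finS by (subst card_Un_disjoint) (auto simp: card_cartesian_product)
  then have cardS: "card S = a" using K(4) n by simp
  define E where "E = exponents p q S"
  let ?dm = "\<lambda>e. (e div p, e mod p)"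
  have dm_E: "?dm ` E = K"
  proof (intro equalityI subsetI)
    fix x assume "x \<in> ?dm ` E"
    then obtain e where e: "e \<in> E" "x = ?dm e" by blast
    from e(1) consider "e < q * p" | s where "s \<in> S" "e = q * p + s" by (auto simp: E_def exponents_def)
    then show "x \<in> K"
    proof cases
      case 1
      then have "x \<in> {..<q} \<times> {..<p}" using e(2) p0 by (simp add: less_mult_imp_div_less)
      then show ?thesis using K(1) by blast
    next
      case (2 s)
      then have "s < p" using S by blast
      then have "x = (q, s)" using 2 e(2) by simp
      then show ?thesis using 2 by (simp add: S_def)
    qed
  next
    fix x assume x: "x \<in> K"
    then obtain m i where mi: "x = (m, i)" "i < p" "m < q \<or> m = q \<and> i \<in> S" unfolding K_eq using S by blast
    have "m * p + i < q * p" if "m < q"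
    proof -
      have "m * p + i < Suc m * p" using mi(2) by simp
      also have "\<dots> \<le> q * p" using that by (intro mult_le_mono1) simp
      finally show ?thesis .
    qed
    then have "m * p + i \<in> E" using mi(3) by (auto simp: E_def exponents_def)
    moreover have "x = ?dm (m * p + i)" using mi by simp
    ultimately show "x \<in> ?dm ` E" by (rule rev_image_eqI)
  qed
  have bijE: "bij_betw (nth_elem E) {..<n} E"
    using nth_elem_bij[of E] card_exponents[OF finS, of p q] finS cardS n by (simp add: E_def)
  have "inj ?dm" by (intro injI) (metis div_mult_mod_eq prod.inject)
  then have inj_c: "inj_on (\<lambda>c. ?dm (nth_elem E c)) {..<n}"
    using comp_inj_on[OF bij_betw_imp_inj_on[OF bijE], of ?dm] by (simp add: inj_on_subset o_def)
  have "(\<lambda>c. ?dm (nth_elem E c)) ` {..<n} = K"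
    using dm_E bij_betw_imp_surj_on[OF bijE] by (simp flip: image_image[of ?dm "nth_elem E"])
  then have ind_c: "indep n {..<n} (\<lambda>c. g (?dm (nth_elem E c)))"
    using K(3) indep_reindex[OF inj_c, of n g] by simp
  define P where "P = mat n n (\<lambda>(j, c). g (?dm (nth_elem E c)) $ j)"
  have P: "P \<in> carrier_mat n n" by (simp add: P_def)
  have "det P \<noteq> 0"
  proof
    assume "det P = 0"
    then obtain x where x: "x \<in> carrier_vec n" "x \<noteq> 0\<^sub>v n" "P *\<^sub>v x = 0\<^sub>v n"
      using det_0_iff_vec_prod_zero[OF P] by blast
    have "(\<Sum>c<n. x $ c * g (?dm (nth_elem E c)) $ j) = 0" if j: "j < n" for j
    proof -
      have "(\<Sum>c<n. x $ c * g (?dm (nth_elem E c)) $ j) = (\<Sum>c<n. P $$ (j, c) * x $ c)"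
        using j by (intro sum.cong) (auto simp: P_def)
      also have "\<dots> = (P *\<^sub>v x) $ j" by (rule mult_mat_vec_index[OF P x(1) j, symmetric])
      also have "\<dots> = 0" unfolding x(3) using j by simp
      finally show ?thesis .
    qed
    then have "x $ c = 0" if "c < n" for c using indepD[OF ind_c, of "\<lambda>c. x $ c" c] that by simp
    then have "x = 0\<^sub>v n" using x(1) by (intro eq_vecI) auto
    then show False using x(2) by simp
  qed
  then have P_GL: "P \<in> carrier (GL n)" using P by (simp add: carrier_GL)
  have "P * diag_model p q S = A * P"
  proof (rule eq_matI)
    fix j c assume "j < dim_row (A * P)" "c < dim_col (A * P)"
    then have j: "j < n" and c: "c < n" using A P by auto
    let ?e = "nth_elem E c"
    have "(A * P) $$ (j, c) = (A *\<^sub>v g (?dm ?e)) $ j"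
      using j c A P g_carrier[of "?dm ?e"]
      by (simp add: scalar_prod_def P_def)
    also have "\<dots> = prim_root p ^ (?e mod p) * g (?dm ?e) $ j" by (rule eigen[OF j])
    also have "\<dots> = prim_root p ^ ?e * P $$ (j, c)" using j c by (simp add: P_def prim_root_power_mod[OF p0])
    also have "\<dots> = (P * diag_model p q S) $$ (j, c)"
      using j c unfolding diag_model_def cardS n[symmetric] E_def
      by (simp add: mat_diag_mult_right[OF P] mult.commute)
    finally show "(P * diag_model p q S) $$ (j, c) = (A * P) $$ (j, c)" ..
  qed (use A P in \<open>auto simp: diag_model_def mat_diag_def cardS n\<close>)
  then show thesis by (rule that[OF S cardS P_GL])
qed

section \<open>Every admissible group of prime order is conjugate to a diagonal model\<close>

text \<open>A maximal set of representatives of disjoint free orbits leaves only fixed points outside its orbits,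
  because \<open>p\<close> is prime and so an orbit that is not free is a point. If there are at most \<open>q\<close> such orbits, they
  can be filled up with fixed points to an invariant set of any admitted size \<open>N\<close>.\<close>
lemma free_orbits_or_invariant_subset:
  fixes \<sigma> :: "'b \<Rightarrow> 'b"
  assumes p: "prime p" and fin: "finite T" and closed: "\<And>x. x \<in> T \<Longrightarrow> \<sigma> x \<in> T"
    and period: "\<And>x. x \<in> T \<Longrightarrow> (\<sigma> ^^ p) x = x" and N: "N \<le> card T" "q * p + 3 \<le> N"
  shows "(\<exists>R\<subseteq>T. card R = q + 1 \<and> inj_on (\<lambda>(x, t). (\<sigma> ^^ t) x) (R \<times> {..<p})) \<or>
    (\<exists>X\<subseteq>T. card X = N \<and> \<sigma> ` X \<subseteq> X \<and> 3 \<le> card {x \<in> X. \<sigma> x = x})"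
proof -
  let ?orb = "\<lambda>(x, t). (\<sigma> ^^ t) x"
  define \<Phi> where "\<Phi> R \<longleftrightarrow> R \<subseteq> T \<and> inj_on ?orb (R \<times> {..<p})" for R
  have p0: "p > 0" using p prime_gt_0_nat by blast
  have closed': "(\<sigma> ^^ t) x \<in> T" if "x \<in> T" for x t
    using that by (induction t) (auto intro: closed)
  have "finite {R. \<Phi> R}" using fin by (auto intro: finite_subset[of _ "Pow T"] simp: \<Phi>_def)
  moreover have "\<Phi> {}" by (simp add: \<Phi>_def)
  ultimately obtain R where R: "\<Phi> R" and maxi: "\<And>Q. \<Phi> Q \<Longrightarrow> R \<subseteq> Q \<Longrightarrow> R = Q"
    using finite_has_maximal2[of "{R. \<Phi> R}" "{}"] by auto
  have RT: "R \<subseteq> T" and inj: "inj_on ?orb (R \<times> {..<p})" using R by (auto simp: \<Phi>_def)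
  have finR: "finite R" using RT fin finite_subset by blast
  show ?thesis
  proof (cases "q + 1 \<le> card R")
    case True
    then obtain Q where Q: "Q \<subseteq> R" "card Q = q + 1"
      by (meson obtain_subset_with_card_n)
    have "Q \<times> {..<p} \<subseteq> R \<times> {..<p}" using Q(1) by blast
    then have "inj_on ?orb (Q \<times> {..<p})" by (rule inj_on_subset[OF inj])
    then show ?thesis using Q RT by blast
  next
    case False
    define Orb where "Orb = ?orb ` (R \<times> {..<p})"
    have Orb: "Orb \<subseteq> T" using RT closed' by (auto simp: Orb_def)
    have finOrb: "finite Orb" using finR by (simp add: Orb_def)
    have "card Orb = card R * p" unfolding Orb_def using inj by (simp add: card_image card_cartesian_product)
    also have "\<dots> \<le> q * p" using False by (intro mult_le_mono1) simp
    finally have card_Orb: "card Orb \<le> q * p" .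
    have in_Orb: "(\<sigma> ^^ k) y \<in> Orb" if "y \<in> R" for k y
    proof -
      have "(\<sigma> ^^ (k mod p)) y = (\<sigma> ^^ k) y" using that RT by (intro funpow_mod_eq period) auto
      moreover have "(y, k mod p) \<in> R \<times> {..<p}" using that p0 by simp
      ultimately show ?thesis unfolding Orb_def by (metis (mono_tags, lifting) case_prod_conv image_eqI)
    qed
    have cancel: "x = (\<sigma> ^^ ((p - t) + t')) y" if "x \<in> T" "t < p" "(\<sigma> ^^ t) x = (\<sigma> ^^ t') y" for x y t t'
    proof -
      have "x = (\<sigma> ^^ ((p - t) + t)) x" using period[OF that(1)] that(2) by simp
      then show ?thesis unfolding funpow_add using that(3) by simp
    qed
    have self: "\<sigma> x = x" if x: "x \<in> T" and t: "t < t'" "t' < p" and eq: "(\<sigma> ^^ t) x = (\<sigma> ^^ t') x" for x t t'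
    proof -
      define d where "d = t' - t"
      have d: "0 < d" "d < p" using t by (auto simp: d_def)
      have "x = (\<sigma> ^^ ((p - t) + t')) x" using cancel[OF x _ eq] t by simp
      also have "(p - t) + t' = p + d" using t by (simp add: d_def)
      also have "(\<sigma> ^^ (p + d)) x = (\<sigma> ^^ (d + p)) x" by (simp only: add.commute)
      also have "\<dots> = (\<sigma> ^^ d) x" unfolding funpow_add using period[OF x] by simp
      finally have fix_d: "(\<sigma> ^^ d) x = x" ..
      \<comment> \<open>The \<open>d\<close>-th and the \<open>p\<close>-th iterates fix \<open>x\<close>, hence so does the iterate whose order is their gcd.\<close>
      have "coprime d p" using p d by (metis coprime_commute nat_dvd_not_less prime_imp_coprime)
      then obtain k where k: "[d * k = 1] (mod p)" using cong_solve_coprime_nat by auto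
      have p1: "p > 1" using p prime_gt_1_nat by blast
      have "x = (\<sigma> ^^ (d * k mod d)) x" by simp
      also have "\<dots> = (\<sigma> ^^ (d * k)) x" by (rule funpow_mod_eq[OF fix_d])
      also have "\<dots> = (\<sigma> ^^ (d * k mod p)) x" by (rule funpow_mod_eq[OF period[OF x], symmetric])
      also have "d * k mod p = 1" using k p1 by (simp add: cong_def)
      finally show ?thesis by simp
    qed
    have fixed: "\<sigma> x = x" if x: "x \<in> T - Orb" for x
    proof (rule ccontr)
      assume nf: "\<sigma> x \<noteq> x"
      have notin: "(\<sigma> ^^ t) x \<noteq> (\<sigma> ^^ t') y" if "t < p" "y \<in> R" for t t' y
        using cancel[of x t t' y] that x in_Orb[OF that(2)] by auto
      have "inj_on ?orb (insert x R \<times> {..<p})"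
      proof (rule inj_onI)
        fix u v assume u: "u \<in> insert x R \<times> {..<p}" and v: "v \<in> insert x R \<times> {..<p}" and uv: "?orb u = ?orb v"
        obtain y t y' t' where yt: "u = (y, t)" "v = (y', t')" by (meson surj_pair)
        have t: "t < p" "t' < p" and eq: "(\<sigma> ^^ t) y = (\<sigma> ^^ t') y'" using u v uv yt by auto
        consider "y \<in> R" "y' \<in> R" | "y = x" "y' = x" | "y = x" "y' \<in> R" | "y \<in> R" "y' = x"
          using u v yt by auto
        then show "u = v"
        proof cases
          case 1
          then show ?thesis using inj_onD[OF inj uv] yt t by simp
        next
          case 2
          have "t = t'"
          proof (rule ccontr)
            assume "t \<noteq> t'"
            then consider "t < t'" | "t' < t" by linarith
            then show False using self[of x t t'] self[of x t' t] x nf t eq 2 by cases auto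
          qed
          then show ?thesis using 2 yt by simp
        next
          case 3
          then show ?thesis using notin[OF t(1)] eq by blast
        next
          case 4
          then show ?thesis using notin[OF t(2), of y t] eq by auto
        qed
      qed
      then have "\<Phi> (insert x R)" using RT x by (simp add: \<Phi>_def)
      then have "x \<in> R" using maxi[of "insert x R"] by blast
      then show False using in_Orb[of x 0] x by simp
    qed
    have "N - card Orb \<le> card (T - Orb)"
      using N Orb finOrb by (simp add: card_Diff_subset)
    then obtain F where F: "F \<subseteq> T - Orb" "card F = N - card Orb"
      by (meson obtain_subset_with_card_n)
    have finF: "finite F" using F(1) fin finite_subset by blast
    have "card (Orb \<union> F) = card Orb + card F"
      using F(1) finOrb finF by (intro card_Un_disjoint) auto
    then have "card (Orb \<union> F) = N" using F(2) card_Orb N by simp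
    moreover have "\<sigma> ` (Orb \<union> F) \<subseteq> Orb \<union> F"
    proof
      fix z assume "z \<in> \<sigma> ` (Orb \<union> F)"
      then consider y t where "y \<in> R" "z = \<sigma> ((\<sigma> ^^ t) y)" | x where "x \<in> F" "z = \<sigma> x"
        by (auto simp: Orb_def)
      then show "z \<in> Orb \<union> F"
      proof cases
        case (1 y t)
        then show ?thesis using in_Orb[of y "Suc t"] by simp
      next
        case (2 x)
        then show ?thesis using F(1) fixed[of x] by auto
      qed
    qed
    moreover have "3 \<le> card {x \<in> Orb \<union> F. \<sigma> x = x}"
    proof -
      have "F \<subseteq> {x \<in> Orb \<union> F. \<sigma> x = x}" using F(1) fixed by blast
      then have "card F \<le> card {x \<in> Orb \<union> F. \<sigma> x = x}" using finOrb finF by (intro card_mono) auto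
      then show ?thesis using F(2) card_Orb N by simp
    qed
    moreover have "Orb \<union> F \<subseteq> T" using Orb F(1) by blast
    ultimately show ?thesis by blast
  qed
qed

lemma smult_power_mat:
  "A \<in> carrier_mat n n \<Longrightarrow> (k \<cdot>\<^sub>m A) ^\<^sub>m t = k ^ t \<cdot>\<^sub>m (A ^\<^sub>m t :: complex mat)"
proof (induction t)
  case (Suc t)
  then have "A ^\<^sub>m t \<in> carrier_mat n n" by simp
  with Suc show ?case
    by (simp add: mult_smult_assoc_mat[of _ n n _ n] mult_smult_distrib[of _ n n _ n] mult.commute)
qed simp

lemma iterate_mult_mat_vec:
  assumes "A \<in> carrier_mat n n" and "v \<in> carrier_vec n"
  shows "((\<lambda>v. A *\<^sub>v v) ^^ t) v = A ^\<^sub>m t *\<^sub>v v"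
  using assms(2)
proof (induction t arbitrary: v)
  case (Suc t)
  have "((\<lambda>v. A *\<^sub>v v) ^^ Suc t) v = ((\<lambda>v. A *\<^sub>v v) ^^ t) (A *\<^sub>v v)"
    by (simp add: funpow_swap1)
  also have "\<dots> = A ^\<^sub>m t *\<^sub>v (A *\<^sub>v v)" using Suc assms(1) by (intro Suc.IH) simp
  also have "\<dots> = (A ^\<^sub>m t * A) *\<^sub>v v"
    using assms(1) Suc.prems by (intro assoc_mult_mat_vec[symmetric, of _ n n _ n]) auto
  finally show ?case by simp
qed (use assms(1) in simp)

text \<open>The \<open>p\<close>-th power of a representing matrix is scalar, and dividing by a \<open>p\<close>-th root of the scalar makes
  it the identity.\<close>
lemma order_p_representative:
  assumes p: "prime p" and g: "g \<in> carrier (PGL n)" "g [^]\<^bsub>PGL n\<^esub> p = \<one>\<^bsub>PGL n\<^esub>"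
  obtains A where "A \<in> carrier (GL n)" "g = pgl n A" "A ^\<^sub>m p = 1\<^sub>m n"
proof -
  have p0: "p > 0" using p prime_gt_0_nat by blast
  obtain B where B: "B \<in> carrier (GL n)" "g = pgl n B" using g(1) unfolding carrier_PGL by blast
  then have Bc: "B \<in> carrier_mat n n" "det B \<noteq> 0" by (auto simp: carrier_GL)
  have "pgl n (B ^\<^sub>m p) = pgl n (1\<^sub>m n)" using g(2) B pow_pgl(1)[OF B(1)] by (simp add: one_PGL)
  then obtain c where c: "c \<noteq> 0" "B ^\<^sub>m p = c \<cdot>\<^sub>m 1\<^sub>m n"
    using Bc by (subst (asm) pgl_eq_iff) auto
  have "card {z. z ^ p = c} = p" using card_nth_roots[OF c(1) p0] .
  then have "{z. z ^ p = c} \<noteq> {}" using p0 by (metis card.empty less_irrefl)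
  then obtain d where d: "d ^ p = c" by blast
  have d0: "d \<noteq> 0" using d c(1) p0 by (auto simp: power_0_left)
  define A where "A = inverse d \<cdot>\<^sub>m B"
  have A: "A \<in> carrier_mat n n" using Bc by (simp add: A_def)
  have "A ^\<^sub>m p = 1\<^sub>m n"
    unfolding A_def smult_power_mat[OF Bc(1)] c(2) using d c(1) by (simp add: power_inverse)
  moreover have "A \<in> carrier (GL n)" using Bc d0 by (simp add: carrier_GL A_def det_smult)
  moreover have "g = pgl n A"
    unfolding B(2) using d0 Bc A by (subst pgl_eq_iff) (auto simp: A_def intro!: exI[of _ d])
  ultimately show thesis using that by blast
qed

lemma mult_mat_vec_eq_0_iff:
  assumes "A \<in> carrier (GL n)" and "v \<in> carrier_vec n"
  shows "A *\<^sub>v v = 0\<^sub>v n \<longleftrightarrow> v = 0\<^sub>v n"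
proof
  show "A *\<^sub>v v = 0\<^sub>v n \<Longrightarrow> v = 0\<^sub>v n"
    using assms det_0_iff_vec_prod_zero[of A n] unfolding carrier_GL by blast
next
  assume "v = 0\<^sub>v n"
  then show "A *\<^sub>v v = 0\<^sub>v n" using assms(1) by (intro eq_vecI) (auto simp: carrier_GL)
qed

text \<open>The alternative of many fixed points is excluded because it makes the generator trivial, so there are
  \<open>q + 1\<close> free orbits, and their points are independent as far as the dimension permits.\<close>
lemma admissible_imp_conjugate_to_model:
  assumes p: "prime p" and a: "2 \<le> a" "a + 2 \<le> p" and n: "n = q * p + a"
    and H: "admissible n H" "card H = p"
  obtains S where "S \<subseteq> {..<p}" "card S = a"
    "conjugacy_class (PGL n) H = conjugacy_class (PGL n) (generate (PGL n) {model_elem p q S})"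
proof -
  interpret PGL: group "PGL n" by (rule group_PGL)
  have p0: "p > 0" and p2: "p \<ge> 2" using p prime_gt_0_nat prime_ge_2_nat by blast+
  obtain T where sub: "subgroup H (PGL n)" and T: "T \<subseteq> proj_points n" "finite T" "n + 2 \<le> card T"
    and gp: "general_position n T" and HT: "H \<subseteq> Aut n T"
    using H(1) unfolding admissible_def by blast
  have "\<not> H \<subseteq> {\<one>\<^bsub>PGL n\<^esub>}"
  proof
    assume "H \<subseteq> {\<one>\<^bsub>PGL n\<^esub>}"
    then have "card H \<le> card {\<one>\<^bsub>PGL n\<^esub>}" by (intro card_mono) auto
    then show False using H(2) p2 by simp
  qed
  then obtain g where g: "g \<in> H" "g \<noteq> \<one>\<^bsub>PGL n\<^esub>" by blast
  note gp_order = PGL.prime_card_subgroup_eq_generate[OF p sub H(2) g]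
  have gc: "g \<in> carrier (PGL n)" using subgroup.mem_carrier[OF sub g(1)] .
  obtain A where A: "A \<in> carrier (GL n)" "g = pgl n A" "A ^\<^sub>m p = 1\<^sub>m n"
    using order_p_representative[OF p gc gp_order(1)] by blast
  have Ac: "A \<in> carrier_mat n n" using A(1) by (simp add: carrier_GL)
  define \<sigma> where "\<sigma> = proj_act g"
  define r where "r P = (SOME v. v \<in> carrier_vec n \<and> v \<noteq> 0\<^sub>v n \<and> P = line v)" for P
  have r: "r P \<in> carrier_vec n \<and> r P \<noteq> 0\<^sub>v n \<and> P = line (r P)" if "P \<in> T" for P
    unfolding r_def
  proof (rule someI_ex)
    show "\<exists>v. v \<in> carrier_vec n \<and> v \<noteq> 0\<^sub>v n \<and> P = line v"
      using that T(1) unfolding proj_points_def by blast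
  qed
  have rc: "r P \<in> carrier_vec n" and r0: "r P \<noteq> 0\<^sub>v n" and rl: "line (r P) = P" if "P \<in> T" for P
    using r[OF that] by simp_all
  have \<sigma>_line: "\<sigma> (line v) = line (A *\<^sub>v v)" if "v \<in> carrier_vec n" for v
    unfolding \<sigma>_def A(2) by (rule proj_act_line[OF Ac that])
  have \<sigma>T: "\<sigma> ` T = T" using HT g(1) unfolding Aut_def \<sigma>_def by blast
  have closed: "\<sigma> P \<in> T" if "P \<in> T" for P using \<sigma>T that by blast
  let ?W = "\<lambda>t v. ((\<lambda>v. A *\<^sub>v v) ^^ t) v"
  have Wc: "?W t v \<in> carrier_vec n" if "v \<in> carrier_vec n" for t v
    using that Ac by (induction t) auto
  have \<sigma>_pow: "(\<sigma> ^^ t) (line v) = line (?W t v)" if "v \<in> carrier_vec n" for t v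
  proof (induction t)
    case (Suc t)
    have "(\<sigma> ^^ Suc t) (line v) = \<sigma> (line (?W t v))" by (simp only: funpow.simps o_apply Suc.IH)
    also have "\<dots> = line (A *\<^sub>v ?W t v)" by (rule \<sigma>_line[OF Wc[OF that]])
    finally show ?case by (simp only: funpow.simps o_apply)
  qed simp
  have Wp: "?W p v = v" if "v \<in> carrier_vec n" for v
    unfolding iterate_mult_mat_vec[OF Ac that] A(3) using that by simp
  have period: "(\<sigma> ^^ p) P = P" if P: "P \<in> T" for P
    using \<sigma>_pow[OF rc[OF P], of p] unfolding Wp[OF rc[OF P]] rl[OF P] .
  have dich: "(\<exists>R\<subseteq>T. card R = q + 1 \<and> inj_on (\<lambda>(x, t). (\<sigma> ^^ t) x) (R \<times> {..<p})) \<or>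
      (\<exists>X\<subseteq>T. card X = n + 2 \<and> \<sigma> ` X \<subseteq> X \<and> 3 \<le> card {x \<in> X. \<sigma> x = x})"
    by (rule free_orbits_or_invariant_subset[OF p T(2) closed period T(3)]) (use n a in auto)
  have "\<not> (\<exists>X\<subseteq>T. card X = n + 2 \<and> \<sigma> ` X \<subseteq> X \<and> 3 \<le> card {x \<in> X. \<sigma> x = x})"
  proof
    assume "\<exists>X\<subseteq>T. card X = n + 2 \<and> \<sigma> ` X \<subseteq> X \<and> 3 \<le> card {x \<in> X. \<sigma> x = x}"
    then obtain X where X: "X \<subseteq> T" "card X = n + 2" "\<sigma> ` X \<subseteq> X" "3 \<le> card {x \<in> X. \<sigma> x = x}" by blast
    have finX: "finite X" using X(1) T(2) by (rule finite_subset)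
    have injT: "inj_on \<sigma> T" using \<sigma>T T(2) by (intro eq_card_imp_inj_on) simp_all
    have "inj_on \<sigma> X" using injT X(1) by (rule inj_on_subset)
    then have bij: "bij_betw \<sigma> X X" using endo_inj_surj[OF finX X(3)] by (simp add: bij_betw_def)
    have ex\<alpha>: "\<forall>P\<in>X. \<exists>k. A *\<^sub>v r P = k \<cdot>\<^sub>v r (\<sigma> P)"
    proof
      fix P assume "P \<in> X"
      then have P: "P \<in> T" using X(1) by blast
      have "line (A *\<^sub>v r P) = line (r (\<sigma> P))"
        using \<sigma>_line[OF rc[OF P]] unfolding rl[OF P] rl[OF closed[OF P]] by (rule sym)
      then show "\<exists>k. A *\<^sub>v r P = k \<cdot>\<^sub>v r (\<sigma> P)" by (rule line_eqD)
    qed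
    from bchoice[OF this] obtain \<alpha> where \<alpha>: "\<And>P. P \<in> X \<Longrightarrow> A *\<^sub>v r P = \<alpha> P \<cdot>\<^sub>v r (\<sigma> P)" by blast
    have \<alpha>0: "\<alpha> P \<noteq> 0" if P: "P \<in> X" for P
    proof
      assume "\<alpha> P = 0"
      have PT: "P \<in> T" using P X(1) by blast
      have "A *\<^sub>v r P = 0\<^sub>v n"
        unfolding \<alpha>[OF P] \<open>\<alpha> P = 0\<close> using rc[OF closed[OF PT]] by (intro eq_vecI) auto
      then show False using mult_mat_vec_eq_0_iff[OF A(1) rc[OF PT]] r0[OF PT] by blast
    qed
    have ind: "indep n Y r" if Y: "Y \<subseteq> X" "card Y = n" for Y
    proof (rule general_position_imp_indep[OF gp])
      have YT: "Y \<subseteq> T" using Y(1) X(1) by blast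
      show "finite Y" using YT T(2) by (rule finite_subset)
      show "card Y \<le> n" using Y(2) by simp
      show "r i \<in> carrier_vec n" "line (r i) \<in> T" if "i \<in> Y" for i
        using that YT rc[of i] rl[of i] by auto
      show "inj_on (\<lambda>i. line (r i)) Y"
        by (rule inj_onI) (use YT rl in \<open>metis subsetD\<close>)
    qed
    obtain Fx where Fx: "Fx \<subseteq> {x \<in> X. \<sigma> x = x}" "card Fx = 3"
      using X(4) by (meson obtain_subset_with_card_n)
    then obtain y1 y2 y3 where ys: "Fx = {y1, y2, y3}" "y1 \<noteq> y2" "y1 \<noteq> y3" "y2 \<noteq> y3"
      using card_3_iff[of Fx] by auto
    have fx: "y1 \<in> X" "y2 \<in> X" "y3 \<in> X" "\<sigma> y1 = y1" "\<sigma> y2 = y2" "\<sigma> y3 = y3"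
      using Fx(1) ys(1) by auto
    have rcX: "r P \<in> carrier_vec n" if "P \<in> X" for P using rc that X(1) by blast
    obtain \<mu> where \<mu>: "\<And>x. x \<in> X \<Longrightarrow> \<sigma> x = x \<and> \<alpha> x = \<mu>"
      using three_fixed_points_imp_scalar[OF Ac finX X(2) rcX ind bij \<alpha>0 \<alpha> fx(1-3) ys(2-4) fx(4-6)] by blast
    have "n \<le> card X" using X(2) by simp
    then obtain Y where Y: "Y \<subseteq> X" "card Y = n" by (meson obtain_subset_with_card_n)
    have "A = \<mu> \<cdot>\<^sub>m 1\<^sub>m n"
    proof (rule mat_eq_on_basis[OF Ac _ _ ind[OF Y] Y(2)])
      show "finite Y" using Y(1) finX by (rule finite_subset)
      fix y assume "y \<in> Y"
      then have y: "y \<in> X" using Y(1) by blast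
      show "r y \<in> carrier_vec n" using rcX[OF y] .
      have "A *\<^sub>v r y = \<mu> \<cdot>\<^sub>v r y" using \<alpha>[OF y] \<mu>[OF y] by simp
      then show "A *\<^sub>v r y = \<mu> \<cdot>\<^sub>m 1\<^sub>m n *\<^sub>v r y" using rcX[OF y] by (simp add: smult_mat_mult_vec[of _ n n])
    qed simp
    moreover have "\<mu> \<noteq> 0" using \<alpha>0[OF fx(1)] \<mu>[OF fx(1)] by simp
    ultimately have "g = pgl n (1\<^sub>m n)" unfolding A(2) by (subst pgl_eq_iff) auto
    then show False using g(2) by (simp add: one_PGL)
  qed
  then obtain R where R: "R \<subseteq> T" "card R = q + 1" "inj_on (\<lambda>(x, t). (\<sigma> ^^ t) x) (R \<times> {..<p})"
    using dich by blast
  have finR: "finite R" using R(1) T(2) by (rule finite_subset)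
  obtain b where "bij_betw b {0..<card R} R" using ex_bij_betw_nat_finite[OF finR] by blast
  then have b: "bij_betw b {..q} R" unfolding R(2) by (simp add: atLeast0LessThan lessThan_Suc_atMost)
  have bT: "b m \<in> T" if "m \<le> q" for m using bij_betwE[OF b] that R(1) by blast
  \<comment> \<open>The value \<open>0\<close> outside the chosen orbits makes the iteration rules hold for every index.\<close>
  define w where "w m t = ?W t (if m \<le> q then r (b m) else 0\<^sub>v n)" for m t
  have start: "(if m \<le> q then r (b m) else 0\<^sub>v n) \<in> carrier_vec n" for m
    using rc[OF bT] by simp
  have line_w: "line (w m t) = (\<sigma> ^^ t) (b m)" if "m \<le> q" for m t
    using \<sigma>_pow[OF rc[OF bT[OF that]], of t] unfolding rl[OF bT[OF that]]
    by (simp only: w_def that if_True)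
  obtain S P where S: "S \<subseteq> {..<p}" "card S = a" and P: "P \<in> carrier (GL n)" "P * diag_model p q S = A * P"
  proof (rule cyclic_orbits_imp_diag_model[OF p _ n Ac, of w])
    show "a < p" using a by simp
    show "w m t \<in> carrier_vec n" for m t unfolding w_def by (rule Wc[OF start])
    show "A *\<^sub>v w m t = w m (Suc t)" for m t by (simp add: w_def)
    show "w m p = w m 0" for m using Wp[OF start, of m] by (simp add: w_def)
    fix Y assume Y: "Y \<subseteq> {..q} \<times> {..<p}" "card Y \<le> n"
    show "indep n Y (\<lambda>(m, t). w m t)"
    proof (rule general_position_imp_indep[OF gp])
      show "finite Y" using Y(1) by (rule finite_subset) simp
      show "card Y \<le> n" by fact
      show "(case i of (m, t) \<Rightarrow> w m t) \<in> carrier_vec n" for i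
        by (cases i) (simp add: w_def Wc[OF start])
      have \<sigma>pT: "(\<sigma> ^^ t) x \<in> T" if "x \<in> T" for t x using that by (induction t) (auto intro: closed)
      fix i assume "i \<in> Y"
      then obtain m t where "i = (m, t)" "m \<le> q" using Y(1) by blast
      then show "line (case i of (m, t) \<Rightarrow> w m t) \<in> T" using line_w \<sigma>pT bT by simp
    next
      show "inj_on (\<lambda>i. line (case i of (m, t) \<Rightarrow> w m t)) Y"
      proof (rule inj_onI)
        fix i i' assume i: "i \<in> Y" "i' \<in> Y" and eq: "line (case i of (m, t) \<Rightarrow> w m t) = line (case i' of (m, t) \<Rightarrow> w m t)"
        obtain m t m' t' where mt: "i = (m, t)" "i' = (m', t')" by (meson surj_pair)
        have le: "m \<le> q" "m' \<le> q" "t < p" "t' < p" using i Y(1) mt by auto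
        have "(\<sigma> ^^ t) (b m) = (\<sigma> ^^ t') (b m')" using eq unfolding mt prod.case line_w[OF le(1)] line_w[OF le(2)] .
        moreover have "b m \<in> R" "b m' \<in> R" using bij_betwE[OF b] le by auto
        ultimately have "(b m, t) = (b m', t')" using le by (intro inj_onD[OF R(3)]) auto
        then show "i = i'" using inj_onD[OF bij_betw_imp_inj_on[OF b], of m m'] le mt by simp
      qed
    qed
  qed (rule that)
  have two: "2 \<le> card S" and n_S: "n = q * p + card S" using a S n by simp_all
  note model = model_elem_props[OF p S(1) two n_S]
  have D: "diag_model p q S \<in> carrier (GL n)" using diag_model_in_GL[of p q S] n_S by simp
  have "pgl n P \<otimes>\<^bsub>PGL n\<^esub> model_elem p q S \<otimes>\<^bsub>PGL n\<^esub> inv\<^bsub>PGL n\<^esub> pgl n P = g"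
    using conjugate_pgl_eq_iff[OF P(1) D A(1)] P(2) unfolding A(2) model_elem_def n_S[symmetric]
    by (auto intro!: exI[of _ 1])
  also have "g = g [^]\<^bsub>PGL n\<^esub> (1 :: nat)" using gc by simp
  finally have "conjugacy_class (PGL n) (generate (PGL n) {model_elem p q S}) =
      conjugacy_class (PGL n) (generate (PGL n) {g})"
    using PGL.conjugacy_class_generate_eq_iff[OF p model gc gp_order(1) g(2)] pgl_in_carrier[OF P(1)] by blast
  then have "conjugacy_class (PGL n) H = conjugacy_class (PGL n) (generate (PGL n) {model_elem p q S})"
    using gp_order(2) by simp
  then show thesis by (rule that[OF S])
qed

section \<open>Counting conjugacy classes\<close>

definition model_class :: "nat \<Rightarrow> nat \<Rightarrow> nat set \<Rightarrow> complex mat set set set" where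
  "model_class p q S =
     conjugacy_class (PGL (q * p + card S)) (generate (PGL (q * p + card S)) {model_elem p q S})"

lemma admissible_classes_eq_image:
  assumes p: "prime p" and a: "2 \<le> a" "a + 2 \<le> p"
  shows "admissible_classes (q * p + a) p = model_class p q ` {S. S \<subseteq> {..<p} \<and> card S = a}"
proof (intro equalityI subsetI)
  fix C assume "C \<in> admissible_classes (q * p + a) p"
  then obtain H where H: "admissible (q * p + a) H" "card H = p" "C = conjugacy_class (PGL (q * p + a)) H"
    unfolding admissible_classes_def by blast
  obtain S where "S \<subseteq> {..<p}" "card S = a" "C = model_class p q S"
    using admissible_imp_conjugate_to_model[OF p a refl H(1,2)] unfolding H(3) model_class_def by metis
  then show "C \<in> model_class p q ` {S. S \<subseteq> {..<p} \<and> card S = a}" by blast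
next
  fix C assume "C \<in> model_class p q ` {S. S \<subseteq> {..<p} \<and> card S = a}"
  then obtain S where S: "S \<subseteq> {..<p}" "card S = a" "C = model_class p q S" by blast
  then show "C \<in> admissible_classes (q * p + a) p"
    using model_group_admissible[OF p S(1) _ refl, of q] a(1)
    unfolding admissible_classes_def model_class_def S(2,3)
    by (intro image_eqI[of _ _ "generate (PGL (q * p + a)) {model_elem p q S}"]) (simp_all add: S(2))
qed

lemma model_class_eq_iff:
  assumes "prime p" and "S \<subseteq> {..<p}" and "S' \<subseteq> {..<p}" and "2 \<le> card S" and "card S' = card S"
  shows "model_class p q S = model_class p q S' \<longleftrightarrow> affine_related p S S'"
  using model_classes_eq_iff[OF assms refl, of q] assms(5) by (simp add: model_class_def)

text \<open>Two images have equal cardinality if their fibres correspond under a bijection of the domains.\<close>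
lemma images_eqpoll:
  assumes h: "bij_betw h X Y" and eq: "\<And>x y. x \<in> X \<Longrightarrow> y \<in> X \<Longrightarrow> f x = f y \<longleftrightarrow> g (h x) = g (h y)"
  shows "f ` X \<approx> g ` Y"
proof -
  define k where "k c = g (h (inv_into X f c))" for c
  have k: "k (f x) = g (h x)" if x: "x \<in> X" for x
    unfolding k_def using eq[of "inv_into X f (f x)" x] x inv_into_into[of "f x" f X] f_inv_into_f[of "f x" f X]
    by blast
  have "inj_on k (f ` X)" by (rule inj_onI) (use k eq in auto)
  moreover have "k ` f ` X = g ` Y"
    using k bij_betw_imp_surj_on[OF h] by (auto simp: image_image intro!: image_eqI)
  ultimately show ?thesis unfolding eqpoll_def bij_betw_def by blast
qed

lemma complement_bij:
  assumes "a \<le> p"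
  shows "bij_betw (\<lambda>S. {..<p} - S) {S. S \<subseteq> {..<p} \<and> card S = a} {S. S \<subseteq> {..<p :: nat} \<and> card S = p - a}"
proof (rule bij_betwI[where g = "\<lambda>S. {..<p} - S"])
  show "(\<lambda>S. {..<p} - S) \<in> {S. S \<subseteq> {..<p} \<and> card S = a} \<rightarrow> {S. S \<subseteq> {..<p} \<and> card S = p - a}"
    by (auto simp: card_Diff_subset finite_subset[of _ "{..<p}"])
  show "(\<lambda>S. {..<p} - S) \<in> {S. S \<subseteq> {..<p} \<and> card S = p - a} \<rightarrow> {S. S \<subseteq> {..<p} \<and> card S = a}"
    using assms by (auto simp: card_Diff_subset finite_subset[of _ "{..<p}"])
qed auto

theorem theorem5:
  fixes p k a :: nat
  assumes "prime p" and "p \<ge> 5"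
    and "p < k + 1"
    and "[k + 1 = a] (mod p)"
    and "2 \<le> a" and "a \<le> p - 2"
  shows "admissible_classes (k + 1) p \<approx> admissible_classes a p
       \<and> admissible_classes (k + 1) p \<approx> admissible_classes (p - a) p"
proof -
  let ?sub = "\<lambda>a. {S. S \<subseteq> {..<p} \<and> card S = a}"
  have a: "a + 2 \<le> p" "2 \<le> p - a" "p - a + 2 \<le> p" using assms by auto
  have "(k + 1) mod p = a" using assms(4) a(1) by (simp add: cong_def)
  then have k: "k + 1 = ((k + 1) div p) * p + a" by (metis div_mult_mod_eq)
  define q where "q = (k + 1) div p"
  have big: "admissible_classes (k + 1) p = model_class p q ` ?sub a"
    using admissible_classes_eq_image[OF assms(1,5) a(1), of q] k by (simp add: q_def)
  have small: "admissible_classes a p = model_class p 0 ` ?sub a"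
    using admissible_classes_eq_image[OF assms(1,5) a(1), of 0] by simp
  have dual: "admissible_classes (p - a) p = model_class p 0 ` ?sub (p - a)"
    using admissible_classes_eq_image[OF assms(1) a(2,3), of 0] by simp
  have "admissible_classes (k + 1) p \<approx> admissible_classes a p"
    unfolding big small
    by (rule images_eqpoll[of "\<lambda>S. S"])
       (use assms(1,5) in \<open>auto simp: model_class_eq_iff bij_betw_def\<close>)
  moreover have "admissible_classes (k + 1) p \<approx> admissible_classes (p - a) p"
    unfolding big dual
  proof (rule images_eqpoll[OF complement_bij])
    fix S S' assume S: "S \<in> ?sub a" "S' \<in> ?sub a"
    then have fin: "finite S" "finite S'" using finite_subset by blast+
    have "model_class p q S = model_class p q S' \<longleftrightarrow> affine_related p S S'"
      using S assms(1,5) by (simp add: model_class_eq_iff)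
    also have "\<dots> \<longleftrightarrow> affine_related p ({..<p} - S) ({..<p} - S')"
      using S assms(1) by (simp add: affine_related_complement)
    also have "\<dots> \<longleftrightarrow> model_class p 0 ({..<p} - S) = model_class p 0 ({..<p} - S')"
      using S a(2) assms(1) fin by (subst model_class_eq_iff) (auto simp: card_Diff_subset)
    finally show "model_class p q S = model_class p q S' \<longleftrightarrow>
        model_class p 0 ({..<p} - S) = model_class p 0 ({..<p} - S')" .
  qed (use a in simp)
  ultimately show ?thesis by blast
qed

end
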